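(* Let $\alpha>1$. (i) There exists a rotationally symmetric $\alpha$-harmonic map $u^*\colon S^2\to S^2$ of degree $1$, of the form $u^*=u_{f}$ with $f\colon[0,\pi]\to\mathbb{R}$, $f(0)=0$, $f(\pi)=3\pi$, which is not a rotation, and it satisfies $E_\alpha(u^* )\geqslant 2^{3\alpha+1}\pi$. (ii) There exist a geodesic disc $D\subset S^2$ and an $\alpha$-harmonic map $D\to S^2$ of degree $1$ which maps the whole boundary circle of $D$ to a single point. (iii) There exist an annulus $A\subset S^2$ bounded by two circles $\{r=r_1\}$ and $\{r=r_2\}$, $0<r_1<r_2<\pi$, and an $\alpha$-harmonic map $A\to S^2$ of degree $1$ which maps each of the two boundary circles of $A$ to a point, the two image points being antipodal points of $S^2$.
   Context: $S^2\subset\mathbb{R}^3$ is the round unit sphere. For $\alpha>1$ and $u\in W^{1,2\alpha}(S^2,S^2)$, $$E_\alpha(u)=\frac12\int_{S^2}(2+|\nabla u|^2)^\alpha\,dA_{S^2}.$$ A map into $S^2$ from $S^2$ or from a domain of $S^2$ is called $\alpha$-harmonic if it is a smooth solution of the Euler-Lagrange equation $\operatorname{div}\big((2+|\nabla u|^2)^{\alpha-1}\nabla u\big)+(2+|\nabla u|^2)^{\alpha-1}|\nabla u|^2u=0$; on all of $S^2$ these are exactly the critical points of $E_\alpha$. The domain sphere is parameterised by $(r,\theta)\mapsto(\sin r\cos\theta,\sin r\sin\theta,\cos r)$, $r\in[0,\pi]$, $\theta\in[0,2\pi]$. For a function $f$ on $[0,\pi]$, $u_f$ denotes the rotationally symmetric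 map $$u_f(r,\theta)=(\sin f(r)\cos\theta,\ \sin f(r)\sin\theta,\ \cos f(r)).$$ A rotation is a map $x\mapsto Rx$ with $R\in SO(3)$. The degree of a map $u$ on a domain $\Omega$ ($\Omega=S^2$, or $\Omega$ a disc or annulus each of whose boundary circles is mapped to a point) is $\deg(u)=\frac1{4\pi}\int_\Omega J(u)\,dA_{S^2}$, with $J(u)=u\cdot(e_1(u)\times e_2(u))$, where $(e_1,e_2)$ is a local oriented orthonormal frame and $e_i(u)$ is the derivative of $u$ in the direction $e_i$. *)

theory Defs
  imports "HOL-Analysis.Analysis"
begin

text \<open>Maps between subsets of the unit sphere are represented by functions
  \<^typ>\<open>real^3 \<Rightarrow> real^3\<close>; all notions below depend only on the values on the domain.\<close>

abbreviation S2 :: "(real^3) set" where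
  "S2 \<equiv> sphere 0 1"

definition sph :: "real \<Rightarrow> real \<Rightarrow> real^3" where
  "sph r \<theta> = vector [sin r * cos \<theta>, sin r * sin \<theta>, cos r]"

text \<open>\<^term>\<open>u\<close> is the map \<open>u_f\<close>.\<close>

definition is_rot_sym_map :: "(real \<Rightarrow> real) \<Rightarrow> (real^3 \<Rightarrow> real^3) \<Rightarrow> bool" where
  "is_rot_sym_map f u \<longleftrightarrow> (\<forall>r\<in>{0..pi}. \<forall>\<theta>\<in>{0..2*pi}. u (sph r \<theta>) = sph (f r) \<theta>)"

definition is_rotation :: "(real^3 \<Rightarrow> real^3) \<Rightarrow> bool" where
  "is_rotation u \<longleftrightarrow> (\<exists>R. rotation_matrix R \<and> (\<forall>x\<in>S2. u x = R *v x))"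

text \<open>The area element is \<open>sin r dr d\<theta>\<close> in the coordinates \<^const>\<open>sph\<close>.\<close>

definition sphere_area :: "(real^3) measure" where
  "sphere_area =
     distr (density lborel
              (\<lambda>p. ennreal (indicator (cbox (0, 0) (pi, 2*pi)) p * sin (fst p))))
           borel (\<lambda>p. sph (fst p) (snd p))"


subsection \<open>Smoothness\<close>

fun Ck_on :: "nat \<Rightarrow> ('a::euclidean_space \<Rightarrow> 'b::real_normed_vector) \<Rightarrow> 'a set \<Rightarrow> bool" where
  "Ck_on 0 F W \<longleftrightarrow> continuous_on W F"
| "Ck_on (Suc k) F W \<longleftrightarrow>
     (\<forall>x\<in>W. F differentiable (at x)) \<and>
     (\<forall>v. Ck_on k (\<lambda>x. frechet_derivative F (at x) v) W)"

text \<open>For an embedded submanifold \<open>M\<close>, possibly with boundary, this is smoothness on \<open>M\<close>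
  (up to and including the boundary).\<close>

definition smooth_map_on :: "(real^3) set \<Rightarrow> (real^3 \<Rightarrow> real^3) \<Rightarrow> bool" where
  "smooth_map_on M u \<longleftrightarrow>
     (\<forall>x\<in>M. \<exists>W F. open W \<and> x \<in> W \<and> (\<forall>k. Ck_on k F W) \<and> (\<forall>y\<in>M \<inter> W. u y = F y))"


subsection \<open>Differential operators on subdomains of the sphere\<close>

text \<open>The sphere is oriented by its outward normal, so that the coordinate frame
  \<open>(\<partial>r, \<partial>\<theta>)\<close> of \<^const>\<open>sph\<close> is positively oriented.\<close>

definition oriented_frame :: "real^3 \<Rightarrow> real^3 \<Rightarrow> real^3 \<Rightarrow> bool" where
  "oriented_frame x e1 e2 \<longleftrightarrow>
     norm e1 = 1 \<and> norm e2 = 1 \<and> e1 \<bullet> e2 = 0 \<and> cross3 e1 e2 = x"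

lemma oriented_frame_exists:
  assumes "x \<in> S2"
  shows "\<exists>e1 e2. oriented_frame x e1 e2"
proof -
  have "norm x = 1" using assms by simp
  obtain A :: "real^3^3" where A: "rotation_matrix A" "A *v axis 3 1 = x"
    by (rule rotation_matrix_exists_basis[of x 3]) (use \<open>norm x = 1\<close> in auto)
  then have A': "orthogonal_transformation (\<lambda>v. A *v v)"
    by (simp add: rotation_matrix_def orthogonal_transformation_matrix)
  have c: "cross3 (axis 1 1) (axis 2 1) = (axis 3 1 :: real^3)"
    by (simp add: cross3_def vec_eq_iff forall_3 axis_def)
  have "cross3 (A *v axis 1 1) (A *v axis 2 1) = x"
    using cross_rotation_matrix[OF A(1)] A(2) c by simp
  moreover have "(A *v axis 1 1) \<bullet> (A *v axis 2 1) = 0"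
    using A' by (simp add: orthogonal_transformation_def inner_axis_axis)
  ultimately have "oriented_frame x (A *v axis 1 1) (A *v axis 2 1)"
    using A' by (simp add: oriented_frame_def orthogonal_transformation_norm)
  then show ?thesis by blast
qed

text \<open>An arbitrary choice of frame at each point; the operators below do not depend on it.\<close>

definition frame :: "real^3 \<Rightarrow> (real^3) \<times> (real^3)" where
  "frame x = (SOME (e1, e2). oriented_frame x e1 e2)"

text \<open>Derivatives are taken within the domain \<open>\<Omega>\<close>. The Frechet derivative within a subset of
  the sphere is not determined in the normal direction, but for the sphere itself, and for
  closed discs and annuli (boundary points included), it is determined on tangent vectors.\<close>

definition e1_deriv :: "(real^3) set \<Rightarrow> (real^3 \<Rightarrow> 'b::real_normed_vector) \<Rightarrow> real^3 \<Rightarrow> 'b" where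
  "e1_deriv \<Omega> F x = frechet_derivative F (at x within \<Omega>) (fst (frame x))"

definition e2_deriv :: "(real^3) set \<Rightarrow> (real^3 \<Rightarrow> 'b::real_normed_vector) \<Rightarrow> real^3 \<Rightarrow> 'b" where
  "e2_deriv \<Omega> F x = frechet_derivative F (at x within \<Omega>) (snd (frame x))"

definition sgrad :: "(real^3) set \<Rightarrow> (real^3 \<Rightarrow> real) \<Rightarrow> real^3 \<Rightarrow> real^3" where
  "sgrad \<Omega> h x = e1_deriv \<Omega> h x *\<^sub>R fst (frame x) + e2_deriv \<Omega> h x *\<^sub>R snd (frame x)"

definition sdiv :: "(real^3) set \<Rightarrow> (real^3 \<Rightarrow> real^3) \<Rightarrow> real^3 \<Rightarrow> real" where
  "sdiv \<Omega> X x = fst (frame x) \<bullet> e1_deriv \<Omega> X x + snd (frame x) \<bullet> e2_deriv \<Omega> X x"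

definition grad_sq :: "(real^3) set \<Rightarrow> (real^3 \<Rightarrow> real^3) \<Rightarrow> real^3 \<Rightarrow> real" where
  "grad_sq \<Omega> u x = (norm (e1_deriv \<Omega> u x))\<^sup>2 + (norm (e2_deriv \<Omega> u x))\<^sup>2"

definition jac :: "(real^3) set \<Rightarrow> (real^3 \<Rightarrow> real^3) \<Rightarrow> real^3 \<Rightarrow> real" where
  "jac \<Omega> u x = u x \<bullet> cross3 (e1_deriv \<Omega> u x) (e2_deriv \<Omega> u x)"


subsection \<open>Energy, degree, harmonicity\<close>

definition alpha_energy :: "real \<Rightarrow> (real^3 \<Rightarrow> real^3) \<Rightarrow> real" where
  "alpha_energy \<alpha> u = 1/2 * (LINT x:S2|sphere_area. (2 + grad_sq S2 u x) powr \<alpha>)"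

definition deg :: "(real^3) set \<Rightarrow> (real^3 \<Rightarrow> real^3) \<Rightarrow> real" where
  "deg \<Omega> u = 1 / (4*pi) * (LINT x:\<Omega>|sphere_area. jac \<Omega> u x)"

definition alpha_harmonic_on :: "real \<Rightarrow> (real^3) set \<Rightarrow> (real^3 \<Rightarrow> real^3) \<Rightarrow> bool" where
  "alpha_harmonic_on \<alpha> \<Omega> u \<longleftrightarrow>
     u ` \<Omega> \<subseteq> S2 \<and> smooth_map_on \<Omega> u \<and>
     (\<forall>x\<in>\<Omega>.
        (\<chi> k. sdiv \<Omega> (\<lambda>y. (2 + grad_sq \<Omega> u y) powr (\<alpha> - 1) *\<^sub>R sgrad \<Omega> (\<lambda>z. u z $ k) y) x)
        + ((2 + grad_sq \<Omega> u x) powr (\<alpha> - 1) * grad_sq \<Omega> u x) *\<^sub>R u x = 0)"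


subsection \<open>Discs and annuli\<close>

definition geodesic_disc :: "real^3 \<Rightarrow> real \<Rightarrow> (real^3) set" where
  "geodesic_disc p \<rho> = {x \<in> S2. arccos (p \<bullet> x) \<le> \<rho>}"

definition geodesic_circle :: "real^3 \<Rightarrow> real \<Rightarrow> (real^3) set" where
  "geodesic_circle p \<rho> = {x \<in> S2. arccos (p \<bullet> x) = \<rho>}"

definition sph_circle :: "real \<Rightarrow> (real^3) set" where
  "sph_circle r = sph r ` {0..2*pi}"

definition sph_annulus :: "real \<Rightarrow> real \<Rightarrow> (real^3) set" where
  "sph_annulus r1 r2 = (\<Union>r\<in>{r1..r2}. sph_circle r)"

end

(* For u_f write z = cos r, sin f = P sin r, cos f = Q and g = f'(r), all regarded as functions of z.  Then
   |grad u|^2 = g^2 + P^2 and J(u) = P g = Q'(z), so that degrees are differences of values of Q, and the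
   alpha-harmonic equation is a first order system for (P, Q, g) on [-1,1] that is singular at the poles.
   With t = 1 - z the substitution Q = z + (1 - z^2) q, g = P + (1 - z^2) w makes it regular apart from a
   term t w' + 2 w, which is inverted by an averaging operator: this gives a solution for every initial
   slope f'(0) = a, depending continuously on a and smooth across the pole.

   Shooting: for a = 1 the solution is f(r) = r.  The energy E = (f_s)^2 + (cos f)^2 with s = log tan(r/2)
   satisfies E' >= -C E, and for large a the solution leaves the first quarter turn very early with E > 1,
   which forces f past 3 pi/2 before the equator.  Take the least a for which max f = 3 pi/2 on the
   hemisphere.  An interior maximum would have f' = 0 and cos f = 0, hence E = 0, so f(pi/2) = 3 pi/2, and
   reflection f(pi - r) = 3 pi - f(r) gives (i).  Restricting to {f <= pi} gives (ii), and the antipodal map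
   of the restriction to {pi <= f <= 2 pi} gives (iii).  The energy bound is the tangent inequality at 8 for
   x^alpha together with g^2 + P^2 >= 2 |Q'| and total variation 6 of Q. *)

theory Submission
  imports Defs
begin

subsection \<open>Smoothness calculus\<close>

text \<open>The profile is carried by \<open>P\<close>, \<open>Q\<close>, \<open>g\<close> as
  functions of the height, not by the angle, because smoothness at a pole is then immediate: if
  \<open>P\<close> and \<open>Q\<close> are smooth near [-1,1], the map is the restriction of a
  smooth map of R^3. The price is the constraint Q^2 + (1 - z^2) P^2 = 1, which the flow must be
  shown to preserve.

  Put \<beta> = \<alpha> - 1. For \<beta> = 0 (harmonic maps) E is constantly 1 and f never passes
  pi. In the shooting, \<beta> > 0 enters as a gain: during the first quarter turn E rises by an
  amount independent of the initial slope a, for a \<ge> 3. A short further interval of t costs only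
  a factor close to 1, while log tan(r/2) runs through a length of order log a on it; this makes the
  angle large.

  E controls t g^2 but not g, so it says nothing about w at the pole. Bounds there come from the
  initial data alone, bounds further on from E. The system is therefore solved with a cutoff first,
  and the two bounds together show that a high cutoff is never reached.\<close>

fun Cn_on :: "nat \<Rightarrow> (real \<Rightarrow> real) \<Rightarrow> real set \<Rightarrow> bool" where
  "Cn_on 0 h S \<longleftrightarrow> continuous_on S h"
| "Cn_on (Suc k) h S \<longleftrightarrow> (\<forall>x\<in>S. h field_differentiable at x) \<and> Cn_on k (deriv h) S"

lemma Cn_on_cong:
  assumes "open S" "\<And>x. x \<in> S \<Longrightarrow> f x = g x" "Cn_on k f S"
  shows "Cn_on k g S"
  using assms(2,3)
proof (induction k arbitrary: f g)
  case 0
  then show ?case using continuous_on_cong by (metis Cn_on.simps(1))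
next
  case (Suc k)
  have ev: "eventually (\<lambda>y. f y = g y) (nhds x)" if "x \<in> S" for x
    using assms(1) Suc.prems(1) that eventually_nhds by blast
  have 1: "g field_differentiable at x" if "x \<in> S" for x
  proof -
    have "(f has_field_derivative deriv f x) (at x)"
      using Suc.prems(2) that field_differentiable_derivI by auto
    then have "(g has_field_derivative deriv f x) (at x)"
      using DERIV_cong_ev[OF refl ev[OF that] refl] by simp
    then show ?thesis by (auto simp: field_differentiable_def)
  qed
  have "Cn_on k (deriv g) S"
    by (rule Suc.IH[of "deriv f"]) (use Suc.prems(2) deriv_cong_ev[OF ev refl] in auto)
  with 1 show ?case by simp
qed

lemma Cn_on_SucI:
  assumes "open S" "\<And>x. x \<in> S \<Longrightarrow> (h has_real_derivative h' x) (at x)" "Cn_on k h' S"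
  shows "Cn_on (Suc k) h S"
proof -
  have "Cn_on k (deriv h) S"
    by (rule Cn_on_cong[OF assms(1) _ assms(3)]) (use assms(2) DERIV_imp_deriv in metis)
  then show ?thesis using assms(2) by (auto simp: field_differentiable_def)
qed

lemma Cn_on_SucD: "Cn_on (Suc k) h S \<Longrightarrow> Cn_on k h S"
proof (induction k arbitrary: h)
  case 0
  then have "h differentiable_on S"
    by (simp add: differentiable_on_def)
       (meson differentiable_at_withinI field_differentiable_imp_differentiable)
  then show ?case by (simp add: differentiable_imp_continuous_on)
next
  case (Suc k)
  then show ?case using Cn_on.simps(2) by blast
qed

lemma Cn_on_continuous: "Cn_on k h S \<Longrightarrow> continuous_on S h"
  by (induction k) (use Cn_on_SucD in auto)

lemma Cn_on_DERIV: "Cn_on (Suc k) h S \<Longrightarrow> x \<in> S \<Longrightarrow> (h has_real_derivative deriv h x) (at x)"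
  by (auto intro: field_differentiable_derivI)

lemma Cn_on_subset: "Cn_on k h S \<Longrightarrow> T \<subseteq> S \<Longrightarrow> Cn_on k h T"
  by (induction k arbitrary: h) (auto intro: continuous_on_subset)

lemma Cn_on_Un: "open S \<Longrightarrow> open T \<Longrightarrow> Cn_on k h S \<Longrightarrow> Cn_on k h T \<Longrightarrow> Cn_on k h (S \<union> T)"
  by (induction k arbitrary: h) (auto intro: continuous_on_open_Un)

lemma Cn_on_const: "Cn_on k (\<lambda>x. c) S"
  by (induction k arbitrary: c) auto

lemma Cn_on_ident: assumes "open S" shows "Cn_on k (\<lambda>x. x) S"
  by (cases k) (auto simp del: Cn_on.simps(2) intro!: Cn_on_SucI[OF assms] Cn_on_const derivative_eq_intros)

lemma Cn_on_add:
  assumes "open S" "Cn_on k f S" "Cn_on k g S"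
  shows "Cn_on k (\<lambda>x. f x + g x) S"
  using assms(2,3)
proof (induction k arbitrary: f g)
  case (Suc k)
  show ?case
    by (rule Cn_on_SucI[OF assms(1), of _ "\<lambda>x. deriv f x + deriv g x"])
       (use Suc in \<open>auto intro!: DERIV_add field_differentiable_derivI\<close>)
qed (auto intro: continuous_intros)

lemma Cn_on_mult:
  assumes "open S" "Cn_on k f S" "Cn_on k g S"
  shows "Cn_on k (\<lambda>x. f x * g x) S"
  using assms(2,3)
proof (induction k arbitrary: f g)
  case (Suc k)
  show ?case
  proof (rule Cn_on_SucI[OF assms(1), of _ "\<lambda>x. deriv f x * g x + deriv g x * f x"])
    show "((\<lambda>x. f x * g x) has_real_derivative deriv f x * g x + deriv g x * f x) (at x)"
      if "x \<in> S" for x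
      using Suc.prems that by (auto intro!: DERIV_mult field_differentiable_derivI)
    show "Cn_on k (\<lambda>x. deriv f x * g x + deriv g x * f x) S"
      using Suc by (intro Cn_on_add[OF assms(1)] Suc.IH Cn_on_SucD[of k g] Cn_on_SucD[of k f]) auto
  qed
qed (auto intro: continuous_intros)

lemma Cn_on_minus: assumes "open S" "Cn_on k f S" shows "Cn_on k (\<lambda>x. - f x) S"
  using Cn_on_mult[OF assms(1) Cn_on_const[of k "-1"] assms(2)] by simp

lemma Cn_on_diff:
  assumes "open S" "Cn_on k f S" "Cn_on k g S"
  shows "Cn_on k (\<lambda>x. f x - g x) S"
  using Cn_on_add[OF assms(1,2) Cn_on_minus[OF assms(1,3)]] by simp

lemma Cn_on_inverse:
  assumes "open S" "Cn_on k f S" "\<And>x. x \<in> S \<Longrightarrow> f x \<noteq> 0"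
  shows "Cn_on k (\<lambda>x. inverse (f x)) S"
  using assms(2,3)
proof (induction k arbitrary: f)
  case (Suc k)
  show ?case
  proof (rule Cn_on_SucI[OF assms(1), of _ "\<lambda>x. - (inverse (f x) * deriv f x * inverse (f x))"])
    show "((\<lambda>x. inverse (f x)) has_real_derivative - (inverse (f x) * deriv f x * inverse (f x))) (at x)"
      if "x \<in> S" for x
      using Suc.prems that by (auto intro!: DERIV_inverse' field_differentiable_derivI)
    have "Cn_on k (\<lambda>x. inverse (f x)) S"
      using Suc Cn_on_SucD by blast
    then show "Cn_on k (\<lambda>x. - (inverse (f x) * deriv f x * inverse (f x))) S"
      using Suc.prems by (intro Cn_on_minus Cn_on_mult assms(1)) auto
  qed
qed (auto intro: continuous_intros)

lemma Cn_on_divide: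
  assumes "open S" "Cn_on k f S" "Cn_on k g S" "\<And>x. x \<in> S \<Longrightarrow> g x \<noteq> 0"
  shows "Cn_on k (\<lambda>x. f x / g x) S"
  unfolding divide_inverse by (intro Cn_on_mult Cn_on_inverse assms)

lemma Cn_on_power: assumes "open S" "Cn_on k f S" shows "Cn_on k (\<lambda>x. f x ^ n) S"
  by (induction n) (auto intro!: Cn_on_const Cn_on_mult assms)

lemma Cn_on_reflect:
  assumes "open S" "Cn_on k f S"
  shows "Cn_on k (\<lambda>x. f (c - x)) ((\<lambda>x. c - x) -` S)"
proof -
  have op: "open ((\<lambda>x. c - x) -` S)"
    by (rule open_vimage[OF assms(1)]) (auto intro: continuous_intros)
  show ?thesis using assms(2)
  proof (induction k arbitrary: f)
    case 0
    then show ?case by (auto intro!: continuous_on_compose2[of S f] continuous_intros)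
  next
    case (Suc k)
    show ?case
    proof (rule Cn_on_SucI[OF op, of _ "\<lambda>x. - deriv f (c - x)"])
      show "((\<lambda>x. f (c - x)) has_real_derivative - deriv f (c - x)) (at x)"
        if "x \<in> (\<lambda>x. c - x) -` S" for x
      proof -
        have "(f has_real_derivative deriv f (c - x)) (at (c - x))"
          using Suc.prems that by (auto intro: field_differentiable_derivI)
        moreover have "((\<lambda>x. c - x) has_real_derivative -1) (at x)"
          by (auto intro!: derivative_eq_intros)
        ultimately show ?thesis
          using DERIV_chain2[where f=f and g="\<lambda>x. c - x" and x=x and s=UNIV] by fastforce
      qed
    qed (use Suc in \<open>auto intro!: Cn_on_minus op\<close>)
  qed
qed

text \<open>The operators \<open>\<phi> \<mapsto> (\<lambda>t. \<integral>\<^sub>0\<^sup>1 \<tau>\<^sup>j \<phi>(\<tau> t) d\<tau>)\<close> invert \<open>t y' + (j + 1) y = \<phi>\<close>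
  at the singular point \<open>t = 0\<close>; differentiating raises \<open>j\<close> by one.\<close>

definition avg :: "nat \<Rightarrow> (real \<Rightarrow> real) \<Rightarrow> real \<Rightarrow> real" where
  "avg j \<phi> t = integral {0..1} (\<lambda>\<tau>. \<tau> ^ j * \<phi> (\<tau> * t))"

lemma scaled_in_interval:
  fixes J :: "real set"
  assumes "convex J" "0 \<in> J" "t \<in> J" "\<tau> \<in> {0..1}"
  shows "\<tau> * t \<in> J"
  using convexD_alt[OF assms(1,2,3), of \<tau>] assms(4) by auto

text \<open>Differentiation under the integral turns the average of \<open>\<phi>\<close> with
  weight \<open>j\<close> into that of its derivative with weight \<open>Suc j\<close>, hence the
  induction over all \<open>j\<close>. No derivative is lost at 0, although the differential
  equation that the average solves is singular there.\<close>

lemma Cn_on_avg: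
  assumes "open J" "convex J" "0 \<in> J" "Cn_on k \<phi> J"
  shows "Cn_on k (avg j \<phi>) J"
  using assms(4)
proof (induction k arbitrary: j \<phi>)
  case 0
  then have c: "continuous_on J \<phi>" by simp
  have "continuous_on J (\<lambda>t. integral (cbox 0 1) (\<lambda>\<tau>. \<tau> ^ j * \<phi> (\<tau> * t)))"
    by (rule integral_continuous_on_param)
       (use scaled_in_interval[OF assms(2,3)] in \<open>auto simp: split_beta intro!: continuous_intros continuous_on_compose2[OF c]\<close>)
  then show ?case by (simp add: avg_def [abs_def])
next
  case (Suc k)
  have c: "continuous_on J (deriv \<phi>)" "continuous_on J \<phi>"
    using Suc.prems Cn_on_continuous[of k] Cn_on_continuous[of "Suc k"] by auto
  have *: "((\<lambda>t. integral (cbox 0 1) (\<lambda>\<tau>. \<tau> ^ j * \<phi> (\<tau> * t))) has_real_derivative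
     integral (cbox 0 1) (\<lambda>\<tau>. \<tau> ^ Suc j * deriv \<phi> (\<tau> * t))) (at t within J)" if "t \<in> J" for t
  proof (rule leibniz_rule_field_derivative[OF _ _ _ that assms(2)])
    fix x \<tau> :: real assume x: "x \<in> J" "\<tau> \<in> cbox 0 1"
    then have "\<tau> * x \<in> J" using scaled_in_interval[OF assms(2,3)] by auto
    then have "(\<phi> has_real_derivative deriv \<phi> (\<tau> * x)) (at (\<tau> * x))"
      using Suc.prems by (auto intro: field_differentiable_derivI)
    moreover have "((\<lambda>x. \<tau> * x) has_real_derivative \<tau>) (at x within J)"
      by (auto intro!: derivative_eq_intros)
    ultimately have "((\<lambda>x. \<phi> (\<tau> * x)) has_real_derivative deriv \<phi> (\<tau> * x) * \<tau>) (at x within J)"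
      using DERIV_chain2[where f=\<phi> and g="\<lambda>x. \<tau> * x" and x=x and s=J] by blast
    then show "((\<lambda>x. \<tau> ^ j * \<phi> (\<tau> * x)) has_real_derivative \<tau> ^ Suc j * deriv \<phi> (\<tau> * x)) (at x within J)"
      by (auto intro!: derivative_eq_intros)
  next
    fix x assume "x \<in> J"
    then show "(\<lambda>\<tau>. \<tau> ^ j * \<phi> (\<tau> * x)) integrable_on cbox 0 1"
      using scaled_in_interval[OF assms(2,3)]
      by (auto intro!: integrable_continuous_real continuous_intros continuous_on_compose2[OF c(2)])
  next
    show "continuous_on (J \<times> cbox 0 1) (\<lambda>(x, \<tau>). \<tau> ^ Suc j * deriv \<phi> (\<tau> * x))"
      using scaled_in_interval[OF assms(2,3)]
      by (auto simp: split_beta intro!: continuous_intros continuous_on_compose2[OF c(1)])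
  qed
  have "(avg j \<phi> has_real_derivative avg (Suc j) (deriv \<phi>) t) (at t)" if "t \<in> J" for t
    using *[OF that] unfolding at_within_open[OF that assms(1)] by (simp add: avg_def [abs_def])
  then show ?case
    by (rule Cn_on_SucI[OF assms(1)]) (use Suc in auto)
qed

section \<open>Smooth maps of several variables\<close>

lemma Ck_on_cong:
  assumes "open W" "\<And>x. x \<in> W \<Longrightarrow> F x = G x" "Ck_on k F W"
  shows "Ck_on k G W"
  using assms(2,3)
proof (induction k arbitrary: F G)
  case 0
  then show ?case by (metis Ck_on.simps(1) continuous_on_cong)
next
  case (Suc k)
  have d: "(G has_derivative frechet_derivative F (at x)) (at x)" if "x \<in> W" for x
    using Suc.prems that frechet_derivative_works has_derivative_transform_within_open[OF _ assms(1)]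
    by (metis Ck_on.simps(2))
  have "Ck_on k (\<lambda>x. frechet_derivative G (at x) v) W" for v
    by (rule Suc.IH[of "\<lambda>x. frechet_derivative F (at x) v"])
       (use Suc.prems(2) frechet_derivative_at[OF d] in auto)
  then show ?case using d by (auto simp: differentiable_def)
qed

lemma Ck_on_SucI:
  assumes "open W" "\<And>x. x \<in> W \<Longrightarrow> (F has_derivative F' x) (at x)"
    "\<And>v. Ck_on k (\<lambda>x. F' x v) W"
  shows "Ck_on (Suc k) F W"
proof -
  have "Ck_on k (\<lambda>x. frechet_derivative F (at x) v) W" for v
    by (rule Ck_on_cong[OF assms(1) _ assms(3)[of v]])
       (use frechet_derivative_at[OF assms(2)] in auto)
  then show ?thesis using assms(2) by (auto simp: differentiable_def)
qed

lemma Ck_on_has_derivative: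
  "Ck_on (Suc k) F W \<Longrightarrow> x \<in> W \<Longrightarrow> (F has_derivative frechet_derivative F (at x)) (at x)"
  using frechet_derivative_works by auto

lemma Ck_on_SucD: "Ck_on (Suc k) F W \<Longrightarrow> Ck_on k F W"
proof (induction k arbitrary: F)
  case 0
  then have "F differentiable_on W"
    by (simp add: differentiable_on_def) (meson differentiable_at_withinI)
  then show ?case by (simp add: differentiable_imp_continuous_on)
next
  case (Suc k)
  then show ?case using Ck_on.simps(2) by blast
qed

lemma Ck_on_const: "Ck_on k (\<lambda>x. c) W"
  by (induction k arbitrary: c) auto

lemma Ck_on_bounded_linear:
  assumes "open W" "bounded_linear L"
  shows "Ck_on k L W"
proof (cases k)
  case 0
  then show ?thesis using assms(2) by (simp add: linear_continuous_on)
next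
  case (Suc m)
  show ?thesis unfolding Suc
    by (rule Ck_on_SucI[OF assms(1), of _ "\<lambda>x. L"])
       (auto intro: bounded_linear_imp_has_derivative assms(2) Ck_on_const)
qed

lemma Ck_on_add:
  assumes "open W" "Ck_on k F W" "Ck_on k G W"
  shows "Ck_on k (\<lambda>x. F x + G x) W"
  using assms(2,3)
proof (induction k arbitrary: F G)
  case (Suc k)
  show ?case
    by (rule Ck_on_SucI[OF assms(1) has_derivative_add[OF Ck_on_has_derivative Ck_on_has_derivative]])
       (use Suc in auto)
qed (auto intro: continuous_intros)

lemma Ck_on_scaleR:
  fixes F :: "'a::euclidean_space \<Rightarrow> real"
  assumes "open W" "Ck_on k F W" "Ck_on k G W"
  shows "Ck_on k (\<lambda>x. F x *\<^sub>R G x) W"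
  using assms(2,3)
proof (induction k arbitrary: F G)
  case (Suc k)
  have "Ck_on k F W" "Ck_on k G W" using Suc.prems Ck_on_SucD by blast+
  then have "Ck_on k (\<lambda>x. F x *\<^sub>R frechet_derivative G (at x) v +
      frechet_derivative F (at x) v *\<^sub>R G x) W" for v
    using Suc by (intro Ck_on_add[OF assms(1)] Suc.IH) auto
  then show ?case
    by (intro Ck_on_SucI[OF assms(1) has_derivative_scaleR[OF Ck_on_has_derivative[OF Suc.prems(1)]
      Ck_on_has_derivative[OF Suc.prems(2)]]])
qed (auto intro: continuous_intros)

lemma Ck_on_height:
  assumes "open S" "Cn_on k h S"
  shows "Ck_on k (\<lambda>x::real^'n. h (x $ i)) {x. x $ i \<in> S}"
proof -
  have op: "open {x::real^'n. x $ i \<in> S}"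
    using open_vimage[OF assms(1) continuous_on_component[OF continuous_on_id], of i]
    by (simp add: vimage_def)
  show ?thesis using assms(2)
  proof (induction k arbitrary: h)
    case 0
    then show ?case by (auto intro!: continuous_on_compose2[of S h] continuous_intros)
  next
    case (Suc k)
    show ?case
    proof (rule Ck_on_SucI[OF op, of _ "\<lambda>x v. deriv h (x $ i) *\<^sub>R (v $ i)"])
      fix x :: "real^'n" assume "x \<in> {x. x $ i \<in> S}"
      then have "(h has_real_derivative deriv h (x $ i)) (at (x $ i))"
        using Suc.prems by (auto intro: field_differentiable_derivI)
      then have "(h has_derivative (*) (deriv h (x $ i))) (at (x $ i))"
        by (simp add: has_field_derivative_def)
      from has_derivative_compose[OF bounded_linear_imp_has_derivative[OF bounded_linear_vec_nth[of i]] this]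
      show "((\<lambda>x. h (x $ i)) has_derivative (\<lambda>v. deriv h (x $ i) *\<^sub>R (v $ i))) (at x)"
        by simp
    next
      fix v :: "real^'n"
      show "Ck_on k (\<lambda>x::real^'n. deriv h (x $ i) *\<^sub>R (v $ i)) {x. x $ i \<in> S}"
        using Suc by (intro Ck_on_scaleR[OF op] Ck_on_const) auto
    qed
  qed
qed

subsection \<open>Calculus on spherical bands\<close>

definition band :: "real \<Rightarrow> real \<Rightarrow> (real^3) set" where
  "band c1 c2 = {x \<in> S2. c1 \<le> x $ 3 \<and> x $ 3 \<le> c2}"

lemma sphere_component_bounds: "x \<in> S2 \<Longrightarrow> \<bar>x $ i\<bar> \<le> 1"
  using component_le_norm_cart[of x i] by simp

lemma S2_eq_band: "S2 = band (-1) 1"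
  using sphere_component_bounds[of _ 3] by (force simp: band_def abs_le_iff)

lemma sphere_sum_squares: "x \<in> S2 \<Longrightarrow> (x $ 1)\<^sup>2 + (x $ 2)\<^sup>2 + (x $ 3)\<^sup>2 = (1::real)" for x :: "real^3"
  by (simp add: norm_eq_1 inner_vec_def sum_3 power2_eq_square)

lemma axis_1_nth [simp]: "axis k (1::real) $ j = (if j = k then 1 else 0)"
  by (simp add: axis_def)

text \<open>A right derivative of F along the curve is already unique, so it suffices that the curve
  stays in the domain for small positive parameters. This is what makes the lemma usable at boundary
  points.\<close>

lemma derivative_along_curve:
  fixes c :: "real \<Rightarrow> 'a::real_normed_vector"
  assumes c: "c 0 = x" "(c has_vector_derivative v) (at 0)" "\<forall>\<^sub>F t in at_right 0. c t \<in> \<Omega>" "x \<in> \<Omega>"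
    and D: "(F has_derivative D) (at x within \<Omega>)"
    and D': "(F has_derivative D') (at x within \<Omega>)"
  shows "D v = D' v"
proof -
  obtain b where b: "b > 0" "\<And>t. 0 < t \<Longrightarrow> t < b \<Longrightarrow> c t \<in> \<Omega>"
    using c(3) by (auto simp: eventually_at_right_field)
  have sub: "c ` {0..b/2} \<subseteq> \<Omega>"
  proof
    fix y assume "y \<in> c ` {0..b/2}"
    then obtain t where "t \<in> {0..b/2}" "y = c t" by auto
    then show "y \<in> \<Omega>" using b c(1,4) by (cases "t = 0") auto
  qed
  have 1: "((F \<circ> c) has_vector_derivative L v) (at 0 within {0..b/2})"
    if "(F has_derivative L) (at x within \<Omega>)" for L
  proof -
    have "(F has_derivative L) (at (c 0) within c ` {0..b/2})"
      using that sub c(1) has_derivative_subset by blast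
    moreover have "(c has_derivative (\<lambda>t. t *\<^sub>R v)) (at 0 within {0..b/2})"
      using c(2) has_derivative_at_withinI by (auto simp: has_vector_derivative_def)
    ultimately have "((F \<circ> c) has_derivative (L \<circ> (\<lambda>t. t *\<^sub>R v))) (at 0 within {0..b/2})"
      by (rule diff_chain_within[rotated])
    moreover have "L \<circ> (\<lambda>t. t *\<^sub>R v) = (\<lambda>t. t *\<^sub>R L v)"
      using linear_simps(5)[OF has_derivative_bounded_linear[OF that]] by auto
    ultimately show ?thesis by (simp add: has_vector_derivative_def)
  qed
  have "at 0 within {0..b/2} \<noteq> bot"
    using b(1) by (simp add: at_within_Icc_at_right trivial_limit_at_right_real)
  then show ?thesis
    by (rule vector_derivative_unique_within[OF _ 1[OF D] 1[OF D']])
qed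

text \<open>A tangent vector that does not leave the band to first order is the velocity of a
  half-curve in the band, and there the previous lemma applies. At a boundary circle every other
  tangent vector is a linear combination of two vectors pointing strictly inward, and derivatives
  are linear. A bound -1 or 1 on the height is no boundary.\<close>

lemma band_derivative_unique:
  assumes x: "x \<in> band c1 c2" and c: "-1 \<le> c1" "c1 < c2" "c2 \<le> 1" and v: "x \<bullet> v = 0"
    and D: "(F has_derivative D) (at x within band c1 c2)"
    and D': "(F has_derivative D') (at x within band c1 c2)"
  shows "D v = D' v"
proof -
  have nx: "norm x = 1" "x \<in> S2" "c1 \<le> x $ 3" "x $ 3 \<le> c2" using x by (auto simp: band_def)
  have good: "D v = D' v" if v: "x \<bullet> v = 0"
    and g: "c1 = -1 \<or> c1 < x $ 3 \<or> 0 < v $ 3" "c2 = 1 \<or> x $ 3 < c2 \<or> v $ 3 < 0" for v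
  proof -
    \<comment> \<open>\<open>\<gamma>\<close> is the line x + t v projected radially to the sphere:
      it starts at x with velocity v.\<close>
    define s where "s = (\<lambda>t::real. 1 / sqrt (1 + t^2 * (v \<bullet> v)))"
    define \<gamma> where "\<gamma> = (\<lambda>t. s t *\<^sub>R (x + t *\<^sub>R v))"
    have pos: "0 < 1 + t^2 * (v \<bullet> v)" for t :: real
      by (simp add: add_pos_nonneg)
    have "norm (x + t *\<^sub>R v) = sqrt (1 + t^2 * (v \<bullet> v))" for t
      using nx(1) v by (simp add: norm_eq_sqrt_inner algebra_simps inner_commute power2_eq_square)
    then have sph: "\<gamma> t \<in> S2" for t
      using pos[of t] by (simp add: \<gamma>_def s_def)
    have "(s has_real_derivative 0) (at 0)"
      unfolding s_def by (auto intro!: derivative_eq_intros)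
    then have "((\<lambda>t. s t *\<^sub>R (x + t *\<^sub>R v)) has_vector_derivative s 0 *\<^sub>R v + 0 *\<^sub>R (x + 0 *\<^sub>R v)) (at 0)"
      by (intro has_vector_derivative_scaleR) (auto intro!: derivative_eq_intros)
    then have \<gamma>': "(\<gamma> has_vector_derivative v) (at 0)" and \<gamma>0: "\<gamma> 0 = x"
      by (auto simp: \<gamma>_def s_def)
    have h': "((\<lambda>t. \<gamma> t $ 3) has_real_derivative v $ 3) (at 0)"
      using bounded_linear.has_vector_derivative[OF bounded_linear_vec_nth \<gamma>']
      by (simp add: has_real_derivative_iff_has_vector_derivative)
    then have lim: "((\<lambda>t. \<gamma> t $ 3) \<longlongrightarrow> x $ 3) (at_right 0)"
      using DERIV_isCont[OF h'] \<gamma>0 by (simp add: isCont_def filterlim_at_split)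
    have "\<forall>\<^sub>F t in at_right 0. c1 \<le> \<gamma> t $ 3"
      using g(1)
    proof (elim disjE)
      assume "c1 = -1"
      then show ?thesis using sphere_component_bounds[OF sph, of _ 3]
        by (auto simp: abs_le_iff intro!: always_eventually)
    next
      assume "c1 < x $ 3"
      then have "\<forall>\<^sub>F t in at_right 0. c1 < \<gamma> t $ 3"
        by (rule order_tendstoD(1)[OF lim])
      then show ?thesis by eventually_elim simp
    next
      assume "0 < v $ 3"
      then obtain d where "d > 0" "\<And>t. 0 < t \<Longrightarrow> t < d \<Longrightarrow> \<gamma> 0 $ 3 < \<gamma> t $ 3"
        using DERIV_pos_inc_right[OF h'] by auto
      then show ?thesis using nx(3) \<gamma>0
        by (auto simp: eventually_at_right_field intro!: exI[of _ d]) (metis less_eq_real_def order_trans)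
    qed
    moreover have "\<forall>\<^sub>F t in at_right 0. \<gamma> t $ 3 \<le> c2"
      using g(2)
    proof (elim disjE)
      assume "c2 = 1"
      then show ?thesis using sphere_component_bounds[OF sph, of _ 3]
        by (auto simp: abs_le_iff intro!: always_eventually)
    next
      assume "x $ 3 < c2"
      then have "\<forall>\<^sub>F t in at_right 0. \<gamma> t $ 3 < c2"
        by (rule order_tendstoD(2)[OF lim])
      then show ?thesis by eventually_elim simp
    next
      assume "v $ 3 < 0"
      then obtain d where "d > 0" "\<And>t. 0 < t \<Longrightarrow> t < d \<Longrightarrow> \<gamma> 0 $ 3 > \<gamma> t $ 3"
        using DERIV_neg_dec_right[OF h'] by auto
      then show ?thesis using nx(4) \<gamma>0
        by (auto simp: eventually_at_right_field intro!: exI[of _ d]) (metis less_eq_real_def order_trans)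
    qed
    ultimately have "\<forall>\<^sub>F t in at_right 0. \<gamma> t \<in> band c1 c2"
      by eventually_elim (use sph in \<open>auto simp: band_def\<close>)
    from derivative_along_curve[OF \<gamma>0 \<gamma>' this x D D'] show ?thesis .
  qed
  \<comment> \<open>The gradient of the height on the sphere. Its own height component is positive
    off the poles, so a multiple of it (\<open>?l\<close> below) brings the height component of v to
    1 or -1.\<close>
  define n where "n = axis 3 1 - (x $ 3) *\<^sub>R x"
  have n: "x \<bullet> n = 0" "n $ 3 = 1 - (x $ 3)\<^sup>2"
    using nx(1) by (auto simp: n_def algebra_simps inner_axis norm_eq_1 power2_eq_square)
  have lin: "linear D" "linear D'"
    using D D' has_derivative_linear by blast+
  have shift: "D v = D' v" if "D w = D' w" "D (v + l *\<^sub>R w) = D' (v + l *\<^sub>R w)" for w l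
    using that lin by (simp add: linear_add linear_scale)
  consider "c1 = -1 \<or> c1 < x $ 3 \<or> 0 < v $ 3" "c2 = 1 \<or> x $ 3 < c2 \<or> v $ 3 < 0"
    | "c1 \<noteq> -1" "x $ 3 = c1" | "c2 \<noteq> 1" "x $ 3 = c2"
    using nx(3,4) by linarith
  then show ?thesis
  proof cases
    case 1
    then show ?thesis using good v by blast
  next
    case 2
    then have "\<bar>x $ 3\<bar> < 1" "x $ 3 < c2" using c by auto
    then have p: "1 - (x $ 3)\<^sup>2 > 0" by (simp add: abs_square_less_1)
    let ?l = "(1 - v $ 3) / (1 - (x $ 3)\<^sup>2)"
    have "(v + ?l *\<^sub>R n) $ 3 = 1" using p n by simp
    then show ?thesis
      by (intro shift[of n ?l] good) (use p n v \<open>x $ 3 < c2\<close> in \<open>simp_all add: inner_add_right\<close>)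
  next
    case 3
    then have "\<bar>x $ 3\<bar> < 1" "x $ 3 > c1" using c by auto
    then have p: "1 - (x $ 3)\<^sup>2 > 0" by (simp add: abs_square_less_1)
    let ?l = "(1 + v $ 3) / (1 - (x $ 3)\<^sup>2)"
    have "(v + ?l *\<^sub>R (- n)) $ 3 = -1" using p n by simp
    then show ?thesis
      by (intro shift[of "- n" ?l] good) (use p n v \<open>x $ 3 > c1\<close> in \<open>simp_all add: inner_diff_right\<close>)
  qed
qed

lemma oriented_frame_frame:
  assumes "x \<in> S2"
  shows "oriented_frame x (fst (frame x)) (snd (frame x))"
proof -
  have "case frame x of (e1, e2) \<Rightarrow> oriented_frame x e1 e2"
    unfolding frame_def by (rule someI_ex) (use oriented_frame_exists[OF assms] in auto)
  then show ?thesis by (simp add: split_beta)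
qed

lemma oriented_frame_tangent:
  assumes "oriented_frame x e f"
  shows "x \<bullet> e = 0" "x \<bullet> f = 0"
  using assms dot_cross_self[of e f] by (auto simp: oriented_frame_def inner_commute)

text \<open>The matrix with rows e, f, x is orthogonal, so its columns are orthonormal as well. The
  right-hand side no longer mentions the frame; all later frame computations reduce to these
  combinations.\<close>

lemma oriented_frame_components:
  assumes "oriented_frame x e f" "x \<in> S2"
  shows "e $ i * e $ j + f $ i * f $ j = (if i = j then 1 else 0) - x $ i * x $ j"
proof -
  define M :: "real^3^3" where "M = vector [e, f, x]"
  have "e \<bullet> e = 1" "f \<bullet> f = 1" "e \<bullet> f = 0" "x \<bullet> x = 1" "x \<bullet> e = 0" "x \<bullet> f = 0"
    using assms oriented_frame_tangent[OF assms(1)] by (auto simp: oriented_frame_def norm_eq_1)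
  then have "M ** transpose M = mat 1"
    by (simp add: vec_eq_iff forall_3 matrix_matrix_mult_def transpose_def mat_def sum_3 M_def
        inner_vec_def mult.commute)
  then have "transpose M ** M = mat 1"
    using matrix_left_right_inverse by blast
  then have "(transpose M ** M) $ i $ j = (if i = j then 1 else 0)"
    by (simp add: mat_def)
  then show ?thesis
    by (simp add: matrix_matrix_mult_def transpose_def sum_3 M_def)
qed

text \<open>\<open>frechet_derivative\<close> within a band is an arbitrary choice in the normal
  direction. Frame vectors are tangent, so any derivative found by calculation may replace
  it.\<close>

lemma frame_deriv_eq:
  assumes "x \<in> band c1 c2" "-1 \<le> c1" "c1 < c2" "c2 \<le> 1"
    and D: "(F has_derivative D) (at x within band c1 c2)"
  shows "e1_deriv (band c1 c2) F x = D (fst (frame x))"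
    and "e2_deriv (band c1 c2) F x = D (snd (frame x))"
proof -
  have fr: "oriented_frame x (fst (frame x)) (snd (frame x))"
    using assms(1) oriented_frame_frame by (auto simp: band_def)
  have "(F has_derivative frechet_derivative F (at x within band c1 c2)) (at x within band c1 c2)"
    using D by (metis differentiableI frechet_derivative_works)
  from band_derivative_unique[OF assms(1-4) _ this D] oriented_frame_tangent[OF fr]
  show "e1_deriv (band c1 c2) F x = D (fst (frame x))"
    and "e2_deriv (band c1 c2) F x = D (snd (frame x))"
    by (auto simp: e1_deriv_def e2_deriv_def)
qed

lemma has_derivative_height:
  fixes x :: "real^3"
  assumes "(h has_real_derivative h') (at (x $ 3))"
  shows "((\<lambda>y. h (y $ 3)) has_derivative (\<lambda>v. h' * v $ 3)) (at x within S)"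
proof -
  have "(h has_derivative (*) h') (at (x $ 3))"
    using assms by (simp add: has_field_derivative_def)
  from has_derivative_compose[OF bounded_linear_imp_has_derivative[OF bounded_linear_vec_nth[of 3]] this]
  show ?thesis by (rule has_derivative_at_withinI)
qed

lemma has_derivative_coordinate:
  "((\<lambda>y::real^'n. y $ i) has_derivative (\<lambda>v. v $ i)) (at x within S)"
  by (rule bounded_linear_imp_has_derivative[OF bounded_linear_vec_nth])

section \<open>Rotationally symmetric maps in terms of the height\<close>

definition sym_map :: "(real \<Rightarrow> real) \<Rightarrow> (real \<Rightarrow> real) \<Rightarrow> real^3 \<Rightarrow> real^3" where
  "sym_map P Q x = (P (x $ 3) * x $ 1) *\<^sub>R axis 1 1 + (P (x $ 3) * x $ 2) *\<^sub>R axis 2 1 + Q (x $ 3) *\<^sub>R axis 3 1"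

lemma sym_map_nth [simp]:
  "sym_map P Q x $ 1 = P (x $ 3) * x $ 1"
  "sym_map P Q x $ 2 = P (x $ 3) * x $ 2"
  "sym_map P Q x $ 3 = Q (x $ 3)"
  by (simp_all add: sym_map_def)

lemma smooth_sym_map:
  assumes "open I" "{-1..1} \<subseteq> I" "\<And>k. Cn_on k P I" "\<And>k. Cn_on k Q I" "M \<subseteq> S2"
  shows "smooth_map_on M (sym_map P Q)"
proof -
  let ?W = "{x::real^3. x $ 3 \<in> I}"
  have op: "open ?W"
    using open_vimage[OF assms(1) continuous_on_component[OF continuous_on_id], of 3]
    by (simp add: vimage_def)
  have "M \<subseteq> ?W"
    using sphere_component_bounds[of _ 3] assms(2,5)
    by (fastforce simp: abs_le_iff)
  moreover have "Ck_on k (sym_map P Q) ?W" for k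
  proof -
    have 1: "Ck_on k (\<lambda>x::real^3. x $ i) ?W" for i
      by (rule Ck_on_bounded_linear[OF op bounded_linear_vec_nth])
    have "Ck_on k (\<lambda>x::real^3. (P (x $ 3) *\<^sub>R x $ 1) *\<^sub>R axis 1 1 + (P (x $ 3) *\<^sub>R x $ 2) *\<^sub>R axis 2 1 + Q (x $ 3) *\<^sub>R axis 3 1 :: real^3) ?W"
      by (intro Ck_on_add[OF op] Ck_on_scaleR[OF op] Ck_on_const 1 Ck_on_height assms)
    then show ?thesis by (simp add: sym_map_def [abs_def])
  qed
  ultimately show ?thesis
    using op unfolding smooth_map_on_def by (metis IntE in_mono)
qed

text \<open>On the sphere the field axis k 1 - (y $ k) y is the gradient of the k-th coordinate. The
  same formula is used off the sphere; the resulting normal terms disappear when paired with a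
  tangent vector.\<close>

lemma has_derivative_tangential_field:
  fixes x :: "real^3"
  assumes "(s has_derivative s') (at x within \<Omega>)"
  shows "((\<lambda>y. s y *\<^sub>R (axis k 1 - (y $ k) *\<^sub>R y)) has_derivative
    (\<lambda>v. s' v *\<^sub>R (axis k 1 - (x $ k) *\<^sub>R x) - s x *\<^sub>R (v $ k *\<^sub>R x + x $ k *\<^sub>R v))) (at x within \<Omega>)"
  by (rule has_derivative_eq_rhs[OF has_derivative_scaleR[OF assms
        has_derivative_diff[OF has_derivative_const has_derivative_scaleR[OF has_derivative_coordinate has_derivative_ident]]]])
     (auto simp: algebra_simps)

lemma inner_axis_tangential:
  fixes e :: "real^3"
  shows "x \<bullet> e = 0 \<Longrightarrow> e \<bullet> (axis k 1 - (x $ k) *\<^sub>R x) = e $ k"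
  by (simp add: inner_diff_right inner_axis inner_commute)

text \<open>\<open>g_eq\<close> is the flux equation (1 - z^2) (A g)' = A (z g - P Q) with A = (2 +
  g^2 + P^2) powr (\<alpha> - 1), cleared of the real power. All equations are multiplied by 1 - z^2
  where necessary, so that they can be demanded at the poles too.\<close>

locale symmetric_profile =
  fixes \<alpha> :: real and P Q g P' P'' g' :: "real \<Rightarrow> real"
  assumes P_deriv: "z \<in> {-1..1} \<Longrightarrow> (P has_real_derivative P' z) (at z)"
    and Q_deriv: "z \<in> {-1..1} \<Longrightarrow> (Q has_real_derivative P z * g z) (at z)"
    and P'_deriv: "z \<in> {-1..1} \<Longrightarrow> (P' has_real_derivative P'' z) (at z)"
    and g_deriv: "z \<in> {-1..1} \<Longrightarrow> (g has_real_derivative g' z) (at z)"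
    and P_eq: "z \<in> {-1..1} \<Longrightarrow> (1 - z\<^sup>2) * P' z = z * P z - Q z * g z"
    and unit: "z \<in> {-1..1} \<Longrightarrow> (Q z)\<^sup>2 + (1 - z\<^sup>2) * (P z)\<^sup>2 = 1"
    and g_eq: "z \<in> {-1..1} \<Longrightarrow>
      (1 - z\<^sup>2) * (g' z * (2 + (g z)\<^sup>2 + (P z)\<^sup>2) + 2 * (\<alpha> - 1) * g z * (g z * g' z + P z * P' z))
        = (2 + (g z)\<^sup>2 + (P z)\<^sup>2) * (z * g z - P z * Q z)"
begin

definition "A z = (2 + (g z)\<^sup>2 + (P z)\<^sup>2) powr (\<alpha> - 1)"

definition "A' z = 2 * (\<alpha> - 1) * (g z * g' z + P z * P' z) / (2 + (g z)\<^sup>2 + (P z)\<^sup>2) * A z"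

lemma den_pos: "2 + (g z)\<^sup>2 + (P z)\<^sup>2 > 0"
  by (simp add: add_pos_nonneg)

lemma A_deriv:
  assumes "z \<in> {-1..1}"
  shows "(A has_real_derivative A' z) (at z)"
proof -
  have "((\<lambda>z. 2 + (g z)\<^sup>2 + (P z)\<^sup>2) has_real_derivative 2 * (g z * g' z + P z * P' z)) (at z)"
    using P_deriv[OF assms] g_deriv[OF assms] by (auto intro!: derivative_eq_intros)
  from DERIV_powr[OF this den_pos DERIV_const[of "\<alpha> - 1"]]
  show ?thesis
    unfolding A_def [abs_def] A'_def by (rule DERIV_cong) (simp add: algebra_simps)
qed

lemma flux_eq:
  assumes "z \<in> {-1..1}"
  shows "(1 - z\<^sup>2) * (A' z * g z + A z * g' z) = A z * (z * g z - P z * Q z)"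
proof -
  let ?N = "2 + (g z)\<^sup>2 + (P z)\<^sup>2"
  have "?N * ((1 - z\<^sup>2) * (A' z * g z + A z * g' z))
     = A z * ((1 - z\<^sup>2) * (g' z * ?N + 2 * (\<alpha> - 1) * g z * (g z * g' z + P z * P' z)))"
    using den_pos[of z] by (simp add: A'_def field_simps)
  also have "\<dots> = ?N * (A z * (z * g z - P z * Q z))"
    unfolding g_eq[OF assms] by simp
  finally show ?thesis using den_pos[of z] by (metis less_irrefl mult_cancel_left)
qed

abbreviation "u \<equiv> sym_map P Q"

definition "du x v = (P' (x $ 3) * v $ 3 * x $ 1 + P (x $ 3) * v $ 1) *\<^sub>R axis 1 1
  + (P' (x $ 3) * v $ 3 * x $ 2 + P (x $ 3) * v $ 2) *\<^sub>R axis 2 1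
  + (P (x $ 3) * g (x $ 3) * v $ 3) *\<^sub>R (axis 3 1 :: real^3)" for x v :: "real^3"

lemma du_nth [simp]:
  "du x v $ 1 = P' (x $ 3) * v $ 3 * x $ 1 + P (x $ 3) * v $ 1"
  "du x v $ 2 = P' (x $ 3) * v $ 3 * x $ 2 + P (x $ 3) * v $ 2"
  "du x v $ 3 = P (x $ 3) * g (x $ 3) * v $ 3"
  by (simp_all add: du_def)

lemma u_has_derivative:
  assumes "x $ 3 \<in> {-1..1}"
  shows "(u has_derivative du x) (at x within \<Omega>)"
  unfolding sym_map_def [abs_def] du_def [abs_def]
  by (rule derivative_eq_intros has_derivative_height P_deriv Q_deriv has_derivative_coordinate assms
       refl ext)+ (simp add: algebra_simps)

context
  fixes c1 c2 :: real and x e f :: "real^3"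
  assumes c: "-1 \<le> c1" "c1 < c2" "c2 \<le> 1" and x: "x \<in> band c1 c2"
    and e_def: "e = fst (frame x)" and f_def: "f = snd (frame x)"
begin

lemma x_sphere: "x \<in> S2" using x by (auto simp: band_def)

lemma x3: "x $ 3 \<in> {-1..1}" using x c by (auto simp: band_def)

lemma unit': "(1 - (x $ 3)\<^sup>2) * (P (x $ 3))\<^sup>2 = 1 - (Q (x $ 3))\<^sup>2"
  using unit[OF x3] by simp

lemma fr: "oriented_frame x e f"
  unfolding e_def f_def by (rule oriented_frame_frame[OF x_sphere])

lemma e_derivs:
  assumes "(F has_derivative D) (at x within band c1 c2)"
  shows "e1_deriv (band c1 c2) F x = D e" "e2_deriv (band c1 c2) F x = D f"
  unfolding e_def f_def using frame_deriv_eq[OF x c assms] by auto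

lemmas comps = oriented_frame_components[OF fr x_sphere]

text \<open>The map stretches by g along meridians and by P along parallels. As the frame is
  arbitrary, |du e|^2 + |du f|^2 is first reduced to the frame-free combinations
  \<open>comps\<close>; then \<open>P_eq\<close> and the constraint remove P' and Q.\<close>

lemma grad_sq_sym: "grad_sq (band c1 c2) u x = (g (x $ 3))\<^sup>2 + (P (x $ 3))\<^sup>2"
proof -
  let ?z = "x $ 3"
  have s: "(x $ 1)\<^sup>2 + (x $ 2)\<^sup>2 = 1 - ?z\<^sup>2" using sphere_sum_squares[OF x_sphere] by simp
  have nn: "(norm (du x v))\<^sup>2 = (P ?z)\<^sup>2 * ((v $ 1)\<^sup>2 + (v $ 2)\<^sup>2)
     + 2 * P ?z * P' ?z * (x $ 1 * (v $ 1 * v $ 3) + x $ 2 * (v $ 2 * v $ 3))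
     + ((P' ?z)\<^sup>2 * ((x $ 1)\<^sup>2 + (x $ 2)\<^sup>2) + (P ?z * g ?z)\<^sup>2) * (v $ 3)\<^sup>2" for v
    by (simp add: power2_norm_eq_inner inner_vec_def sum_3) (simp add: power2_eq_square algebra_simps)
  have c': "(e $ i)\<^sup>2 + (f $ i)\<^sup>2 = 1 - (x $ i)\<^sup>2" for i
    using comps[of i i] by (simp add: power2_eq_square)
  have "grad_sq (band c1 c2) u x = (norm (du x e))\<^sup>2 + (norm (du x f))\<^sup>2"
    using e_derivs[OF u_has_derivative[OF x3]] by (simp add: grad_sq_def)
  also have "\<dots> = (P ?z)\<^sup>2 * (((e $ 1)\<^sup>2 + (f $ 1)\<^sup>2) + ((e $ 2)\<^sup>2 + (f $ 2)\<^sup>2))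
     + 2 * P ?z * P' ?z * (x $ 1 * (e $ 1 * e $ 3 + f $ 1 * f $ 3) + x $ 2 * (e $ 2 * e $ 3 + f $ 2 * f $ 3))
     + ((P' ?z)\<^sup>2 * ((x $ 1)\<^sup>2 + (x $ 2)\<^sup>2) + (P ?z * g ?z)\<^sup>2) * ((e $ 3)\<^sup>2 + (f $ 3)\<^sup>2)"
    unfolding nn by (simp add: algebra_simps)
  also have "\<dots> = (P ?z)\<^sup>2 * (2 - ((x $ 1)\<^sup>2 + (x $ 2)\<^sup>2))
     - 2 * P ?z * P' ?z * ?z * ((x $ 1)\<^sup>2 + (x $ 2)\<^sup>2)
     + ((P' ?z)\<^sup>2 * ((x $ 1)\<^sup>2 + (x $ 2)\<^sup>2) + (P ?z * g ?z)\<^sup>2) * (1 - ?z\<^sup>2)"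
    unfolding c' comps by (simp add: algebra_simps power2_eq_square)
  also have "\<dots> = (P ?z)\<^sup>2 * (1 + ?z\<^sup>2) - 2 * P ?z * ?z * ((1 - ?z\<^sup>2) * P' ?z)
     + ((1 - ?z\<^sup>2) * P' ?z)\<^sup>2 + ((1 - ?z\<^sup>2) * (P ?z)\<^sup>2) * (g ?z)\<^sup>2"
    unfolding s by (simp add: algebra_simps power2_eq_square)
  also have "\<dots> = (P ?z)\<^sup>2 * (1 + ?z\<^sup>2) - 2 * P ?z * ?z * (?z * P ?z - Q ?z * g ?z)
     + (?z * P ?z - Q ?z * g ?z)\<^sup>2 + (1 - (Q ?z)\<^sup>2) * (g ?z)\<^sup>2"
    unfolding P_eq[OF x3] unit' by (simp add: algebra_simps)
  also have "\<dots> = (g ?z)\<^sup>2 + (P ?z)\<^sup>2" by (simp add: algebra_simps power2_eq_square)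
  finally show ?thesis .
qed

lemma jac_sym: "jac (band c1 c2) u x = P (x $ 3) * g (x $ 3)"
proof -
  let ?z = "x $ 3"
  have s: "(x $ 1)\<^sup>2 + (x $ 2)\<^sup>2 = 1 - ?z\<^sup>2" using sphere_sum_squares[OF x_sphere] by simp
  have cr: "x $ 1 = e $ 2 * f $ 3 - e $ 3 * f $ 2" "x $ 2 = e $ 3 * f $ 1 - e $ 1 * f $ 3"
    "x $ 3 = e $ 1 * f $ 2 - e $ 2 * f $ 1"
    using fr unfolding oriented_frame_def cross3_def by (auto simp: vec_eq_iff forall_3)
  have "jac (band c1 c2) u x = u x \<bullet> cross3 (du x e) (du x f)"
    using e_derivs[OF u_has_derivative[OF x3]] by (simp add: jac_def)
  also have "\<dots> = (P ?z)\<^sup>2 * (P ?z * g ?z) * (x $ 1 * (e $ 2 * f $ 3 - e $ 3 * f $ 2) + x $ 2 * (e $ 3 * f $ 1 - e $ 1 * f $ 3))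
    + Q ?z * ((P ?z)\<^sup>2 * (e $ 1 * f $ 2 - e $ 2 * f $ 1) - P ?z * P' ?z * (x $ 1 * (e $ 2 * f $ 3 - e $ 3 * f $ 2) + x $ 2 * (e $ 3 * f $ 1 - e $ 1 * f $ 3)))"
    by (simp add: inner_vec_def sum_3 cross3_def) (simp add: algebra_simps power2_eq_square)
  also have "\<dots> = (P ?z)\<^sup>2 * (P ?z * g ?z) * ((x $ 1)\<^sup>2 + (x $ 2)\<^sup>2)
    + Q ?z * ((P ?z)\<^sup>2 * ?z - P ?z * P' ?z * ((x $ 1)\<^sup>2 + (x $ 2)\<^sup>2))"
    unfolding cr[symmetric] by (simp add: power2_eq_square)
  also have "\<dots> = ((1 - ?z\<^sup>2) * (P ?z)\<^sup>2) * (P ?z * g ?z)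
    + Q ?z * ((P ?z)\<^sup>2 * ?z - P ?z * ((1 - ?z\<^sup>2) * P' ?z))"
    unfolding s by (simp add: algebra_simps)
  also have "\<dots> = (1 - (Q ?z)\<^sup>2) * (P ?z * g ?z)
    + Q ?z * ((P ?z)\<^sup>2 * ?z - P ?z * (?z * P ?z - Q ?z * g ?z))"
    unfolding P_eq[OF x3] unit' by (simp add: algebra_simps)
  also have "\<dots> = P ?z * g ?z" by (simp add: algebra_simps power2_eq_square)
  finally show ?thesis .
qed

text \<open>The gradient has to be differentiated once more, whereas \<open>frame\<close> is an
  arbitrary choice and need not even be continuous. Hence this formula in x alone.\<close>

lemma sgrad_component: "sgrad (band c1 c2) (\<lambda>y. u y $ k) x =
  (if k = 3 then (P (x $ 3) * g (x $ 3)) *\<^sub>R (axis 3 1 - (x $ 3) *\<^sub>R x)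
   else (P' (x $ 3) * x $ k) *\<^sub>R (axis 3 1 - (x $ 3) *\<^sub>R x) + P (x $ 3) *\<^sub>R (axis k 1 - (x $ k) *\<^sub>R x))"
proof -
  have "((\<lambda>y. u y $ k) has_derivative (\<lambda>v. du x v $ k)) (at x within band c1 c2)"
    by (rule bounded_linear.has_derivative[OF bounded_linear_vec_nth u_has_derivative[OF x3]])
  note d = e_derivs[OF this]
  have k: "k = 1 \<or> k = 2 \<or> k = 3" by (rule exhaust_3)
  have s: "sgrad (band c1 c2) (\<lambda>y. u y $ k) x $ j = du x e $ k * e $ j + du x f $ k * f $ j" for j
    using d by (simp add: sgrad_def e_def f_def)
  have j: "j = 1 \<or> j = 2 \<or> j = 3" for j :: 3 by (rule exhaust_3)
  have "sgrad (band c1 c2) (\<lambda>y. u y $ k) x $ j =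
    (if k = 3 then (P (x $ 3) * g (x $ 3)) * (e $ 3 * e $ j + f $ 3 * f $ j)
     else (P' (x $ 3) * x $ k) * (e $ 3 * e $ j + f $ 3 * f $ j) + P (x $ 3) * (e $ k * e $ j + f $ k * f $ j))" for j
    unfolding s using k by (auto simp: algebra_simps)
  then show ?thesis
    unfolding comps by (auto simp: vec_eq_iff)
qed

end

text \<open>The third component is a combination of the flux equation and \<open>P_eq\<close>. The
  other two equal x $ k times one scalar expression in z; that it vanishes follows from the flux
  equation, \<open>P_eq\<close>, the derivative of \<open>P_eq\<close> and the constraint.\<close>

lemma alpha_harmonic_sym:
  assumes c: "-1 \<le> c1" "c1 < c2" "c2 \<le> 1"
    and smooth: "smooth_map_on (band c1 c2) u"
  shows "alpha_harmonic_on \<alpha> (band c1 c2) u"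
  unfolding alpha_harmonic_on_def
proof (intro conjI ballI smooth)
  show "u ` band c1 c2 \<subseteq> S2"
  proof
    fix y assume "y \<in> u ` band c1 c2"
    then obtain x where x: "x \<in> band c1 c2" "y = u x" by auto
    then have "x \<in> S2" "x $ 3 \<in> {-1..1}" using c by (auto simp: band_def)
    then have "(x $ 1)\<^sup>2 + (x $ 2)\<^sup>2 = 1 - (x $ 3)\<^sup>2" "x $ 3 \<in> {-1..1}"
      using sphere_sum_squares[of x] by auto
    moreover have "(u x $ 1)\<^sup>2 + (u x $ 2)\<^sup>2 + (u x $ 3)\<^sup>2
      = ((x $ 1)\<^sup>2 + (x $ 2)\<^sup>2) * (P (x $ 3))\<^sup>2 + (Q (x $ 3))\<^sup>2"
      by (simp add: power_mult_distrib algebra_simps)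
    ultimately have "(u x $ 1)\<^sup>2 + (u x $ 2)\<^sup>2 + (u x $ 3)\<^sup>2 = 1"
      using unit[of "x $ 3"] by simp
    then show "y \<in> S2"
      unfolding x by (simp add: norm_eq_1 inner_vec_def sum_3 power2_eq_square del: sym_map_nth)
  qed
next
  fix x assume x: "x \<in> band c1 c2"
  define e f where "e = fst (frame x)" and "f = snd (frame x)"
  note ef = e_def f_def
  define z where "z = x $ 3"
  let ?\<Omega> = "band c1 c2"
  have xs: "x \<in> S2" using x by (auto simp: band_def)
  have z: "z \<in> {-1..1}" using x c by (auto simp: band_def z_def)
  have fr: "oriented_frame x e f" using fr[OF c x] ef by simp
  note comps = oriented_frame_components[OF fr xs]
  have tang: "x \<bullet> e = 0" "x \<bullet> f = 0" using oriented_frame_tangent[OF fr] by auto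
  have unit_ef: "e \<bullet> e = 1" "f \<bullet> f = 1" using fr by (auto simp: oriented_frame_def norm_eq_1)
  have s: "(x $ 1)\<^sup>2 + (x $ 2)\<^sup>2 = 1 - z\<^sup>2" using sphere_sum_squares[OF xs] by (simp add: z_def)
  have inn: "w \<bullet> (a *\<^sub>R (axis k 1 - (x $ k) *\<^sub>R x) - b *\<^sub>R (w $ k *\<^sub>R x + x $ k *\<^sub>R w)) = a * w $ k - b * x $ k"
    if "x \<bullet> w = 0" "w \<bullet> w = 1" for w :: "real^3" and a b k
    using that inner_axis_tangential[of x w k] by (simp add: inner_diff_right inner_add_right inner_commute)
  define X where "X k y = (2 + grad_sq ?\<Omega> u y) powr (\<alpha> - 1) *\<^sub>R sgrad ?\<Omega> (\<lambda>z. u z $ k) y" for k y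
  have eqX: "X k y = A (y $ 3) *\<^sub>R (if k = 3 then (P (y $ 3) * g (y $ 3)) *\<^sub>R (axis 3 1 - (y $ 3) *\<^sub>R y)
    else (P' (y $ 3) * y $ k) *\<^sub>R (axis 3 1 - (y $ 3) *\<^sub>R y) + P (y $ 3) *\<^sub>R (axis k 1 - (y $ k) *\<^sub>R y))"
    if "y \<in> ?\<Omega>" for k y
    unfolding X_def grad_sq_sym[OF c that refl refl] sgrad_component[OF c that refl refl]
    by (simp add: A_def add.assoc)
  have div3: "sdiv ?\<Omega> (X 3) x = (A' z * P z * g z + A z * P' z * g z + A z * P z * g' z) * (1 - z\<^sup>2) - 2 * (A z * P z * g z) * z"
  proof -
    have "((\<lambda>y. A (y $ 3) * P (y $ 3) * g (y $ 3)) has_derivative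
      (\<lambda>v. (A' z * P z * g z + A z * P' z * g z + A z * P z * g' z) * v $ 3)) (at x within ?\<Omega>)"
      by (rule has_derivative_height)
         (use A_deriv[OF z] P_deriv[OF z] g_deriv[OF z] in \<open>auto simp: z_def algebra_simps intro!: derivative_eq_intros\<close>)
    from has_derivative_tangential_field[OF this, of 3]
    have "(X 3 has_derivative (\<lambda>v. ((A' z * P z * g z + A z * P' z * g z + A z * P z * g' z) * v $ 3) *\<^sub>R (axis 3 1 - (x $ 3) *\<^sub>R x)
      - (A z * P z * g z) *\<^sub>R (v $ 3 *\<^sub>R x + x $ 3 *\<^sub>R v))) (at x within ?\<Omega>)"
      unfolding z_def
      by (rule has_derivative_transform[OF x, rotated]) (use eqX in \<open>auto simp: mult.assoc\<close>)
    note d = e_derivs[OF c x ef this]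
    have h: "f $ 3 * f $ 3 = 1 - z\<^sup>2 - e $ 3 * e $ 3"
      using comps[of 3 3] by (simp add: z_def power2_eq_square)
    have gen: "a * e $ 3 * e $ 3 - b * x $ 3 + (a * f $ 3 * f $ 3 - b * x $ 3) = a * (1 - z\<^sup>2) - 2 * b * z" for a b
      unfolding mult.assoc h by (simp add: z_def algebra_simps)
    show ?thesis
      unfolding sdiv_def d ef[symmetric] inn[OF tang(1) unit_ef(1)] inn[OF tang(2) unit_ef(2)] by (rule gen)
  qed
  have divk: "sdiv ?\<Omega> (X k) x = x $ k * ((A' z * P' z + A z * P'' z) * (1 - z\<^sup>2) - 3 * z * (A z * P' z)
     - z * (A' z * P z + A z * P' z) - 2 * (A z * P z))" if "k \<noteq> 3" for k
  proof -
    have "((\<lambda>y. A (y $ 3) * P' (y $ 3)) has_derivative (\<lambda>v. (A' z * P' z + A z * P'' z) * v $ 3)) (at x within ?\<Omega>)"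
      by (rule has_derivative_height)
         (use A_deriv[OF z] P'_deriv[OF z] in \<open>auto simp: z_def algebra_simps intro!: derivative_eq_intros\<close>)
    from has_derivative_mult[OF this has_derivative_coordinate[of k]]
    have 1: "((\<lambda>y. A (y $ 3) * P' (y $ 3) * y $ k) has_derivative
       (\<lambda>v. A z * P' z * v $ k + (A' z * P' z + A z * P'' z) * v $ 3 * x $ k)) (at x within ?\<Omega>)"
      by (simp add: z_def)
    have 2: "((\<lambda>y. A (y $ 3) * P (y $ 3)) has_derivative (\<lambda>v. (A' z * P z + A z * P' z) * v $ 3)) (at x within ?\<Omega>)"
      by (rule has_derivative_height)
         (use A_deriv[OF z] P_deriv[OF z] in \<open>auto simp: z_def algebra_simps intro!: derivative_eq_intros\<close>)
    from has_derivative_add[OF has_derivative_tangential_field[OF 1, of 3] has_derivative_tangential_field[OF 2, of k]]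
    have "(X k has_derivative (\<lambda>v. (A z * P' z * v $ k + (A' z * P' z + A z * P'' z) * v $ 3 * x $ k) *\<^sub>R (axis 3 1 - (x $ 3) *\<^sub>R x)
        - (A z * P' z * x $ k) *\<^sub>R (v $ 3 *\<^sub>R x + x $ 3 *\<^sub>R v)
      + (((A' z * P z + A z * P' z) * v $ 3) *\<^sub>R (axis k 1 - (x $ k) *\<^sub>R x)
        - (A z * P z) *\<^sub>R (v $ k *\<^sub>R x + x $ k *\<^sub>R v)))) (at x within ?\<Omega>)"
      unfolding z_def
      by (rule has_derivative_transform[OF x, rotated]) (use eqX that in \<open>auto simp: mult.assoc scaleR_add_right\<close>)
    note d = e_derivs[OF c x ef this]
    show ?thesis
      unfolding sdiv_def d ef[symmetric] inner_add_right[of _ "_ - _"] inn[OF tang(1) unit_ef(1)] inn[OF tang(2) unit_ef(2)]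
    proof -
      have "e $ k * e $ 3 + f $ k * f $ 3 = - (x $ k * z)" "e $ 3 * e $ 3 + f $ 3 * f $ 3 = 1 - z\<^sup>2"
        using comps[of k 3] comps[of 3 3] that by (auto simp: z_def power2_eq_square)
      then have h: "f $ k * f $ 3 = - (x $ k * z) - e $ k * e $ 3" "f $ 3 * f $ 3 = 1 - z\<^sup>2 - e $ 3 * e $ 3"
        by linarith+
      have "(A z * P' z * e $ k + (A' z * P' z + A z * P'' z) * e $ 3 * x $ k) * e $ 3 - A z * P' z * x $ k * x $ 3 +
        ((A' z * P z + A z * P' z) * e $ 3 * e $ k - A z * P z * x $ k) +
        ((A z * P' z * f $ k + (A' z * P' z + A z * P'' z) * f $ 3 * x $ k) * f $ 3 - A z * P' z * x $ k * x $ 3 +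
        ((A' z * P z + A z * P' z) * f $ 3 * f $ k - A z * P z * x $ k))
       = A z * P' z * (e $ k * e $ 3 + f $ k * f $ 3) + (A' z * P' z + A z * P'' z) * x $ k * (e $ 3 * e $ 3 + f $ 3 * f $ 3)
         + (A' z * P z + A z * P' z) * (e $ k * e $ 3 + f $ k * f $ 3) - 2 * (A z * P' z * x $ k * x $ 3) - 2 * (A z * P z * x $ k)"
        by (simp add: algebra_simps)
      also have "\<dots> = x $ k * ((A' z * P' z + A z * P'' z) * (1 - z\<^sup>2) - 3 * z * (A z * P' z)
         - z * (A' z * P z + A z * P' z) - 2 * (A z * P z))"
        unfolding h by (simp add: z_def algebra_simps)
      finally show "(A z * P' z * e $ k + (A' z * P' z + A z * P'' z) * e $ 3 * x $ k) * e $ 3 - A z * P' z * x $ k * x $ 3 +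
        ((A' z * P z + A z * P' z) * e $ 3 * e $ k - A z * P z * x $ k) +
        ((A z * P' z * f $ k + (A' z * P' z + A z * P'' z) * f $ 3 * x $ k) * f $ 3 - A z * P' z * x $ k * x $ 3 +
        ((A' z * P z + A z * P' z) * f $ 3 * f $ k - A z * P z * x $ k)) = \<dots>" .
    qed
  qed
  have gs: "grad_sq ?\<Omega> u x = (g z)\<^sup>2 + (P z)\<^sup>2"
    using grad_sq_sym[OF c x refl refl] by (simp add: z_def)
  have Az: "(2 + grad_sq ?\<Omega> u x) powr (\<alpha> - 1) = A z"
    unfolding gs by (simp add: A_def add.assoc)
  have main: "sdiv ?\<Omega> (X k) x + A z * ((g z)\<^sup>2 + (P z)\<^sup>2) * u x $ k = 0" for k
  proof (cases "k = 3")
    case True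
    have "sdiv ?\<Omega> (X 3) x = P z * ((1 - z\<^sup>2) * (A' z * g z + A z * g' z)) + A z * g z * ((1 - z\<^sup>2) * P' z) - 2 * (A z * P z * g z) * z"
      unfolding div3 by (simp add: algebra_simps)
    also have "\<dots> = - (A z * ((g z)\<^sup>2 + (P z)\<^sup>2) * Q z)"
      unfolding flux_eq[OF z] P_eq[OF z] by (simp add: algebra_simps power2_eq_square)
    finally show ?thesis using True by (simp add: z_def)
  next
    case False
    show ?thesis
    \<comment> \<open>The scalar equation is obtained after multiplication by 1 - z^2, which cannot
      be cancelled at a pole. There, however, the horizontal coordinates vanish.\<close>
    proof (cases "x $ k = 0")
      case True
      have "u x $ k = 0" using True exhaust_3[of k] False by auto
      then show ?thesis unfolding divk[OF False] using True by simp
    next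
      case k0: False
      have "(x $ k)\<^sup>2 \<le> 1 - z\<^sup>2"
        using s False exhaust_3[of k] by (smt (verit) zero_le_power2)
      then have "z\<^sup>2 < 1" using k0 by (smt (verit) zero_less_power2)
      then have zz: "z \<in> {-1<..<1}" by (auto simp: abs_square_less_1 abs_less_iff)
      have ne: "1 - z\<^sup>2 \<noteq> 0" using \<open>z\<^sup>2 < 1\<close> by simp
      \<comment> \<open>\<open>P_eq\<close> is an identity near the interior point z, so it can be
        differentiated. Comparing the two derivatives expresses P'' through first
        derivatives.\<close>
      have "((\<lambda>z. (1 - z\<^sup>2) * P' z) has_real_derivative - 2 * z * P' z + (1 - z\<^sup>2) * P'' z) (at z)"
        using P'_deriv[OF z] by (auto intro!: derivative_eq_intros)
      moreover have "((\<lambda>z. z * P z - Q z * g z) has_real_derivative P z + z * P' z - (P z * g z * g z + Q z * g' z)) (at z)"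
        using P_deriv[OF z] Q_deriv[OF z] g_deriv[OF z] by (auto intro!: derivative_eq_intros)
      then have "((\<lambda>z. (1 - z\<^sup>2) * P' z) has_real_derivative P z + z * P' z - (P z * g z * g z + Q z * g' z)) (at z)"
        by (rule has_field_derivative_transform_within_open[of _ _ _ "{-1<..<1}"]) (use zz P_eq in auto)
      ultimately have P''_eq: "(1 - z\<^sup>2) * P'' z = P z + 3 * z * P' z - (P z * (g z)\<^sup>2 + Q z * g' z)"
        using DERIV_unique by (fastforce simp: power2_eq_square)
      let ?B = "(A' z * P' z + A z * P'' z) * (1 - z\<^sup>2) - 3 * z * (A z * P' z)
         - z * (A' z * P z + A z * P' z) - 2 * (A z * P z)"
      have B: "?B = A' z * ((1 - z\<^sup>2) * P' z) + A z * ((1 - z\<^sup>2) * P'' z) - 3 * z * (A z * P' z)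
         - z * (A' z * P z + A z * P' z) - 2 * (A z * P z)"
        by (simp add: algebra_simps)
      have BR: "?B = - Q z * (A' z * g z + A z * g' z) - A z * P z * (1 + (g z)\<^sup>2) - z * A z * P' z"
        unfolding B P''_eq P_eq[OF z] by (simp add: algebra_simps)
      have unit': "(1 - z\<^sup>2) * (P z)\<^sup>2 = 1 - (Q z)\<^sup>2" using unit[OF z] by simp
      have "(1 - z\<^sup>2) * (?B + A z * ((g z)\<^sup>2 + (P z)\<^sup>2) * P z)
        = - Q z * ((1 - z\<^sup>2) * (A' z * g z + A z * g' z)) - (1 - z\<^sup>2) * (A z * P z * (1 + (g z)\<^sup>2)) - z * A z * ((1 - z\<^sup>2) * P' z)
          + A z * (1 - z\<^sup>2) * (g z)\<^sup>2 * P z + A z * P z * ((1 - z\<^sup>2) * (P z)\<^sup>2)"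
        unfolding BR by (simp add: algebra_simps power2_eq_square)
      also have "\<dots> = 0"
        unfolding flux_eq[OF z] P_eq[OF z] unit' by (simp add: algebra_simps power2_eq_square)
      finally have "?B + A z * ((g z)\<^sup>2 + (P z)\<^sup>2) * P z = 0" using ne by simp
      moreover have uk: "u x $ k = P z * x $ k" using exhaust_3[of k] False by (auto simp: z_def)
      have "x $ k * a + b * (P z * x $ k) = x $ k * (a + b * P z)" for a b
        by (simp add: algebra_simps)
      then have "sdiv ?\<Omega> (X k) x + A z * ((g z)\<^sup>2 + (P z)\<^sup>2) * u x $ k = x $ k * (?B + A z * ((g z)\<^sup>2 + (P z)\<^sup>2) * P z)"
        unfolding divk[OF False] uk by blast
      ultimately show ?thesis by (metis mult_zero_right)
    qed
  qed
  show "(\<chi> k. sdiv ?\<Omega> (\<lambda>y. (2 + grad_sq ?\<Omega> u y) powr (\<alpha> - 1) *\<^sub>R sgrad ?\<Omega> (\<lambda>z. u z $ k) y) x)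
      + ((2 + grad_sq ?\<Omega> u x) powr (\<alpha> - 1) * grad_sq ?\<Omega> u x) *\<^sub>R u x = 0"
    using main unfolding Az unfolding gs X_def [symmetric] by (simp add: vec_eq_iff del: sym_map_nth)
qed

end

subsection \<open>Integration on spherical bands\<close>

lemma sph_nth [simp]: "sph r \<theta> $ 1 = sin r * cos \<theta>" "sph r \<theta> $ 2 = sin r * sin \<theta>" "sph r \<theta> $ 3 = cos r"
  by (simp_all add: sph_def)

lemma sph_in_S2: "sph r \<theta> \<in> S2"
proof -
  have "(sin r * cos \<theta>)\<^sup>2 + (sin r * sin \<theta>)\<^sup>2 + (cos r)\<^sup>2 = (sin r)\<^sup>2 * ((cos \<theta>)\<^sup>2 + (sin \<theta>)\<^sup>2) + (cos r)\<^sup>2"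
    by (simp only: power_mult_distrib distrib_left)
  then have "(sin r * cos \<theta>)\<^sup>2 + (sin r * sin \<theta>)\<^sup>2 + (cos r)\<^sup>2 = 1"
    by simp
  then show ?thesis
    by (simp add: norm_eq_1 inner_vec_def sum_3 flip: power2_eq_square)
qed

lemma continuous_on_sph: "continuous_on UNIV (\<lambda>p. sph (fst p) (snd p))"
proof -
  have "sph r \<theta> = (sin r * cos \<theta>) *\<^sub>R axis 1 1 + (sin r * sin \<theta>) *\<^sub>R axis 2 1 + cos r *\<^sub>R axis 3 1" for r \<theta>
    by (simp add: vec_eq_iff forall_3)
  then show ?thesis by (auto intro!: continuous_intros)
qed

lemma sphere_area_integral_band:
  assumes c: "-1 \<le> c1" "c1 < c2" "c2 \<le> 1" and h: "continuous_on {c1..c2} h"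
    and F: "\<And>x. x \<in> band c1 c2 \<Longrightarrow> F x = h (x $ 3)"
  shows "(LINT x:band c1 c2|sphere_area. F x) =
    2 * pi * integral {arccos c2..arccos c1} (\<lambda>r. sin r * h (cos r))"
proof -
  \<comment> \<open>F is known only on the band. \<open>H\<close> and \<open>G\<close> extend it by
    zero to Borel functions on the line and on R^3, as the change of measure requires.\<close>
  define H where "H z = indicator {c1..c2} z *\<^sub>R h z" for z
  define G where "G x = indicator S2 x * H (x $ 3)" for x :: "real^3"
  have H: "H \<in> borel_measurable borel"
    unfolding H_def [abs_def] by (rule borel_measurable_continuous_on_indicator[OF _ h]) simp
  have G: "G \<in> borel_measurable borel"
    unfolding G_def [abs_def]
    by (intro borel_measurable_times borel_measurable_indicator measurable_compose[OF _ H]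
        borel_measurable_continuous_onI continuous_intros) simp
  have s: "(\<lambda>p. sph (fst p) (snd p)) \<in> borel_measurable lborel"
    using borel_measurable_continuous_onI[OF continuous_on_sph] by simp
  define k where "k r = indicator {arccos c2..arccos c1} r *\<^sub>R (sin r * h (cos r))" for r
  have ck: "continuous_on {arccos c2..arccos c1} (\<lambda>r. sin r * h (cos r))"
  proof (intro continuous_intros continuous_on_compose2[OF h])
    show "cos ` {arccos c2..arccos c1} \<subseteq> {c1..c2}"
    proof
      fix y assume "y \<in> cos ` {arccos c2..arccos c1}"
      then obtain r where r: "arccos c2 \<le> r" "r \<le> arccos c1" "y = cos r" by auto
      have "0 \<le> arccos c2" "arccos c1 \<le> pi" using c by (auto intro: arccos_lbound arccos_ubound)
      then have "cos (arccos c1) \<le> cos r" "cos r \<le> cos (arccos c2)"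
        using r by (auto intro!: cos_monotone_0_pi_le)
      then show "y \<in> {c1..c2}" using c r by (simp add: cos_arccos)
    qed
  qed
  have ik: "integrable lborel k"
    using borel_integrable_atLeastAtMost'[OF ck] by (simp add: set_integrable_def k_def [abs_def])
  have mem: "cos r \<in> {c1..c2} \<longleftrightarrow> r \<in> {arccos c2..arccos c1}" if "0 \<le> r" "r \<le> pi" for r
    using that c cos_mono_le_eq[of "arccos c1" r] cos_mono_le_eq[of r "arccos c2"]
    by (auto simp: cos_arccos arccos_lbound arccos_ubound)
  have "(LINT x:band c1 c2|sphere_area. F x) = (LINT x|sphere_area. G x)"
    unfolding set_lebesgue_integral_def
    by (rule Bochner_Integration.integral_cong)
       (auto simp: G_def H_def F band_def indicator_def)
  also have "\<dots> = (LINT p|density lborel (\<lambda>p. ennreal (indicator (cbox (0, 0) (pi, 2*pi)) p * sin (fst p))).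
      G (sph (fst p) (snd p)))"
    unfolding sphere_area_def by (rule integral_distr) (use s G in auto)
  also have "\<dots> = (LINT p|lborel. (indicator (cbox (0, 0) (pi, 2*pi)) p * sin (fst p)) *\<^sub>R G (sph (fst p) (snd p)))"
  proof (rule integral_density)
    show "(\<lambda>p. G (sph (fst p) (snd p))) \<in> borel_measurable lborel"
      using measurable_compose[OF s G] by simp
    show "(\<lambda>p. indicator (cbox (0, 0) (pi, 2 * pi)) p * sin (fst p)) \<in> borel_measurable (lborel :: (real \<times> real) measure)"
      by (intro borel_measurable_times borel_measurable_indicator)
         (auto intro!: borel_measurable_continuous_onI continuous_intros)
    show "AE p in lborel. 0 \<le> indicator (cbox (0, 0) (pi, 2 * pi)) p * sin (fst p)"
      by (rule AE_I2) (auto simp: indicator_def sin_ge_zero)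
  qed
  also have "\<dots> = (LINT p|(lborel \<Otimes>\<^sub>M lborel). k (fst p) * indicator {0..2*pi} (snd p))"
    unfolding lborel_prod
  proof (rule Bochner_Integration.integral_cong)
    fix p :: "real \<times> real"
    obtain r \<theta> where p: "p = (r, \<theta>)" by fastforce
    have z: "k r = 0" if "\<not> (0 \<le> r \<and> r \<le> pi)"
    proof -
      have "0 \<le> arccos c2" "arccos c1 \<le> pi" using c by (auto intro: arccos_lbound arccos_ubound)
      then show ?thesis using that by (auto simp: k_def indicator_def)
    qed
    have "indicator (cbox (0, 0) (pi, 2*pi)) (r, \<theta>) = (indicator {0..pi} r * indicator {0..2*pi} \<theta> :: real)"
      by (auto simp: indicator_def cbox_Pair_eq)
    moreover have "indicator {0..pi} r * (sin r * H (cos r)) = k r"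
      using z mem[of r] by (auto simp: H_def k_def indicator_def)
    ultimately show "(indicator (cbox (0, 0) (pi, 2*pi)) p * sin (fst p)) *\<^sub>R G (sph (fst p) (snd p))
       = k (fst p) * indicator {0..2*pi} (snd p)"
      using sph_in_S2[of r \<theta>] by (simp add: p G_def)
  qed simp
  also have "\<dots> = (LINT r|lborel. LINT \<theta>|lborel. k r * indicator {0..2*pi} \<theta>)"
  proof -
    have i1: "integrable lborel (\<lambda>\<theta>. indicator {0..2*pi} \<theta> :: real)" by simp
    have "integrable (lborel \<Otimes>\<^sub>M lborel) (\<lambda>p. k (fst p) * indicator {0..2*pi} (snd p))"
    proof (rule lborel_pair.Fubini_integrable)
      have [measurable]: "k \<in> borel_measurable borel" using ik by simp
      show "(\<lambda>p. k (fst p) * indicator {0..2*pi} (snd p)) \<in> borel_measurable (lborel \<Otimes>\<^sub>M lborel)"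
        by measurable
      have "(\<lambda>x. LINT y|lborel. norm (k (fst (x, y)) * indicator {0..2*pi} (snd (x, y)))) = (\<lambda>x. \<bar>k x\<bar> * (2 * pi))"
        by (auto simp: abs_mult)
      then show "integrable lborel (\<lambda>x. LINT y|lborel. norm (k (fst (x, y)) * indicator {0..2*pi} (snd (x, y))))"
        using ik by simp
      show "AE x in lborel. integrable lborel (\<lambda>y. k (fst (x, y)) * indicator {0..2*pi} (snd (x, y)))"
        using i1 by simp
    qed
    from lborel_pair.integral_fst'[OF this] show ?thesis by simp
  qed
  also have "\<dots> = 2 * pi * (LINT r|lborel. k r)"
    by (simp add: mult.commute)
  also have "(LINT r|lborel. k r) = integral {arccos c2..arccos c1} (\<lambda>r. sin r * h (cos r))"
    using set_borel_integral_eq_integral(2)[OF borel_integrable_atLeastAtMost'[OF ck]]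
    by (simp add: set_lebesgue_integral_def k_def [abs_def])
  finally show ?thesis .
qed

text \<open>Young's inequality for x and y powr (\<alpha> - 1), with exponents \<alpha> and \<alpha>
  / (\<alpha> - 1), rearranged.\<close>

lemma powr_tangent_ineq:
  fixes x y \<alpha> :: real
  assumes "\<alpha> > 1" "x \<ge> 0" "y > 0"
  shows "y powr \<alpha> + \<alpha> * y powr (\<alpha> - 1) * (x - y) \<le> x powr \<alpha>"
proof -
  have "x * y powr (\<alpha> - 1) \<le> x powr \<alpha> / \<alpha> + (y powr (\<alpha> - 1)) powr (\<alpha> / (\<alpha> - 1)) / (\<alpha> / (\<alpha> - 1))"
    by (rule Youngs_inequality) (use assms in \<open>auto simp: field_simps\<close>)
  also have "(y powr (\<alpha> - 1)) powr (\<alpha> / (\<alpha> - 1)) = y powr \<alpha>"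
    using assms by (simp add: powr_powr)
  finally have "\<alpha> * (x * y powr (\<alpha> - 1)) \<le> x powr \<alpha> + (\<alpha> - 1) * y powr \<alpha>"
    using assms by (simp add: field_simps)
  moreover have "y * y powr (\<alpha> - 1) = y powr \<alpha>"
    using assms by (simp add: powr_diff)
  ultimately show ?thesis by (simp add: algebra_simps)
qed

context symmetric_profile begin

lemma continuous_Pg: "continuous_on {-1..1} P" "continuous_on {-1..1} g" "continuous_on {-1..1} Q"
  using P_deriv g_deriv Q_deriv
  by (meson DERIV_isCont continuous_at_imp_continuous_on)+

lemma Q_integral:
  assumes "a \<le> b"
  shows "((\<lambda>r. sin r * (P (cos r) * g (cos r))) has_integral Q (cos a) - Q (cos b)) {a..b}"
proof -
  have "((\<lambda>r. sin r * (P (cos r) * g (cos r))) has_integral (- Q (cos b)) - (- Q (cos a))) {a..b}"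
  proof (rule fundamental_theorem_of_calculus[OF assms])
    fix r assume "r \<in> {a..b}"
    have "cos r \<in> {-1..1}" by simp
    from DERIV_chain2[where f=Q and g=cos and x=r and s=UNIV, OF Q_deriv[OF this] DERIV_cos]
    have "((\<lambda>r. - Q (cos r)) has_real_derivative sin r * (P (cos r) * g (cos r))) (at r)"
      by (auto intro!: derivative_eq_intros)
    then show "((\<lambda>r. - Q (cos r)) has_vector_derivative sin r * (P (cos r) * g (cos r))) (at r within {a..b})"
      by (simp add: has_real_derivative_iff_has_vector_derivative has_vector_derivative_at_within)
  qed
  then show ?thesis by simp
qed

lemma deg_sym:
  assumes c: "-1 \<le> c1" "c1 < c2" "c2 \<le> 1"
  shows "deg (band c1 c2) u = (Q c2 - Q c1) / 2"
proof -
  have "continuous_on {c1..c2} (\<lambda>z. P z * g z)"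
    by (intro continuous_intros) (use continuous_Pg c in \<open>auto elim: continuous_on_subset\<close>)
  from sphere_area_integral_band[OF c this, of "jac (band c1 c2) u"] jac_sym[OF c]
  have "deg (band c1 c2) u = 1 / (4 * pi) * (2 * pi * integral {arccos c2..arccos c1} (\<lambda>r. sin r * (P (cos r) * g (cos r))))"
    by (simp add: deg_def)
  moreover have "arccos c2 \<le> arccos c1" using c by (intro arccos_le_arccos) auto
  ultimately show ?thesis
    using integral_unique[OF Q_integral] c by (simp add: cos_arccos)
qed

text \<open>The heights z0 and -z0 cut the meridian into three arcs, on each of which Q changes by
  2. So the integral of g^2 + P^2 against sin r dr is at least 12, and its mean at least 6, as sin r
  dr has mass 2. Hence the tangent is taken at 8 = 2 + 6, where the linear term contributes nothing
  negative.\<close>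

lemma energy_lower_bound:
  assumes \<alpha>: "\<alpha> > 1" and z0: "0 < z0" "z0 < 1" "Q z0 = -1" "Q (- z0) = 1" "Q 1 = 1" "Q (- 1) = - 1"
  shows "alpha_energy \<alpha> u \<ge> 2 powr (3 * \<alpha> + 1) * pi"
proof -
  let ?e = "\<lambda>z. (2 + ((g z)\<^sup>2 + (P z)\<^sup>2)) powr \<alpha>"
  let ?j = "\<lambda>r. sin r * (P (cos r) * g (cos r))"
  let ?C = "\<alpha> * 8 powr (\<alpha> - 1)"
  have ce: "continuous_on {-1..1} ?e"
    by (intro continuous_intros continuous_Pg) (smt (verit) zero_le_power2)
  have "alpha_energy \<alpha> u = 1/2 * (2 * pi * integral {arccos 1..arccos (-1)} (\<lambda>r. sin r * ?e (cos r)))"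
    unfolding alpha_energy_def S2_eq_band
    by (subst sphere_area_integral_band[OF _ _ _ ce]) (use grad_sq_sym in auto)
  then have E: "alpha_energy \<alpha> u = pi * integral {0..pi} (\<lambda>r. sin r * ?e (cos r))" by simp
  have cj: "continuous_on S (\<lambda>r. \<bar>?j r\<bar>)" for S
    by (intro continuous_intros continuous_on_compose2[OF continuous_Pg(1)] continuous_on_compose2[OF continuous_Pg(2)]) auto
  have J: "\<bar>Q (cos a) - Q (cos b)\<bar> \<le> integral {a..b} (\<lambda>r. \<bar>?j r\<bar>)" if "a \<le> b" for a b
    using integral_norm_bound_integral[of ?j "{a..b}" "\<lambda>r. \<bar>?j r\<bar>"] Q_integral[OF that]
      integrable_continuous_real[OF cj]
    by (simp add: has_integral_integrable integral_unique)
  let ?r = "arccos z0"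
  have r: "0 < ?r" "?r < pi / 2"
    using z0 arccos_lt_bounded[of z0] arccos_less_arccos[of 0 z0] by auto
  have cr: "cos ?r = z0" "cos (pi - ?r) = - z0" using z0 by (auto simp: cos_arccos)
  have "integral {0..pi} (\<lambda>r. \<bar>?j r\<bar>) = integral {0..?r} (\<lambda>r. \<bar>?j r\<bar>) + integral {?r..pi - ?r} (\<lambda>r. \<bar>?j r\<bar>)
    + integral {pi - ?r..pi} (\<lambda>r. \<bar>?j r\<bar>)"
    using r integrable_continuous_real[OF cj] by (simp add: Henstock_Kurzweil_Integration.integral_combine)
  moreover have "2 \<le> integral {0..?r} (\<lambda>r. \<bar>?j r\<bar>)" using J[of 0 ?r] r cr z0 by simp
  moreover have "2 \<le> integral {?r..pi - ?r} (\<lambda>r. \<bar>?j r\<bar>)" using J[of ?r "pi - ?r"] r cr z0 by simp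
  moreover have "2 \<le> integral {pi - ?r..pi} (\<lambda>r. \<bar>?j r\<bar>)" using J[of "pi - ?r" pi] r cr z0 by simp
  ultimately have J6: "6 \<le> integral {0..pi} (\<lambda>r. \<bar>?j r\<bar>)" by linarith
  have sin_int: "((\<lambda>r. sin r) has_integral 2) {0..pi}"
  proof -
    have "((\<lambda>r. sin r) has_integral (- cos pi) - (- cos 0)) {0..pi}"
      by (rule fundamental_theorem_of_calculus)
         (auto simp: has_real_derivative_iff_has_vector_derivative[symmetric] intro!: derivative_eq_intros)
    then show ?thesis by simp
  qed
  \<comment> \<open>sin r times the tangent line at 8, with g^2 + P^2 replaced by its lower bound 2
    |P g|.\<close>
  let ?m = "\<lambda>r. (8 powr \<alpha> - 6 * ?C) * sin r + 2 * ?C * \<bar>?j r\<bar>"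
  have m: "(?m has_integral (8 powr \<alpha> - 6 * ?C) * 2 + 2 * ?C * integral {0..pi} (\<lambda>r. \<bar>?j r\<bar>)) {0..pi}"
    by (intro has_integral_add has_integral_mult_right sin_int integrable_integral integrable_continuous_real cj)
  have "integral {0..pi} ?m \<le> integral {0..pi} (\<lambda>r. sin r * ?e (cos r))"
  proof (rule integral_le)
    show "?m integrable_on {0..pi}" using m by (rule has_integral_integrable)
    show "(\<lambda>r. sin r * ?e (cos r)) integrable_on {0..pi}"
      by (intro integrable_continuous_real continuous_intros continuous_on_compose2[OF ce]) auto
    fix r assume r: "r \<in> {0..pi}"
    then have s: "sin r \<ge> 0" by (auto intro: sin_ge_zero)
    let ?P = "P (cos r)" and ?g = "g (cos r)"
    have "2 * \<bar>?P * ?g\<bar> \<le> ?g\<^sup>2 + ?P\<^sup>2"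
      using sum_squares_bound[of "\<bar>?g\<bar>" "\<bar>?P\<bar>"] by (simp add: abs_mult mult_ac)
    then have "?C * (2 * \<bar>?P * ?g\<bar> - 6) \<le> ?C * ((2 + (?g\<^sup>2 + ?P\<^sup>2)) - 8)"
      using \<alpha> by (intro mult_left_mono) auto
    moreover have "8 powr \<alpha> + ?C * ((2 + (?g\<^sup>2 + ?P\<^sup>2)) - 8) \<le> ?e (cos r)"
      using powr_tangent_ineq[OF \<alpha>, of "2 + (?g\<^sup>2 + ?P\<^sup>2)" 8] by simp
    ultimately have "8 powr \<alpha> - 6 * ?C + 2 * ?C * \<bar>?P * ?g\<bar> \<le> ?e (cos r)" by (simp add: algebra_simps)
    from mult_left_mono[OF this s]
    show "?m r \<le> sin r * ?e (cos r)" using s by (simp add: abs_mult algebra_simps)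
  qed
  then have "(8 powr \<alpha> - 6 * ?C) * 2 + 2 * ?C * integral {0..pi} (\<lambda>r. \<bar>?j r\<bar>) \<le> integral {0..pi} (\<lambda>r. sin r * ?e (cos r))"
    using integral_unique[OF m] by simp
  moreover have "2 * ?C * 6 \<le> 2 * ?C * integral {0..pi} (\<lambda>r. \<bar>?j r\<bar>)"
    using J6 \<alpha> by (intro mult_left_mono) auto
  ultimately have "2 * 8 powr \<alpha> \<le> integral {0..pi} (\<lambda>r. sin r * ?e (cos r))" by (simp add: algebra_simps)
  moreover have "2 powr (3 * \<alpha> + 1) = 2 * (8::real) powr \<alpha>"
  proof -
    have "(2::real) powr (3 * \<alpha>) = (2 powr 3) powr \<alpha>" by (simp only: powr_powr)
    then show ?thesis by (simp add: powr_add)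
  qed
  ultimately show ?thesis unfolding E by (simp add: mult.commute)
qed

end

subsection \<open>Averaged integral equations\<close>

text \<open>Integrating exp (L \<tau> |t|) over \<tau> gains a factor 1 / (L |t|), so the part k |t|
  of the Lipschitz constant contributes at most k / L \<le> 1/4. The constant part 1/4 gains
  nothing. Together they give 1/2.\<close>

lemma weighted_integral_le:
  fixes L k t N :: real
  assumes "L > 0" "4 * k \<le> L" "k \<ge> 0" "N \<ge> 0"
  shows "integral {0..1} (\<lambda>\<tau>. (k * \<bar>t\<bar> + 1/4) * (N * exp (L * (\<tau> * \<bar>t\<bar>)))) \<le> N * exp (L * \<bar>t\<bar>) / 2"
proof -
  let ?f = "\<lambda>\<tau>. (k * \<bar>t\<bar> + 1/4) * (N * exp (L * (\<tau> * \<bar>t\<bar>)))"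
  let ?h = "\<lambda>\<tau>. k * N / L * (L * \<bar>t\<bar> * exp (L * (\<tau> * \<bar>t\<bar>))) + 1/4 * (N * exp (L * \<bar>t\<bar>))"
  have "((\<lambda>\<tau>. L * \<bar>t\<bar> * exp (L * (\<tau> * \<bar>t\<bar>))) has_integral exp (L * (1 * \<bar>t\<bar>)) - exp (L * (0 * \<bar>t\<bar>))) {0..1}"
    by (rule fundamental_theorem_of_calculus)
       (auto simp flip: has_real_derivative_iff_has_vector_derivative intro!: derivative_eq_intros)
  then have h: "(?h has_integral k * N / L * (exp (L * \<bar>t\<bar>) - 1) + 1/4 * (N * exp (L * \<bar>t\<bar>))) {0..1}"
    by (intro has_integral_add has_integral_mult_right) (use has_integral_const_real[of _ 0 1] in auto)
  have "integral {0..1} ?f \<le> integral {0..1} ?h"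
  proof (rule integral_le)
    show "?f integrable_on {0..1}" by (auto intro!: integrable_continuous_real continuous_intros)
    show "?h integrable_on {0..1}" using h by blast
    fix \<tau> :: real assume \<tau>: "\<tau> \<in> {0..1}"
    then have "\<tau> * \<bar>t\<bar> \<le> \<bar>t\<bar>" by (simp add: mult_left_le_one_le)
    then have "exp (L * (\<tau> * \<bar>t\<bar>)) \<le> exp (L * \<bar>t\<bar>)" using assms(1) by simp
    then show "?f \<tau> \<le> ?h \<tau>" using assms by (simp add: field_simps mult_left_mono)
  qed
  also have "\<dots> = k / L * (N * (exp (L * \<bar>t\<bar>) - 1)) + 1/4 * (N * exp (L * \<bar>t\<bar>))"
    using integral_unique[OF h] by simp
  also have "\<dots> \<le> 1/4 * (N * exp (L * \<bar>t\<bar>)) + 1/4 * (N * exp (L * \<bar>t\<bar>))"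
  proof (intro add_mono mult_mono order_refl)
    show "k / L \<le> 1 / 4" using assms by (simp add: field_simps)
    show "0 \<le> N * (exp (L * \<bar>t\<bar>) - 1)" using assms by simp
    show "exp (L * \<bar>t\<bar>) - 1 \<le> exp (L * \<bar>t\<bar>)" by simp
  qed (use assms in auto)
  finally show ?thesis by simp
qed

text \<open>Describes Y t = y0 + integral of G \<tau> t (Y (\<tau> t)) over \<tau> in [0,1].
  Components whose integrand carries a factor t account for k |t| in the Lipschitz constant; the
  summand 1/4 is room for a singular component without such a factor.\<close>

locale averaged_equation =
  fixes G :: "real \<Rightarrow> real \<Rightarrow> 'b::euclidean_space \<Rightarrow> 'b" and l h k N :: real
  assumes lh: "l \<le> 0" "0 \<le> h" and k: "k \<ge> 0"
    and cont: "continuous_on ({0..1} \<times> {l..h} \<times> UNIV) (\<lambda>(\<tau>, t, y). G \<tau> t y)"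
    and lip: "\<And>\<tau> t y y'. \<tau> \<in> {0..1} \<Longrightarrow> t \<in> {l..h} \<Longrightarrow>
        norm (G \<tau> t y - G \<tau> t y') \<le> (k * \<bar>t\<bar> + 1/4) * norm (y - y')"
    and bound: "\<And>\<tau> t. \<tau> \<in> {0..1} \<Longrightarrow> t \<in> {l..h} \<Longrightarrow> norm (G \<tau> t 0) \<le> N"
begin

lemma integrand_integrable:
  assumes "t \<in> S" "S \<subseteq> {l..h}" "convex S" "0 \<in> S" "continuous_on S Y"
  shows "(\<lambda>\<tau>. G \<tau> t (Y (\<tau> * t))) integrable_on {0..1}"
proof -
  have "continuous_on {0..1} (\<lambda>\<tau>. Y (\<tau> * t))"
    using scaled_in_interval[OF assms(3,4,1)]
    by (intro continuous_on_compose2[OF assms(5)] continuous_intros) auto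
  then have "continuous_on {0..1} (\<lambda>\<tau>. (\<lambda>(\<tau>, t, y). G \<tau> t y) (\<tau>, t, Y (\<tau> * t)))"
    using assms(1,2) by (intro continuous_on_compose2[OF cont] continuous_intros) auto
  then show ?thesis by (simp add: integrable_continuous_real)
qed

lemma integral_diff_le:
  assumes "t \<in> S" "S \<subseteq> {l..h}" "convex S" "0 \<in> S" "continuous_on S Y" "continuous_on S Y'"
    and L: "L > 0" "4 * k \<le> L" and D: "D \<ge> 0"
    and d: "\<And>s. s \<in> S \<Longrightarrow> norm (Y s - Y' s) \<le> D * exp (L * \<bar>s\<bar>)"
  shows "norm (integral {0..1} (\<lambda>\<tau>. G \<tau> t (Y (\<tau> * t))) - integral {0..1} (\<lambda>\<tau>. G \<tau> t (Y' (\<tau> * t))))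
    \<le> D * exp (L * \<bar>t\<bar>) / 2"
proof -
  note i = integrand_integrable[OF assms(1-4)]
  have "norm (integral {0..1} (\<lambda>\<tau>. G \<tau> t (Y (\<tau> * t))) - integral {0..1} (\<lambda>\<tau>. G \<tau> t (Y' (\<tau> * t))))
     = norm (integral {0..1} (\<lambda>\<tau>. G \<tau> t (Y (\<tau> * t)) - G \<tau> t (Y' (\<tau> * t))))"
    using i[OF assms(5)] i[OF assms(6)] by (simp add: Henstock_Kurzweil_Integration.integral_diff)
  also have "\<dots> \<le> integral {0..1} (\<lambda>\<tau>. (k * \<bar>t\<bar> + 1/4) * (D * exp (L * (\<tau> * \<bar>t\<bar>))))"
  proof (rule integral_norm_bound_integral)
    show "(\<lambda>\<tau>. G \<tau> t (Y (\<tau> * t)) - G \<tau> t (Y' (\<tau> * t))) integrable_on {0..1}"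
      by (intro Henstock_Kurzweil_Integration.integrable_diff i assms)
    show "(\<lambda>\<tau>. (k * \<bar>t\<bar> + 1/4) * (D * exp (L * (\<tau> * \<bar>t\<bar>)))) integrable_on {0..1}"
      by (auto intro!: integrable_continuous_real continuous_intros)
    fix \<tau> :: real assume \<tau>: "\<tau> \<in> {0..1}"
    have "norm (G \<tau> t (Y (\<tau> * t)) - G \<tau> t (Y' (\<tau> * t))) \<le> (k * \<bar>t\<bar> + 1/4) * norm (Y (\<tau> * t) - Y' (\<tau> * t))"
      using \<tau> assms(1,2) by (intro lip) auto
    also have "\<dots> \<le> (k * \<bar>t\<bar> + 1/4) * (D * exp (L * \<bar>\<tau> * t\<bar>))"
      using k \<tau> scaled_in_interval[OF assms(3,4,1)] by (intro mult_left_mono d) auto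
    finally show "norm (G \<tau> t (Y (\<tau> * t)) - G \<tau> t (Y' (\<tau> * t))) \<le> (k * \<bar>t\<bar> + 1/4) * (D * exp (L * (\<tau> * \<bar>t\<bar>)))"
      using \<tau> by (simp add: abs_mult)
  qed
  also have "\<dots> \<le> D * exp (L * \<bar>t\<bar>) / 2"
    by (rule weighted_integral_le[OF L k D])
  finally show ?thesis .
qed

text \<open>At a maximum point s of the weighted difference \<open>d\<close>, the contraction
  estimate gives d s \<le> d s / 2.\<close>

lemma unique:
  assumes "T \<ge> 0" "T \<le> h" "continuous_on {0..T} Y" "continuous_on {0..T} Y'"
    and "\<And>t. t \<in> {0..T} \<Longrightarrow> Y t = y0 + integral {0..1} (\<lambda>\<tau>. G \<tau> t (Y (\<tau> * t)))"
    and "\<And>t. t \<in> {0..T} \<Longrightarrow> Y' t = y0 + integral {0..1} (\<lambda>\<tau>. G \<tau> t (Y' (\<tau> * t)))"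
    and t: "t \<in> {0..T}"
  shows "Y t = Y' t"
proof -
  define L where "L = 4 * k + 1"
  define d where "d s = norm (Y s - Y' s) * exp (- L * \<bar>s\<bar>)" for s
  have L: "L > 0" "4 * k \<le> L" using k by (auto simp: L_def)
  have "continuous_on {0..T} d"
    unfolding d_def [abs_def] by (intro continuous_intros assms)
  then obtain s where s: "s \<in> {0..T}" "\<And>r. r \<in> {0..T} \<Longrightarrow> d r \<le> d s"
    using continuous_attains_sup[of "{0..T}" d] assms(1) by (metis atLeastatMost_empty_iff2 compact_Icc not_less)
  have "norm (Y s - Y' s) = norm (integral {0..1} (\<lambda>\<tau>. G \<tau> s (Y (\<tau> * s))) - integral {0..1} (\<lambda>\<tau>. G \<tau> s (Y' (\<tau> * s))))"
    using assms(5,6)[OF s(1)] by (metis add_diff_cancel_left)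
  also have "\<dots> \<le> d s * exp (L * \<bar>s\<bar>) / 2"
  proof (rule integral_diff_le[OF s(1) _ _ _ assms(3,4) L])
    fix r assume "r \<in> {0..T}"
    from s(2)[OF this] show "norm (Y r - Y' r) \<le> d s * exp (L * \<bar>r\<bar>)"
      unfolding d_def by (simp add: exp_minus field_simps)
  qed (use assms(1,2) lh in \<open>auto simp: d_def\<close>)
  also have "\<dots> = norm (Y s - Y' s) / 2"
    by (simp add: d_def exp_minus)
  finally have "d s = 0" by (simp add: d_def)
  with s(2)[OF t] have "d t \<le> 0" by simp
  then show ?thesis by (simp add: d_def mult_le_0_iff)
qed

text \<open>The fixed point is sought among bounded continuous functions of time and parameter
  together, so joint continuity in the parameter needs no separate argument.\<close>

lemma existence:
  fixes y0 :: "real \<Rightarrow> 'b"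
  assumes y0: "continuous_on UNIV y0" "bounded (range y0)"
  obtains Y :: "real \<times> real \<Rightarrow> 'b" where
    "continuous_on ({l..h} \<times> UNIV) Y"
    "\<And>t p. t \<in> {l..h} \<Longrightarrow> Y (t, p) = y0 p + integral {0..1} (\<lambda>\<tau>. G \<tau> t (Y (\<tau> * t, p)))"
proof -
  define L where "L = 4 * k + 1"
  have L: "L > 0" "4 * k \<le> L" using k by (auto simp: L_def)
  \<comment> \<open>Time is clamped into the interval, so that the operator acts on functions
    defined on the whole plane.\<close>
  define c where "c t = max l (min h t)" for t
  have c: "c t \<in> {l..h}" "continuous_on A c" for t A
    using lh by (auto simp: c_def [abs_def] intro!: continuous_intros)
  have cid: "t \<in> {l..h} \<Longrightarrow> c t = t" for t by (auto simp: c_def)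
  \<comment> \<open>The unknown Z is the solution divided by exp (L |t|); the supremum norm of Z is
    thus the weighted norm in which the operator contracts.\<close>
  define W where "W Z t p = exp (L * \<bar>t\<bar>) *\<^sub>R apply_bcontfun Z (t, p)" for Z :: "(real \<times> real) \<Rightarrow>\<^sub>C 'b" and t p
  have cW: "continuous_on S (\<lambda>x. W Z (f x) (g x))" if "continuous_on S f" "continuous_on S g" for S f g and Z and x :: "'x::topological_space"
    unfolding W_def using that
    by (intro continuous_intros continuous_on_compose2[OF continuous_on_apply_bcontfun[of UNIV Z]]) auto
  define F where "F Z x = exp (- L * \<bar>c (fst x)\<bar>) *\<^sub>R (y0 (snd x) +
      integral {0..1} (\<lambda>\<tau>. G \<tau> (c (fst x)) (W Z (\<tau> * c (fst x)) (snd x))))" for Z x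
  have contF: "continuous_on UNIV (F Z)" for Z
  proof -
    have "continuous_on (UNIV \<times> cbox 0 1) (\<lambda>z. (\<lambda>(\<tau>, t, y). G \<tau> t y)
        (snd z, c (fst (fst z)), W Z (snd z * c (fst (fst z))) (snd (fst z))))"
      by (intro continuous_on_compose2[OF cont] continuous_intros continuous_on_compose2[OF c(2)[of UNIV]] cW)
         (use c(1) in auto)
    then have "continuous_on UNIV (\<lambda>x. integral (cbox 0 1) (\<lambda>\<tau>. G \<tau> (c (fst x)) (W Z (\<tau> * c (fst x)) (snd x))))"
      by (intro integral_continuous_on_param) (simp add: split_beta)
    then show ?thesis
      unfolding F_def [abs_def]
      by (intro continuous_intros continuous_on_compose2[OF c(2)[of UNIV]] continuous_on_compose2[OF y0(1)]) auto
  qed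
  have cont1: "continuous_on {l..h} (\<lambda>s. W Z s p)" for Z p
    by (intro cW continuous_intros)
  have diffF: "norm (F Z x - F Z' x) \<le> dist Z Z' / 2" for Z Z' x
  proof -
    let ?t = "c (fst x)"
    have "norm (integral {0..1} (\<lambda>\<tau>. G \<tau> ?t (W Z (\<tau> * ?t) (snd x))) - integral {0..1} (\<lambda>\<tau>. G \<tau> ?t (W Z' (\<tau> * ?t) (snd x))))
      \<le> dist Z Z' * exp (L * \<bar>?t\<bar>) / 2"
    proof (rule integral_diff_le[OF c(1) _ _ _ cont1 cont1 L])
      fix s
      have "W Z s (snd x) - W Z' s (snd x) = exp (L * \<bar>s\<bar>) *\<^sub>R (Z (s, snd x) - Z' (s, snd x))"
        by (simp add: W_def algebra_simps)
      then show "norm (W Z s (snd x) - W Z' s (snd x)) \<le> dist Z Z' * exp (L * \<bar>s\<bar>)"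
        using dist_bounded[of Z "(s, snd x)" Z'] by (simp add: dist_norm mult.commute)
    qed (use lh in auto)
    moreover have "F Z x - F Z' x = exp (- L * \<bar>?t\<bar>) *\<^sub>R (integral {0..1} (\<lambda>\<tau>. G \<tau> ?t (W Z (\<tau> * ?t) (snd x))) - integral {0..1} (\<lambda>\<tau>. G \<tau> ?t (W Z' (\<tau> * ?t) (snd x))))"
      by (simp add: F_def algebra_simps)
    ultimately have "norm (F Z x - F Z' x) \<le> exp (- L * \<bar>?t\<bar>) * (dist Z Z' * exp (L * \<bar>?t\<bar>) / 2)"
      by simp
    also have "\<dots> = dist Z Z' / 2" by (simp add: exp_minus)
    finally show ?thesis .
  qed
  have boundF: "\<exists>b. \<forall>x. norm (F Z x) \<le> b" for Z
  proof -
    obtain B where B: "\<And>p. norm (y0 p) \<le> B" using y0(2) by (auto simp: bounded_iff)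
    have "norm (F 0 x) \<le> B + N" for x
    proof -
      have W0: "W 0 s p = 0" for s p by (simp add: W_def)
      have "norm (integral {0..1} (\<lambda>\<tau>. G \<tau> (c (fst x)) 0)) \<le> integral {0..1} (\<lambda>\<tau>::real. N)"
      proof (rule integral_norm_bound_integral)
        show "(\<lambda>\<tau>. G \<tau> (c (fst x)) 0) integrable_on {0..1}"
          using integrand_integrable[OF c(1) subset_refl, of "\<lambda>_. 0" "fst x"] lh by simp
      qed (use bound c(1) in auto)
      then have "norm (y0 (snd x) + integral {0..1} (\<lambda>\<tau>. G \<tau> (c (fst x)) 0)) \<le> B + N"
        by (intro order_trans[OF norm_triangle_ineq] add_mono B) simp
      moreover have "exp (- L * \<bar>c (fst x)\<bar>) \<le> 1" using L by simp
      ultimately have "exp (- L * \<bar>c (fst x)\<bar>) * norm (y0 (snd x) + integral {0..1} (\<lambda>\<tau>. G \<tau> (c (fst x)) 0)) \<le> 1 * (B + N)"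
        by (intro mult_mono) auto
      then show ?thesis by (simp add: F_def W0)
    qed
    then have "norm (F Z x) \<le> B + N + dist Z 0 / 2" for x
      using diffF[of Z x 0] norm_triangle_ineq2[of "F Z x" "F 0 x"] by (smt (verit))
    then show ?thesis by blast
  qed
  define FF where "FF Z = Bcontfun (F Z)" for Z
  have FF: "apply_bcontfun (FF Z) = F Z" for Z
  proof -
    obtain b where "\<And>x. norm (F Z x) \<le> b" using boundF by blast
    then have "F Z \<in> bcontfun" by (rule bcontfun_normI[OF contF])
    then show ?thesis unfolding FF_def by (rule Bcontfun_inverse)
  qed
  have "\<exists>!Z\<in>UNIV. FF Z = Z"
  proof (rule Banach_fix)
    show "dist (FF Z) (FF Z') \<le> 1/2 * dist Z Z'" for Z Z'
    proof (rule dist_bound)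
      show "dist (FF Z x) (FF Z' x) \<le> 1/2 * dist Z Z'" for x
        using diffF[of Z x Z'] by (simp add: FF dist_norm[of "F Z x"])
    qed
  qed (auto simp: complete_UNIV)
  then obtain Z where Z: "FF Z = Z" by auto
  define Y where "Y x = W Z (fst x) (snd x)" for x
  show thesis
  proof
    show "continuous_on ({l..h} \<times> UNIV) Y"
      unfolding Y_def by (intro cW continuous_intros)
    fix t p assume t: "t \<in> {l..h}"
    have "Z (t, p) = F Z (t, p)" using FF[of Z] Z by simp
    then show "Y (t, p) = y0 p + integral {0..1} (\<lambda>\<tau>. G \<tau> t (Y (\<tau> * t, p)))"
      by (simp add: Y_def F_def W_def[of Z t p] cid[OF t] exp_minus)
  qed
qed

end

subsection \<open>The regularised equation at the pole\<close>

definition gfun :: "real \<Rightarrow> real \<Rightarrow> real \<Rightarrow> real" where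
  "gfun t P v = P + (2 - t) * v"

definition Den :: "real \<Rightarrow> real \<Rightarrow> real \<Rightarrow> real \<Rightarrow> real" where
  "Den \<beta> t P v = 2 + (1 + 2 * \<beta>) * (gfun t P v)\<^sup>2 + P\<^sup>2"

text \<open>Along a solution this is the derivative with respect to z of log ((2 + g^2 + P^2) powr
  \<beta>), solved for the g' that it contains; that turns the denominator into \<open>Den\<close>.
  Its numerator z (g^2 + P^2) - 2 g P Q is divisible by 1 - z^2, because g - P and Q - z are, and
  the quotient is what is written here.\<close>

definition Bfun :: "real \<Rightarrow> real \<Rightarrow> real \<Rightarrow> real \<Rightarrow> real \<Rightarrow> real \<Rightarrow> real" where
  "Bfun \<beta> t q P v x = 2 * \<beta> * ((2 - t) * ((1 - t) * x - v * P * q) - P * q * (gfun t P v + P)) / Den \<beta> t P v"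

text \<open>The right-hand side of t w' + 2 w = Phi, which is the equation for g after the
  substitution. The arguments v and x stand for t w and t w^2; w enters in no other way.\<close>

definition Phi :: "real \<Rightarrow> real \<Rightarrow> real \<Rightarrow> real \<Rightarrow> real \<Rightarrow> real \<Rightarrow> real" where
  "Phi \<beta> t q P v x = (2 / (2 - t) - q) * v + Bfun \<beta> t q P v x * gfun t P v / (2 - t)"

text \<open>The derivative of q in t. A direct computation leaves (1 - P^2 - 2 (1 - t) q) / (t (2 -
  t)), which the constraint turns into q^2; the singularity at the pole is removed in this
  way.\<close>

definition F_q :: "real \<Rightarrow> real \<Rightarrow> real \<Rightarrow> real \<Rightarrow> real" where
  "F_q t q P w = q\<^sup>2 - P * w"

definition F_P :: "real \<Rightarrow> real \<Rightarrow> real \<Rightarrow> real \<Rightarrow> real" where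
  "F_P t q P w = P * q + (1 - t + t * (2 - t) * q) * w"

lemma Den_ge: "\<beta> \<ge> 0 \<Longrightarrow> Den \<beta> t P v \<ge> 2"
  by (simp add: Den_def)

lemma Den_pos: "\<beta> \<ge> 0 \<Longrightarrow> Den \<beta> t P v > 0"
  using Den_ge[of \<beta> t P v] by simp

section \<open>Truncation and a Lipschitz calculus with weights\<close>

definition clamp_to :: "real \<Rightarrow> real \<Rightarrow> real" where
  "clamp_to R x = max (- R) (min R x)"

lemma clamp_to_le: "R \<ge> 0 \<Longrightarrow> \<bar>clamp_to R x\<bar> \<le> R"
  by (auto simp: clamp_to_def)

lemma clamp_to_lip: "\<bar>clamp_to R x - clamp_to R y\<bar> \<le> \<bar>x - y\<bar>"
  by (auto simp: clamp_to_def max_def min_def)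

lemma clamp_to_id: "\<bar>x\<bar> \<le> R \<Longrightarrow> clamp_to R x = x"
  by (auto simp: clamp_to_def)

lemma continuous_clamp_to [continuous_intros]: "continuous_on S f \<Longrightarrow> continuous_on S (\<lambda>x. clamp_to R (f x))"
  unfolding clamp_to_def by (intro continuous_intros)

text \<open>Bounded functions of \<open>(t, (q, P, w))\<close> that are Lipschitz in the state, where \<open>\<omega> t\<close> is the
  weight of \<open>w\<close>: the choice \<open>\<omega> t = \<bar>t\<bar>\<close> records that the singular equation depends on \<open>w\<close> only
  through \<open>t w\<close> and \<open>t w\<^sup>2\<close>.\<close>

definition lipb :: "real set \<Rightarrow> (real \<Rightarrow> real) \<Rightarrow> (real \<Rightarrow> real \<times> real \<times> real \<Rightarrow> real) \<Rightarrow> bool" where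
  "lipb J \<omega> f \<longleftrightarrow> (\<exists>C\<ge>0. (\<forall>t\<in>J. \<forall>y. \<bar>f t y\<bar> \<le> C) \<and>
    (\<forall>t\<in>J. \<forall>q P w q' P' w'. \<bar>f t (q, P, w) - f t (q', P', w')\<bar> \<le> C * (\<bar>q - q'\<bar> + \<bar>P - P'\<bar> + \<omega> t * \<bar>w - w'\<bar>)))"

lemma lipb_time:
  assumes "\<And>t. t \<in> J \<Longrightarrow> \<bar>c t\<bar> \<le> B" "\<And>t. t \<in> J \<Longrightarrow> \<omega> t \<ge> 0"
  shows "lipb J \<omega> (\<lambda>t y. c t)"
  unfolding lipb_def
proof (intro exI[of _ "max 0 B"] conjI ballI allI)
  fix t q P w q' P' w' assume "t \<in> J"
  then have "0 \<le> \<bar>q - q'\<bar> + \<bar>P - P'\<bar> + \<omega> t * \<bar>w - w'\<bar>"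
    using assms(2) by simp
  then show "\<bar>c t - c t\<bar> \<le> max 0 B * (\<bar>q - q'\<bar> + \<bar>P - P'\<bar> + \<omega> t * \<bar>w - w'\<bar>)"
    by simp
qed (use assms(1) in \<open>simp_all add: le_max_iff_disj\<close>)

lemma lipb_add:
  assumes "lipb J \<omega> f" "lipb J \<omega> h"
  shows "lipb J \<omega> (\<lambda>t y. f t y + h t y)"
proof -
  obtain C where C: "C \<ge> 0" "\<And>t y. t \<in> J \<Longrightarrow> \<bar>f t y\<bar> \<le> C"
    "\<And>t q P w q' P' w'. t \<in> J \<Longrightarrow> \<bar>f t (q, P, w) - f t (q', P', w')\<bar> \<le> C * (\<bar>q - q'\<bar> + \<bar>P - P'\<bar> + \<omega> t * \<bar>w - w'\<bar>)"
    using assms(1) unfolding lipb_def by blast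
  obtain D where D: "D \<ge> 0" "\<And>t y. t \<in> J \<Longrightarrow> \<bar>h t y\<bar> \<le> D"
    "\<And>t q P w q' P' w'. t \<in> J \<Longrightarrow> \<bar>h t (q, P, w) - h t (q', P', w')\<bar> \<le> D * (\<bar>q - q'\<bar> + \<bar>P - P'\<bar> + \<omega> t * \<bar>w - w'\<bar>)"
    using assms(2) unfolding lipb_def by blast
  show ?thesis unfolding lipb_def
  proof (intro exI[of _ "C + D"] conjI ballI allI)
    fix t y assume t: "t \<in> J"
    show "\<bar>f t y + h t y\<bar> \<le> C + D" using C(2)[OF t, of y] D(2)[OF t, of y] by linarith
  next
    fix t q P w q' P' w' assume t: "t \<in> J"
    show "\<bar>f t (q, P, w) + h t (q, P, w) - (f t (q', P', w') + h t (q', P', w'))\<bar>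
      \<le> (C + D) * (\<bar>q - q'\<bar> + \<bar>P - P'\<bar> + \<omega> t * \<bar>w - w'\<bar>)"
      using C(3)[OF t, of q P w q' P' w'] D(3)[OF t, of q P w q' P' w'] unfolding distrib_right by linarith
  qed (use C(1) D(1) in simp)
qed

lemma lipb_mult:
  assumes "lipb J \<omega> f" "lipb J \<omega> h"
  shows "lipb J \<omega> (\<lambda>t y. f t y * h t y)"
proof -
  obtain C where C: "C \<ge> 0" "\<And>t y. t \<in> J \<Longrightarrow> \<bar>f t y\<bar> \<le> C"
    "\<And>t q P w q' P' w'. t \<in> J \<Longrightarrow> \<bar>f t (q, P, w) - f t (q', P', w')\<bar> \<le> C * (\<bar>q - q'\<bar> + \<bar>P - P'\<bar> + \<omega> t * \<bar>w - w'\<bar>)"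
    using assms(1) unfolding lipb_def by blast
  obtain D where D: "D \<ge> 0" "\<And>t y. t \<in> J \<Longrightarrow> \<bar>h t y\<bar> \<le> D"
    "\<And>t q P w q' P' w'. t \<in> J \<Longrightarrow> \<bar>h t (q, P, w) - h t (q', P', w')\<bar> \<le> D * (\<bar>q - q'\<bar> + \<bar>P - P'\<bar> + \<omega> t * \<bar>w - w'\<bar>)"
    using assms(2) unfolding lipb_def by blast
  show ?thesis unfolding lipb_def
  proof (intro exI[of _ "C * D + C * D"] conjI ballI allI)
    fix t y assume t: "t \<in> J"
    have "\<bar>f t y\<bar> * \<bar>h t y\<bar> \<le> C * D"
      using C(1) C(2)[OF t, of y] D(2)[OF t, of y] by (intro mult_mono) auto
    then show "\<bar>f t y * h t y\<bar> \<le> C * D + C * D" using mult_nonneg_nonneg[OF C(1) D(1)] by (simp add: abs_mult)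
  next
    fix t q P w q' P' w' assume t: "t \<in> J"
    let ?d = "\<bar>q - q'\<bar> + \<bar>P - P'\<bar> + \<omega> t * \<bar>w - w'\<bar>"
    let ?y = "(q, P, w)" and ?z = "(q', P', w')"
    have e: "f t ?y * h t ?y - f t ?z * h t ?z = f t ?y * (h t ?y - h t ?z) + (f t ?y - f t ?z) * h t ?z"
      by (simp add: algebra_simps)
    have "\<bar>f t ?y * h t ?y - f t ?z * h t ?z\<bar> \<le> \<bar>f t ?y\<bar> * \<bar>h t ?y - h t ?z\<bar> + \<bar>f t ?y - f t ?z\<bar> * \<bar>h t ?z\<bar>"
      unfolding e by (rule order_trans[OF abs_triangle_ineq]) (simp add: abs_mult)
    also have "\<dots> \<le> C * (D * ?d) + (C * ?d) * D"
    proof (rule add_mono)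
      show "\<bar>f t ?y\<bar> * \<bar>h t ?y - h t ?z\<bar> \<le> C * (D * ?d)"
        by (rule mult_mono[OF C(2)[OF t] D(3)[OF t] C(1) abs_ge_zero])
      show "\<bar>f t ?y - f t ?z\<bar> * \<bar>h t ?z\<bar> \<le> (C * ?d) * D"
        by (rule mult_mono[OF C(3)[OF t] D(2)[OF t] order_trans[OF abs_ge_zero C(3)[OF t]] abs_ge_zero])
    qed
    also have "\<dots> = (C * D + C * D) * ?d" by (simp add: algebra_simps)
    finally show "\<bar>f t ?y * h t ?y - f t ?z * h t ?z\<bar> \<le> (C * D + C * D) * ?d" .
  qed (use C(1) D(1) in simp)
qed

lemma lipb_inverse:
  assumes "lipb J \<omega> f" "\<And>t y. t \<in> J \<Longrightarrow> f t y \<ge> 1" "\<And>t. t \<in> J \<Longrightarrow> \<omega> t \<ge> 0"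
  shows "lipb J \<omega> (\<lambda>t y. inverse (f t y))"
proof -
  obtain C where C: "C \<ge> 0" "\<And>t y. t \<in> J \<Longrightarrow> \<bar>f t y\<bar> \<le> C"
    "\<And>t q P w q' P' w'. t \<in> J \<Longrightarrow> \<bar>f t (q, P, w) - f t (q', P', w')\<bar> \<le> C * (\<bar>q - q'\<bar> + \<bar>P - P'\<bar> + \<omega> t * \<bar>w - w'\<bar>)"
    using assms(1) unfolding lipb_def by blast
  show ?thesis unfolding lipb_def
  proof (intro exI[of _ "max 1 C"] conjI ballI allI)
    fix t y assume t: "t \<in> J"
    show "\<bar>inverse (f t y)\<bar> \<le> max 1 C" using assms(2)[OF t, of y] by (simp add: le_max_iff_disj inverse_le_1_iff)
  next
    fix t q P w q' P' w' assume t: "t \<in> J"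
    let ?d = "\<bar>q - q'\<bar> + \<bar>P - P'\<bar> + \<omega> t * \<bar>w - w'\<bar>"
    let ?a = "f t (q, P, w)" and ?b = "f t (q', P', w')"
    have ab: "?a \<ge> 1" "?b \<ge> 1" using assms(2)[OF t] by auto
    then have "1 * 1 \<le> ?a * ?b" by (intro mult_mono) auto
    then have ab1: "1 \<le> ?a * ?b" by simp
    have "\<bar>inverse ?a - inverse ?b\<bar> = \<bar>?a - ?b\<bar> / (?a * ?b)"
    proof -
      have "inverse ?a - inverse ?b = (?b - ?a) / (?a * ?b)" using ab by (simp add: field_simps)
      then show ?thesis using ab by (simp add: abs_mult)
    qed
    also have "\<dots> \<le> \<bar>?a - ?b\<bar>"
      using mult_left_mono[OF ab1, of "\<bar>?a - ?b\<bar>"] ab1 by (subst pos_divide_le_eq) auto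
    also have "\<dots> \<le> C * ?d" by (rule C(3)[OF t])
    also have "\<dots> \<le> max 1 C * ?d"
      using assms(3)[OF t] by (intro mult_right_mono) auto
    finally show "\<bar>inverse ?a - inverse ?b\<bar> \<le> max 1 C * ?d" .
  qed auto
qed

lemma lipb_cont:
  assumes "compact J" "continuous_on J c" "\<And>t. t \<in> J \<Longrightarrow> \<omega> t \<ge> 0"
  shows "lipb J \<omega> (\<lambda>t y. c t)"
proof -
  have "bounded (c ` J)" using assms by (intro compact_imp_bounded compact_continuous_image)
  then obtain B where "\<And>t. t \<in> J \<Longrightarrow> \<bar>c t\<bar> \<le> B" by (auto simp: bounded_iff)
  then show ?thesis using assms(3) by (rule lipb_time)
qed

lemma lipb_diff:
  assumes "lipb J \<omega> f" "lipb J \<omega> h" "\<And>t. t \<in> J \<Longrightarrow> \<omega> t \<ge> 0"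
  shows "lipb J \<omega> (\<lambda>t y. f t y - h t y)"
proof -
  have "lipb J \<omega> (\<lambda>t y. f t y + (-1) * h t y)"
    by (intro lipb_add lipb_mult assms(1,2) lipb_time[of J _ 1]) (use assms(3) in auto)
  then show ?thesis by simp
qed

lemma lipb_clamp_state:
  assumes "R \<ge> 0" "\<And>t. t \<in> J \<Longrightarrow> \<omega> t \<ge> 0"
  shows "lipb J \<omega> (\<lambda>t y. clamp_to R (fst y))" "lipb J \<omega> (\<lambda>t y. clamp_to R (fst (snd y)))"
proof -
  have 1: "\<bar>clamp_to R x - clamp_to R x'\<bar> \<le> (R + 1) * (a + \<bar>x - x'\<bar> + b)" if "a \<ge> 0" "b \<ge> 0" for a b x x' :: real
  proof -
    have "1 * \<bar>x - x'\<bar> \<le> (R + 1) * (a + \<bar>x - x'\<bar> + b)"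
      using that assms(1) by (intro mult_mono) auto
    then show ?thesis using order_trans[OF clamp_to_lip[of R x x']] by simp
  qed
  have 2: "\<bar>clamp_to R x\<bar> \<le> R + 1" for x using clamp_to_le[OF assms(1), of x] by simp
  show "lipb J \<omega> (\<lambda>t y. clamp_to R (fst (snd y)))"
    unfolding lipb_def by (rule exI[of _ "R + 1"]) (use 1 2 assms in auto)
  show "lipb J \<omega> (\<lambda>t y. clamp_to R (fst y))"
    unfolding lipb_def
    by (rule exI[of _ "R + 1"]) (use 1[of 0] 2 assms in \<open>auto simp: add.assoc\<close>)
qed

lemma lipb_weighted:
  assumes "C \<ge> 0" "\<And>t w. t \<in> J \<Longrightarrow> \<bar>f t w\<bar> \<le> C" "\<And>t. t \<in> J \<Longrightarrow> \<omega> t \<ge> 0"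
    "\<And>t w w'. t \<in> J \<Longrightarrow> \<bar>f t w - f t w'\<bar> \<le> C * (\<omega> t * \<bar>w - w'\<bar>)"
  shows "lipb J \<omega> (\<lambda>t y. f t (snd (snd y)))"
  unfolding lipb_def
proof (intro exI[of _ C] conjI ballI allI)
  fix t q P w q' P' w' assume t: "t \<in> J"
  have "C * (\<omega> t * \<bar>w - w'\<bar>) \<le> C * (\<bar>q - q'\<bar> + \<bar>P - P'\<bar> + \<omega> t * \<bar>w - w'\<bar>)"
    using assms(1) by (intro mult_left_mono) auto
  with assms(4)[OF t, of w w']
  show "\<bar>f t (snd (snd (q, P, w))) - f t (snd (snd (q', P', w')))\<bar> \<le> C * (\<bar>q - q'\<bar> + \<bar>P - P'\<bar> + \<omega> t * \<bar>w - w'\<bar>)"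
    by simp
qed (use assms in auto)

lemma lipb_clamp_w:
  assumes "R \<ge> 0"
  shows "lipb {-1..3/2} (\<lambda>t. 1) (\<lambda>t y. clamp_to R (snd (snd y)))"
    and "lipb {-1..3/2} (\<lambda>t. \<bar>t\<bar>) (\<lambda>t y. t * clamp_to R (snd (snd y)))"
    and "lipb {-1..3/2} (\<lambda>t. \<bar>t\<bar>) (\<lambda>t y. t * (clamp_to R (snd (snd y)))\<^sup>2)"
proof -
  let ?c = "clamp_to R"
  have b: "\<bar>?c w\<bar> \<le> R" for w by (rule clamp_to_le[OF assms])
  have t2: "\<bar>t\<bar> \<le> 2" if "t \<in> {-1..3/2}" for t :: real using that by auto
  show "lipb {-1..3/2} (\<lambda>t. 1) (\<lambda>t y. ?c (snd (snd y)))"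
  proof (rule lipb_weighted[of "R + 1" _ "\<lambda>t. ?c"])
    fix t w w' :: real
    have "1 * \<bar>w - w'\<bar> \<le> (R + 1) * \<bar>w - w'\<bar>" using assms by (intro mult_right_mono) auto
    then show "\<bar>?c w - ?c w'\<bar> \<le> (R + 1) * (1 * \<bar>w - w'\<bar>)"
      using clamp_to_lip[of R w w'] by simp
    show "\<bar>?c w\<bar> \<le> R + 1" using b[of w] by simp
  qed (use assms in auto)
  show "lipb {-1..3/2} (\<lambda>t. \<bar>t\<bar>) (\<lambda>t y. t * ?c (snd (snd y)))"
  proof (rule lipb_weighted[of "2 * R + 1" _ "\<lambda>t w. t * ?c w"])
    fix t w w' :: real assume t: "t \<in> {-1..3/2}"
    have "\<bar>t\<bar> * \<bar>?c w\<bar> \<le> 2 * R" using b[of w] t2[OF t] by (intro mult_mono) auto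
    then show "\<bar>t * ?c w\<bar> \<le> 2 * R + 1" by (simp add: abs_mult)
    have "\<bar>t * ?c w - t * ?c w'\<bar> = \<bar>t\<bar> * \<bar>?c w - ?c w'\<bar>" by (simp flip: abs_mult right_diff_distrib)
    also have "\<dots> \<le> \<bar>t\<bar> * \<bar>w - w'\<bar>" by (intro mult_left_mono clamp_to_lip) auto
    also have "\<dots> \<le> (2 * R + 1) * (\<bar>t\<bar> * \<bar>w - w'\<bar>)"
      using assms mult_right_mono[of 1 "2 * R + 1" "\<bar>t\<bar> * \<bar>w - w'\<bar>"] by simp
    finally show "\<bar>t * ?c w - t * ?c w'\<bar> \<le> (2 * R + 1) * (\<bar>t\<bar> * \<bar>w - w'\<bar>)" .
  qed (use assms in auto)
  show "lipb {-1..3/2} (\<lambda>t. \<bar>t\<bar>) (\<lambda>t y. t * (?c (snd (snd y)))\<^sup>2)"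
  proof (rule lipb_weighted[of "2 * R\<^sup>2 + 2 * R" _ "\<lambda>t w. t * (?c w)\<^sup>2"])
    fix t w w' :: real assume t: "t \<in> {-1..3/2}"
    have "(?c w)\<^sup>2 \<le> R\<^sup>2" using power_mono[OF b[of w], of 2] by simp
    then have "\<bar>t\<bar> * (?c w)\<^sup>2 \<le> 2 * R\<^sup>2" using t2[OF t] by (intro mult_mono) auto
    then show "\<bar>t * (?c w)\<^sup>2\<bar> \<le> 2 * R\<^sup>2 + 2 * R" using assms by (simp add: abs_mult)
    have "\<bar>t * (?c w)\<^sup>2 - t * (?c w')\<^sup>2\<bar> = \<bar>t\<bar> * (\<bar>?c w + ?c w'\<bar> * \<bar>?c w - ?c w'\<bar>)"
      by (simp flip: abs_mult add: power2_eq_square algebra_simps)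
    also have "\<dots> \<le> \<bar>t\<bar> * ((2 * R) * \<bar>w - w'\<bar>)"
      using b[of w] b[of w'] by (intro mult_left_mono mult_mono clamp_to_lip) auto
    also have "\<dots> \<le> (2 * R\<^sup>2 + 2 * R) * (\<bar>t\<bar> * \<bar>w - w'\<bar>)"
      using mult_right_mono[of "2 * R" "2 * R\<^sup>2 + 2 * R" "\<bar>t\<bar> * \<bar>w - w'\<bar>"] by (simp add: mult_ac)
    finally show "\<bar>t * (?c w)\<^sup>2 - t * (?c w')\<^sup>2\<bar> \<le> (2 * R\<^sup>2 + 2 * R) * (\<bar>t\<bar> * \<bar>w - w'\<bar>)" .
  qed (use assms in auto)
qed

lemma Bfun_inverse: "Bfun \<beta> t q P v x =
    2 * \<beta> * ((2 - t) * ((1 - t) * x - v * P * q) - P * q * (gfun t P v + P)) * inverse (Den \<beta> t P v)"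
  by (simp add: Bfun_def divide_inverse)

lemma Phi_inverse: "Phi \<beta> t q P v x =
    (2 * inverse (2 - t) - q) * v + Bfun \<beta> t q P v x * gfun t P v * inverse (2 - t)"
  by (simp add: Phi_def divide_inverse)

lemma continuous_on_Phi:
  assumes "\<beta> \<ge> 0" "continuous_on S t" "continuous_on S q" "continuous_on S P" "continuous_on S v" "continuous_on S x"
    "\<And>s. s \<in> S \<Longrightarrow> t s \<noteq> 2"
  shows "continuous_on S (\<lambda>s. Phi \<beta> (t s) (q s) (P s) (v s) (x s))"
proof -
  have ne: "\<forall>s\<in>S. 2 - t s \<noteq> 0" using assms(7) by force
  have g: "continuous_on S (\<lambda>s. gfun (t s) (P s) (v s))"
    unfolding gfun_def by (intro continuous_intros assms)
  have D: "continuous_on S (\<lambda>s. Den \<beta> (t s) (P s) (v s))"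
    unfolding Den_def by (intro continuous_intros assms g)
  have ne2: "\<forall>s\<in>S. Den \<beta> (t s) (P s) (v s) \<noteq> 0"
    using Den_pos[OF assms(1)] by (metis less_irrefl)
  have B: "continuous_on S (\<lambda>s. Bfun \<beta> (t s) (q s) (P s) (v s) (x s))"
    unfolding Bfun_def by (intro continuous_intros assms g D ne2)
  show ?thesis unfolding Phi_def by (intro continuous_intros assms g B ne)
qed

text \<open>The interval [-1, 3/2] contains neighbourhoods of the pole t = 0 and of the equator t =
  1, and it keeps 2 - t away from zero. With the weight |t| on w, the singular right-hand side
  depends on w only to an extent that vanishes at the pole.\<close>

lemma lipb_fields:
  assumes "\<beta> \<ge> 0" "R \<ge> 0"
  shows "lipb {-1..3/2} (\<lambda>t. 1) (\<lambda>t y. F_q t (clamp_to R (fst y)) (clamp_to R (fst (snd y))) (clamp_to R (snd (snd y))))"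
    and "lipb {-1..3/2} (\<lambda>t. 1) (\<lambda>t y. F_P t (clamp_to R (fst y)) (clamp_to R (fst (snd y))) (clamp_to R (snd (snd y))))"
    and "lipb {-1..3/2} (\<lambda>t. \<bar>t\<bar>) (\<lambda>t y. Phi \<beta> t (clamp_to R (fst y)) (clamp_to R (fst (snd y)))
      (t * clamp_to R (snd (snd y))) (t * (clamp_to R (snd (snd y)))\<^sup>2))"
proof -
  note st = lipb_clamp_state[OF assms(2)] lipb_clamp_w[OF assms(2)]
  have cn: "lipb {-1..3/2} \<omega> (\<lambda>t y. c)" "lipb {-1..3/2} \<omega> (\<lambda>t y. t)" "lipb {-1..3/2} \<omega> (\<lambda>t y. inverse (2 - t))"
    if "\<And>t. t \<in> {-1..3/2} \<Longrightarrow> \<omega> t \<ge> 0" for c and \<omega> :: "real \<Rightarrow> real"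
    by (rule lipb_cont; use that in \<open>auto intro!: continuous_intros\<close>)+
  show "lipb {-1..3/2} (\<lambda>t. 1) (\<lambda>t y. F_q t (clamp_to R (fst y)) (clamp_to R (fst (snd y))) (clamp_to R (snd (snd y))))"
    unfolding F_q_def power2_eq_square by (intro lipb_diff lipb_mult st) simp_all
  show "lipb {-1..3/2} (\<lambda>t. 1) (\<lambda>t y. F_P t (clamp_to R (fst y)) (clamp_to R (fst (snd y))) (clamp_to R (snd (snd y))))"
    unfolding F_P_def by (intro lipb_add lipb_diff lipb_mult st cn) simp_all
  have g: "lipb {-1..3/2} (\<lambda>t. \<bar>t\<bar>) (\<lambda>t y. gfun t (clamp_to R (fst (snd y))) (t * clamp_to R (snd (snd y))))"
    unfolding gfun_def by (intro lipb_add st lipb_mult[OF lipb_diff[OF cn(1,2)] st(4)]) simp_all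
  have D: "lipb {-1..3/2} (\<lambda>t. \<bar>t\<bar>) (\<lambda>t y. Den \<beta> t (clamp_to R (fst (snd y))) (t * clamp_to R (snd (snd y))))"
    unfolding Den_def power2_eq_square
    by (intro lipb_add lipb_mult[OF cn(1)] lipb_mult[OF g g] lipb_mult[OF st(2) st(2)] cn) simp_all
  have B: "lipb {-1..3/2} (\<lambda>t. \<bar>t\<bar>) (\<lambda>t y. Bfun \<beta> t (clamp_to R (fst y)) (clamp_to R (fst (snd y)))
      (t * clamp_to R (snd (snd y))) (t * (clamp_to R (snd (snd y)))\<^sup>2))"
    unfolding Bfun_inverse
  proof (rule lipb_mult[OF lipb_mult[OF cn(1)] lipb_inverse[OF D]])
    show "lipb {-1..3/2} (\<lambda>t. \<bar>t\<bar>) (\<lambda>t y. (2 - t) * ((1 - t) * (t * (clamp_to R (snd (snd y)))\<^sup>2)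
        - t * clamp_to R (snd (snd y)) * clamp_to R (fst (snd y)) * clamp_to R (fst y))
      - clamp_to R (fst (snd y)) * clamp_to R (fst y) * (gfun t (clamp_to R (fst (snd y))) (t * clamp_to R (snd (snd y))) + clamp_to R (fst (snd y))))"
      by (intro lipb_diff[OF lipb_mult[OF lipb_diff[OF cn(1,2)] lipb_diff[OF lipb_mult[OF lipb_diff[OF cn(1,2)] st(5)] lipb_mult[OF lipb_mult[OF st(4) st(2)] st(1)]]]]
        lipb_mult[OF lipb_mult[OF st(2) st(1)] lipb_add[OF g st(2)]]) simp_all
  qed (use Den_ge[OF assms(1)] in \<open>auto intro: order_trans[of 1 2]\<close>)
  show "lipb {-1..3/2} (\<lambda>t. \<bar>t\<bar>) (\<lambda>t y. Phi \<beta> t (clamp_to R (fst y)) (clamp_to R (fst (snd y)))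
      (t * clamp_to R (snd (snd y))) (t * (clamp_to R (snd (snd y)))\<^sup>2))"
    unfolding Phi_inverse
    by (intro lipb_add[OF lipb_mult[OF lipb_diff[OF lipb_mult[OF cn(1,3)] st(1)] st(4)] lipb_mult[OF lipb_mult[OF B g] cn(3)]]) simp_all
qed

section \<open>The truncated system as a fixed point problem\<close>

definition pole_G :: "real \<Rightarrow> real \<Rightarrow> real \<Rightarrow> real \<Rightarrow> real \<Rightarrow> real \<times> real \<times> real \<Rightarrow> real \<times> real \<times> real" where
  "pole_G \<beta> R M \<tau> t y = (let q = clamp_to R (fst y); P = clamp_to R (fst (snd y)); w = clamp_to R (M * snd (snd y)) in
     (t * F_q (\<tau> * t) q P w, t * F_P (\<tau> * t) q P w,
      \<tau> * Phi \<beta> (\<tau> * t) q P (\<tau> * t * w) (\<tau> * t * w\<^sup>2) / M))"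

text \<open>The singular component is not contracted by a small time step; rescaling \<open>w\<close> by a large
  \<open>M\<close> makes its dependence on \<open>q\<close> and \<open>P\<close> small instead.\<close>

lemma pole_G_averaged:
  assumes "\<beta> \<ge> 0" "R \<ge> 0"
  obtains M k N where "M > 0" "averaged_equation (pole_G \<beta> R M) (-1) (3/2) k N"
proof -
  let ?J = "{-1..3/2::real}" and ?c = "clamp_to R"
  obtain C1 where C1: "C1 \<ge> 0" "\<And>t y. t \<in> ?J \<Longrightarrow> \<bar>F_q t (?c (fst y)) (?c (fst (snd y))) (?c (snd (snd y)))\<bar> \<le> C1"
    "\<And>t q P w q' P' w'. t \<in> ?J \<Longrightarrow> \<bar>F_q t (?c q) (?c P) (?c w) - F_q t (?c q') (?c P') (?c w')\<bar>
       \<le> C1 * (\<bar>q - q'\<bar> + \<bar>P - P'\<bar> + \<bar>w - w'\<bar>)"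
    using lipb_fields(1)[OF assms] by (auto simp: lipb_def)
  obtain C2 where C2: "C2 \<ge> 0" "\<And>t y. t \<in> ?J \<Longrightarrow> \<bar>F_P t (?c (fst y)) (?c (fst (snd y))) (?c (snd (snd y)))\<bar> \<le> C2"
    "\<And>t q P w q' P' w'. t \<in> ?J \<Longrightarrow> \<bar>F_P t (?c q) (?c P) (?c w) - F_P t (?c q') (?c P') (?c w')\<bar>
       \<le> C2 * (\<bar>q - q'\<bar> + \<bar>P - P'\<bar> + \<bar>w - w'\<bar>)"
    using lipb_fields(2)[OF assms] by (auto simp: lipb_def)
  obtain C3 where C3: "C3 \<ge> 0" "\<And>t y. t \<in> ?J \<Longrightarrow> \<bar>Phi \<beta> t (?c (fst y)) (?c (fst (snd y))) (t * ?c (snd (snd y))) (t * (?c (snd (snd y)))\<^sup>2)\<bar> \<le> C3"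
    "\<And>t q P w q' P' w'. t \<in> ?J \<Longrightarrow> \<bar>Phi \<beta> t (?c q) (?c P) (t * ?c w) (t * (?c w)\<^sup>2) - Phi \<beta> t (?c q') (?c P') (t * ?c w') (t * (?c w')\<^sup>2)\<bar>
       \<le> C3 * (\<bar>q - q'\<bar> + \<bar>P - P'\<bar> + \<bar>t\<bar> * \<bar>w - w'\<bar>)"
    using lipb_fields(3)[OF assms] by (auto simp: lipb_def)
  \<comment> \<open>The differences of q and P each enter the singular component with factor C3 / M
    \<le> 1/8, which uses up exactly the admissible 1/4. The difference of w comes with a factor |t|
    and goes into k.\<close>
  define M where "M = 8 * C3 + 1"
  have M: "M > 0" "C3 / M \<le> 1 / 8" using C3(1) by (auto simp: M_def field_simps)
  define k where "k = C1 * (2 + M) + C2 * (2 + M) + C3"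
  define N where "N = 2 * C1 + 2 * C2 + C3 / M"
  have Jsc: "\<tau> * t \<in> ?J" if "\<tau> \<in> {0..1}" "t \<in> ?J" for \<tau> t
    by (rule scaled_in_interval) (use that in auto)
  have n3: "norm (a, b, c) \<le> \<bar>a\<bar> + \<bar>b\<bar> + \<bar>c\<bar>" for a b c :: real
    using order_trans[OF norm_Pair_le[of a "(b, c)"] add_left_mono[OF norm_Pair_le[of b c]]]
    by (simp only: real_norm_def add.assoc)
  have nle: "\<bar>a\<bar> \<le> norm (a, b, c)" "\<bar>b\<bar> \<le> norm (a, b, c)" "\<bar>c\<bar> \<le> norm (a, b, c)" for a b c :: real
    using norm_fst_le[of a "(b, c)"] order_trans[OF norm_fst_le[of b c] norm_snd_le[of "(b, c)" a]]
      order_trans[OF norm_snd_le[of c b] norm_snd_le[of "(b, c)" a]]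
    by (simp_all only: real_norm_def)
  have "averaged_equation (pole_G \<beta> R M) (-1) (3/2) k N"
  proof
    show "k \<ge> 0" using C1(1) C2(1) C3(1) M by (simp add: k_def)
    have ne: "\<tau> * t \<noteq> 2" if "\<tau> \<in> {0..1}" "t \<in> ?J" for \<tau> t using Jsc[OF that] by auto
    have "M \<noteq> 0" using M by simp
    then show "continuous_on ({0..1} \<times> ?J \<times> UNIV) (\<lambda>(\<tau>, t, y). pole_G \<beta> R M \<tau> t y)"
      unfolding pole_G_def Let_def split_beta F_q_def F_P_def
      by (intro continuous_intros continuous_on_Phi assms) (use ne in auto)
  next
    fix \<tau> t :: real and y y' :: "real \<times> real \<times> real" assume \<tau>: "\<tau> \<in> {0..1}" and t: "t \<in> ?J"
    obtain q P w q' P' w' where y: "y = (q, P, w)" "y' = (q', P', w')" by (metis prod_cases3)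
    let ?n = "norm (y - y')"
    have n: "\<bar>q - q'\<bar> \<le> ?n" "\<bar>P - P'\<bar> \<le> ?n" "\<bar>w - w'\<bar> \<le> ?n" "?n \<ge> 0"
      unfolding y using nle(1)[of "q - q'" "P - P'" "w - w'"] nle(2)[of "P - P'" "q - q'" "w - w'"]
        nle(3)[of "w - w'" "q - q'" "P - P'"] by auto
    have Mw: "\<bar>M * w - M * w'\<bar> \<le> M * ?n"
      using n(3) M by (simp add: abs_mult flip: right_diff_distrib)
    have s2: "\<bar>q - q'\<bar> + \<bar>P - P'\<bar> + \<bar>M * w - M * w'\<bar> \<le> (2 + M) * ?n"
      using n Mw by (simp add: algebra_simps)
    have e1: "\<bar>F_q (\<tau> * t) (?c q) (?c P) (?c (M * w)) - F_q (\<tau> * t) (?c q') (?c P') (?c (M * w'))\<bar> \<le> C1 * ((2 + M) * ?n)"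
      by (rule order_trans[OF C1(3)[OF Jsc[OF \<tau> t]] mult_left_mono[OF s2 C1(1)]])
    have e2: "\<bar>F_P (\<tau> * t) (?c q) (?c P) (?c (M * w)) - F_P (\<tau> * t) (?c q') (?c P') (?c (M * w'))\<bar> \<le> C2 * ((2 + M) * ?n)"
      by (rule order_trans[OF C2(3)[OF Jsc[OF \<tau> t]] mult_left_mono[OF s2 C2(1)]])
    have t\<tau>: "\<bar>\<tau> * t\<bar> \<le> \<bar>t\<bar>" using \<tau> by (simp add: abs_mult mult_left_le_one_le)
    have s3: "\<bar>q - q'\<bar> + \<bar>P - P'\<bar> + \<bar>\<tau> * t\<bar> * \<bar>M * w - M * w'\<bar> \<le> 2 * ?n + \<bar>t\<bar> * (M * ?n)"
      using n(1,2) mult_mono[OF t\<tau> Mw] by simp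
    have e3: "\<bar>Phi \<beta> (\<tau> * t) (?c q) (?c P) (\<tau> * t * ?c (M * w)) (\<tau> * t * (?c (M * w))\<^sup>2) -
        Phi \<beta> (\<tau> * t) (?c q') (?c P') (\<tau> * t * ?c (M * w')) (\<tau> * t * (?c (M * w'))\<^sup>2)\<bar> \<le> C3 * (2 * ?n + \<bar>t\<bar> * (M * ?n))"
      (is "\<bar>?A - ?B\<bar> \<le> _")
      by (rule order_trans[OF C3(3)[OF Jsc[OF \<tau> t]] mult_left_mono[OF s3 C3(1)]])
    have e4: "\<bar>\<tau> * A / M - \<tau> * B / M\<bar> = \<tau> * \<bar>A - B\<bar> / M" for A B
    proof -
      have "\<tau> * A / M - \<tau> * B / M = \<tau> * (A - B) / M"
        by (simp add: diff_divide_distrib right_diff_distrib)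
      then show ?thesis using \<tau> M by (simp add: abs_mult)
    qed
    have "\<bar>\<tau> * ?A / M - \<tau> * ?B / M\<bar> = \<tau> * \<bar>?A - ?B\<bar> / M" by (rule e4)
    also have "\<dots> \<le> \<bar>?A - ?B\<bar> / M"
      using \<tau> M by (intro divide_right_mono) (auto simp: mult_left_le_one_le)
    also have "\<dots> \<le> C3 * (2 * ?n + \<bar>t\<bar> * (M * ?n)) / M"
      using e3 M by (intro divide_right_mono) auto
    also have "\<dots> = (C3 / M) * (2 * ?n) + C3 * \<bar>t\<bar> * ?n"
      using M by (simp add: field_simps)
    also have "\<dots> \<le> 1 / 8 * (2 * ?n) + C3 * \<bar>t\<bar> * ?n"
      using M n by (intro add_mono mult_right_mono) auto
    finally have e3': "\<bar>\<tau> * ?A / M - \<tau> * ?B / M\<bar> \<le> ?n / 4 + C3 * \<bar>t\<bar> * ?n" by simp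
    have "norm (pole_G \<beta> R M \<tau> t y - pole_G \<beta> R M \<tau> t y')
      \<le> \<bar>t * F_q (\<tau> * t) (?c q) (?c P) (?c (M * w)) - t * F_q (\<tau> * t) (?c q') (?c P') (?c (M * w'))\<bar>
       + \<bar>t * F_P (\<tau> * t) (?c q) (?c P) (?c (M * w)) - t * F_P (\<tau> * t) (?c q') (?c P') (?c (M * w'))\<bar>
       + \<bar>\<tau> * ?A / M - \<tau> * ?B / M\<bar>"
      unfolding pole_G_def Let_def y by (simp del: norm_Pair) (rule n3)
    also have "\<dots> \<le> \<bar>t\<bar> * (C1 * ((2 + M) * ?n)) + \<bar>t\<bar> * (C2 * ((2 + M) * ?n)) + (?n / 4 + C3 * \<bar>t\<bar> * ?n)"
      by (intro add_mono e3') (use mult_left_mono[OF e1, of "\<bar>t\<bar>"] mult_left_mono[OF e2, of "\<bar>t\<bar>"] in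
          \<open>simp_all add: abs_mult flip: right_diff_distrib\<close>)
    also have "\<dots> = (k * \<bar>t\<bar> + 1/4) * ?n" by (simp add: k_def algebra_simps)
    finally show "norm (pole_G \<beta> R M \<tau> t y - pole_G \<beta> R M \<tau> t y') \<le> (k * \<bar>t\<bar> + 1/4) * ?n" .
  next
    fix \<tau> t :: real assume \<tau>: "\<tau> \<in> {0..1}" and t: "t \<in> ?J"
    have t2: "\<bar>t\<bar> \<le> 2" using t by auto
    have a: "\<bar>t * F_q (\<tau> * t) (?c 0) (?c 0) (?c 0)\<bar> \<le> 2 * C1"
      using C1(2)[OF Jsc[OF \<tau> t], of "(0,0,0)"] t2 unfolding abs_mult by (intro mult_mono) auto
    have b: "\<bar>t * F_P (\<tau> * t) (?c 0) (?c 0) (?c 0)\<bar> \<le> 2 * C2"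
      using C2(2)[OF Jsc[OF \<tau> t], of "(0,0,0)"] t2 unfolding abs_mult by (intro mult_mono) auto
    have "\<tau> * \<bar>Phi \<beta> (\<tau> * t) (?c 0) (?c 0) (\<tau> * t * ?c 0) (\<tau> * t * (?c 0)\<^sup>2)\<bar> \<le> 1 * C3"
      using C3(2)[OF Jsc[OF \<tau> t], of "(0,0,0)"] \<tau> by (intro mult_mono) auto
    then have c: "\<bar>\<tau> * Phi \<beta> (\<tau> * t) (?c 0) (?c 0) (\<tau> * t * ?c 0) (\<tau> * t * (?c 0)\<^sup>2) / M\<bar> \<le> C3 / M"
      using \<tau> M by (simp add: abs_mult divide_right_mono)
    show "norm (pole_G \<beta> R M \<tau> t 0) \<le> N"
      unfolding pole_G_def Let_def zero_prod_def fst_conv snd_conv mult_zero_right[of M]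
      by (rule order_trans[OF n3]) (use a b c in \<open>simp add: N_def\<close>)
  qed auto
  with M(1) show thesis by (rule that)
qed

text \<open>The cutoff \<open>c\<close> is either a clamp or the identity.\<close>

definition pole_system :: "(real \<Rightarrow> real) \<Rightarrow> real \<Rightarrow> real \<Rightarrow> real set \<Rightarrow> (real \<Rightarrow> real) \<Rightarrow> (real \<Rightarrow> real) \<Rightarrow> (real \<Rightarrow> real) \<Rightarrow> bool" where
  "pole_system c \<beta> a S q P w \<longleftrightarrow> (\<forall>t\<in>S.
     q t = (1 - a\<^sup>2) / 2 + t * avg 0 (\<lambda>\<sigma>. F_q \<sigma> (c (q \<sigma>)) (c (P \<sigma>)) (c (w \<sigma>))) t \<and>
     P t = a + t * avg 0 (\<lambda>\<sigma>. F_P \<sigma> (c (q \<sigma>)) (c (P \<sigma>)) (c (w \<sigma>))) t \<and>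
     w t = avg 1 (\<lambda>\<sigma>. Phi \<beta> \<sigma> (c (q \<sigma>)) (c (P \<sigma>)) (\<sigma> * c (w \<sigma>)) (\<sigma> * (c (w \<sigma>))\<^sup>2)) t)"

lemma pole_G_integral:
  assumes "averaged_equation (pole_G \<beta> R M) (-1) (3/2) k N" "M > 0"
    and S: "t \<in> S" "S \<subseteq> {-1..3/2}" "convex S" "0 \<in> S"
    and c: "continuous_on S q" "continuous_on S P" "continuous_on S w"
  shows "integral {0..1} (\<lambda>\<tau>. pole_G \<beta> R M \<tau> t (q (\<tau> * t), P (\<tau> * t), w (\<tau> * t) / M)) =
    (t * avg 0 (\<lambda>\<sigma>. F_q \<sigma> (clamp_to R (q \<sigma>)) (clamp_to R (P \<sigma>)) (clamp_to R (w \<sigma>))) t,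
     t * avg 0 (\<lambda>\<sigma>. F_P \<sigma> (clamp_to R (q \<sigma>)) (clamp_to R (P \<sigma>)) (clamp_to R (w \<sigma>))) t,
     avg 1 (\<lambda>\<sigma>. Phi \<beta> \<sigma> (clamp_to R (q \<sigma>)) (clamp_to R (P \<sigma>)) (\<sigma> * clamp_to R (w \<sigma>)) (\<sigma> * (clamp_to R (w \<sigma>))\<^sup>2)) t / M)"
proof -
  let ?I = "\<lambda>\<tau>. pole_G \<beta> R M \<tau> t (q (\<tau> * t), P (\<tau> * t), w (\<tau> * t) / M)"
  have "continuous_on S (\<lambda>s. (q s, P s, w s / M))"
    using assms(2) by (intro continuous_intros c) auto
  from averaged_equation.integrand_integrable[OF assms(1) S this]
  have i: "?I integrable_on {0..1}" .
  note l = integral_linear[OF i, symmetric]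
  have bl: "bounded_linear (\<lambda>y::real \<times> real \<times> real. fst (snd y))" "bounded_linear (\<lambda>y::real \<times> real \<times> real. snd (snd y))"
    using bounded_linear_compose[OF bounded_linear_fst bounded_linear_snd]
      bounded_linear_compose[OF bounded_linear_snd bounded_linear_snd] by (simp_all add: o_def)
  have "fst (integral {0..1} ?I) = t * avg 0 (\<lambda>\<sigma>. F_q \<sigma> (clamp_to R (q \<sigma>)) (clamp_to R (P \<sigma>)) (clamp_to R (w \<sigma>))) t"
    unfolding l[OF bounded_linear_fst] unfolding o_def pole_G_def Let_def avg_def using assms(2) by simp
  moreover have "fst (snd (integral {0..1} ?I)) = t * avg 0 (\<lambda>\<sigma>. F_P \<sigma> (clamp_to R (q \<sigma>)) (clamp_to R (P \<sigma>)) (clamp_to R (w \<sigma>))) t"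
    unfolding l[OF bl(1)] unfolding o_def pole_G_def Let_def avg_def using assms(2) by simp
  moreover have "snd (snd (integral {0..1} ?I)) = avg 1 (\<lambda>\<sigma>. Phi \<beta> \<sigma> (clamp_to R (q \<sigma>)) (clamp_to R (P \<sigma>)) (\<sigma> * clamp_to R (w \<sigma>)) (\<sigma> * (clamp_to R (w \<sigma>))\<^sup>2)) t / M"
    unfolding l[OF bl(2)] unfolding o_def pole_G_def Let_def avg_def using assms(2) by simp
  ultimately show ?thesis by (simp only: prod_eq_iff fst_conv snd_conv)
qed

lemma truncated_solution:
  assumes "\<beta> \<ge> 0" "R \<ge> 0" "A \<ge> 0"
  obtains q P w :: "real \<times> real \<Rightarrow> real" where
    "continuous_on ({-1..3/2} \<times> UNIV) q" "continuous_on ({-1..3/2} \<times> UNIV) P" "continuous_on ({-1..3/2} \<times> UNIV) w"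
    "\<And>a. a \<in> {0..A} \<Longrightarrow> pole_system (clamp_to R) \<beta> a {-1..3/2} (\<lambda>t. q (t, a)) (\<lambda>t. P (t, a)) (\<lambda>t. w (t, a))"
proof -
  obtain M k N where M: "M > 0" and ae: "averaged_equation (pole_G \<beta> R M) (-1) (3/2) k N"
    using pole_G_averaged[OF assms(1,2)] by blast
  \<comment> \<open>The slope is clamped to [0, A], which makes the initial data bounded in the
    parameter. The third entry is 0 because w is determined by its averaged equation and has no free
    initial value.\<close>
  define y0 where "y0 a = (let b = max 0 (min A a) in ((1 - b\<^sup>2) / 2, b, 0::real))" for a
  have c0: "continuous_on UNIV y0"
    unfolding y0_def Let_def by (intro continuous_intros) auto
  have "range y0 = y0 ` {0..A}"
  proof
    show "range y0 \<subseteq> y0 ` {0..A}"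
    proof
      fix y assume "y \<in> range y0"
      then obtain a where "y = y0 a" by auto
      then have "y = y0 (max 0 (min A a))" using assms(3) by (simp add: y0_def)
      then show "y \<in> y0 ` {0..A}" using assms(3) by auto
    qed
  qed auto
  then have b0: "bounded (range y0)"
    using compact_imp_bounded[OF compact_continuous_image[OF continuous_on_subset[OF c0 subset_UNIV] compact_Icc]] by metis
  obtain Y :: "real \<times> real \<Rightarrow> real \<times> real \<times> real" where Y: "continuous_on ({-1..3/2} \<times> UNIV) Y"
    "\<And>t p. t \<in> {-1..3/2} \<Longrightarrow> Y (t, p) = y0 p + integral {0..1} (\<lambda>\<tau>. pole_G \<beta> R M \<tau> t (Y (\<tau> * t, p)))"
    using averaged_equation.existence[OF ae c0 b0] by blast
  define q P w where "q x = fst (Y x)" and "P x = fst (snd (Y x))" and "w x = M * snd (snd (Y x))" for x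
  have cont: "continuous_on ({-1..3/2} \<times> UNIV) q" "continuous_on ({-1..3/2} \<times> UNIV) P" "continuous_on ({-1..3/2} \<times> UNIV) w"
    unfolding q_def P_def w_def by (intro continuous_intros Y(1))+
  have Yc: "Y x = (q x, P x, w x / M)" for x using M by (simp add: q_def P_def w_def)
  have cs: "continuous_on {-1..3/2} (\<lambda>t. f (t, a))" if "continuous_on ({-1..3/2} \<times> UNIV) f" for f :: "real \<times> real \<Rightarrow> real" and a
    by (rule continuous_on_compose2[OF that]) (auto intro!: continuous_intros)
  show thesis
  proof (rule that[OF cont])
    fix a assume a: "a \<in> {0..A}"
    show "pole_system (clamp_to R) \<beta> a {-1..3/2} (\<lambda>t. q (t, a)) (\<lambda>t. P (t, a)) (\<lambda>t. w (t, a))"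
      unfolding pole_system_def
    proof
      fix t :: real assume t: "t \<in> {-1..3/2}"
      have z: "0 \<in> {-1..3/2::real}" by simp
      note I = pole_G_integral[OF ae M t order_refl convex_real_interval(5) z cs[OF cont(1), of a] cs[OF cont(2), of a] cs[OF cont(3), of a]]
      have y0: "y0 a = ((1 - a\<^sup>2) / 2, a, 0)" using a by (simp add: y0_def)
      have "(q (t, a), P (t, a), w (t, a) / M) = ((1 - a\<^sup>2) / 2, a, 0) +
          integral {0..1} (\<lambda>\<tau>. pole_G \<beta> R M \<tau> t (q (\<tau> * t, a), P (\<tau> * t, a), w (\<tau> * t, a) / M))"
        using Y(2)[OF t, of a] unfolding Yc y0 .
      then show "q (t, a) = (1 - a\<^sup>2) / 2 + t * avg 0 (\<lambda>\<sigma>. F_q \<sigma> (clamp_to R (q (\<sigma>, a))) (clamp_to R (P (\<sigma>, a))) (clamp_to R (w (\<sigma>, a)))) t \<and>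
        P (t, a) = a + t * avg 0 (\<lambda>\<sigma>. F_P \<sigma> (clamp_to R (q (\<sigma>, a))) (clamp_to R (P (\<sigma>, a))) (clamp_to R (w (\<sigma>, a)))) t \<and>
        w (t, a) = avg 1 (\<lambda>\<sigma>. Phi \<beta> \<sigma> (clamp_to R (q (\<sigma>, a))) (clamp_to R (P (\<sigma>, a))) (\<sigma> * clamp_to R (w (\<sigma>, a))) (\<sigma> * (clamp_to R (w (\<sigma>, a)))\<^sup>2)) t"
        unfolding I using M by simp
    qed
  qed
qed

lemma truncated_unique:
  assumes "\<beta> \<ge> 0" "R \<ge> 0" and T: "0 \<le> T" "T \<le> 3/2"
    and c: "continuous_on {0..T} q" "continuous_on {0..T} P" "continuous_on {0..T} w"
    and c': "continuous_on {0..T} q'" "continuous_on {0..T} P'" "continuous_on {0..T} w'"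
    and s: "pole_system (clamp_to R) \<beta> a {0..T} q P w"
    and s': "pole_system (clamp_to R) \<beta> a {0..T} q' P' w'"
    and t: "t \<in> {0..T}"
  shows "q t = q' t \<and> P t = P' t \<and> w t = w' t"
proof -
  obtain M k N where M: "M > 0" and ae: "averaged_equation (pole_G \<beta> R M) (-1) (3/2) k N"
    using pole_G_averaged[OF assms(1,2)] by blast
  have M0: "M \<noteq> 0" using M by simp
  have *: "(q s, P s, w s / M) = ((1 - a\<^sup>2) / 2, a, 0) +
      integral {0..1} (\<lambda>\<tau>. pole_G \<beta> R M \<tau> s (q (\<tau> * s), P (\<tau> * s), w (\<tau> * s) / M))"
    if "s \<in> {0..T}" "continuous_on {0..T} q" "continuous_on {0..T} P" "continuous_on {0..T} w"
      "pole_system (clamp_to R) \<beta> a {0..T} q P w" for s q P w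
  proof -
    have sub: "{0..T} \<subseteq> {-1..3/2}" and z: "0 \<in> {0..T}" using T by auto
    note I = pole_G_integral[OF ae M that(1) sub convex_real_interval(5) z that(2-4)]
    show ?thesis unfolding I using that(1,5) by (simp add: pole_system_def)
  qed
  have "(q t, P t, w t / M) = (q' t, P' t, w' t / M)"
    by (rule averaged_equation.unique[OF ae T, of "\<lambda>s. (q s, P s, w s / M)" "\<lambda>s. (q' s, P' s, w' s / M)"
          "((1 - a\<^sup>2) / 2, a, 0)" t])
       (use c c' M0 t *[OF _ c s] *[OF _ c' s'] in \<open>auto intro!: continuous_intros\<close>)
  then show ?thesis using M by simp
qed

section \<open>Derivatives of the averages\<close>

lemma has_real_derivative_times_id:
  assumes "isCont w 0"
  shows "((\<lambda>t. t * w t) has_real_derivative w 0) (at (0::real))"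
proof -
  have "(w \<longlongrightarrow> w 0) (at 0)" using assms by (simp add: isCont_def)
  then have "((\<lambda>t. (t * w t - 0 * w 0) / (t - 0)) \<longlongrightarrow> w 0) (at 0)"
    by (rule Lim_transform_eventually) (auto simp: eventually_at_filter)
  then show ?thesis by (simp add: has_field_derivative_iff)
qed

text \<open>t times the average of \<open>\<phi>\<close> over [0, t] is one formula valid on all of
  J. On a compact interval around 0 and t it differs from the usual indefinite integral by a
  constant.\<close>

lemma antiderivative_on_open_interval:
  fixes \<phi> :: "real \<Rightarrow> real"
  assumes "open J" "convex J" "0 \<in> J" "continuous_on J \<phi>"
  obtains \<Psi> where "\<And>t. t \<in> J \<Longrightarrow> (\<Psi> has_real_derivative \<phi> t) (at t)"
proof -
  have "((\<lambda>t. t * avg 0 \<phi> t) has_real_derivative \<phi> t) (at t)" if t: "t \<in> J" for t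
  proof -
    obtain d where d: "d > 0" "cball t d \<subseteq> J" using assms(1) t open_contains_cball by blast
    define l h where "l = min 0 (t - d)" and "h = max 0 (t + d)"
    have "t - d \<in> J" "t + d \<in> J" using d by (auto simp: dist_real_def subset_eq)
    then have "l \<in> J" "h \<in> J" using assms(3) by (auto simp: l_def h_def min_def max_def)
    then have sub: "{l..h} \<subseteq> J"
      using assms(2) by (simp add: convex_contains_segment closed_segment_eq_real_ivl split: if_splits)
         (metis atLeastatMost_empty_iff empty_subsetI order.refl)
    have c: "continuous_on {l..h} \<phi>" using assms(4) sub continuous_on_subset by blast
    have lh: "l \<le> 0" "0 \<le> h" "l < t" "t < h" using d(1) by (auto simp: l_def h_def)
    let ?\<Psi> = "\<lambda>s. integral {l..s} \<phi>"
    have D: "(?\<Psi> has_real_derivative \<phi> s) (at s within {l..h})" if "s \<in> {l..h}" for s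
      using integral_has_real_derivative[OF c that] .
    have eq: "s * avg 0 \<phi> s = ?\<Psi> s - ?\<Psi> 0" if s: "s \<in> {l..h}" for s
    proof -
      have "((\<lambda>\<tau>. s * \<phi> (\<tau> * s)) has_integral ?\<Psi> (1 * s) - ?\<Psi> (0 * s)) {0..1}"
      proof (rule fundamental_theorem_of_calculus)
        fix \<tau> :: real assume \<tau>: "\<tau> \<in> {0..1}"
        have sc: "(\<lambda>\<tau>. \<tau> * s) ` {0..1} \<subseteq> {l..h}"
          using scaled_in_interval[of "{l..h}" s] s lh by auto
        have "((\<lambda>\<tau>. \<tau> * s) has_real_derivative s) (at \<tau> within {0..1})"
          by (auto intro!: derivative_eq_intros)
        moreover have "(?\<Psi> has_real_derivative \<phi> (\<tau> * s)) (at (\<tau> * s) within (\<lambda>\<tau>. \<tau> * s) ` {0..1})"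
          by (rule DERIV_subset[OF D[OF subsetD[OF sc imageI[OF \<tau>]]] sc])
        ultimately have "(?\<Psi> \<circ> (\<lambda>\<tau>. \<tau> * s) has_real_derivative \<phi> (\<tau> * s) * s) (at \<tau> within {0..1})"
          by (intro DERIV_image_chain)
        then show "((\<lambda>\<tau>. ?\<Psi> (\<tau> * s)) has_vector_derivative s * \<phi> (\<tau> * s)) (at \<tau> within {0..1})"
          by (simp add: o_def mult.commute flip: has_real_derivative_iff_has_vector_derivative)
      qed simp
      from integral_unique[OF this] show ?thesis by (simp add: avg_def)
    qed
    have "((\<lambda>s. ?\<Psi> s - ?\<Psi> 0) has_real_derivative \<phi> t) (at t within {l<..<h})"
      using D[of t] lh by (auto intro!: derivative_eq_intros intro: DERIV_subset[of _ _ _ "{l..h}"])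
    then have "((\<lambda>s. ?\<Psi> s - ?\<Psi> 0) has_real_derivative \<phi> t) (at t)"
      using lh by (simp add: at_within_open[of t "{l<..<h}"])
    then show ?thesis
      by (rule has_field_derivative_transform_within_open[of _ _ _ "{l<..<h}"]) (use lh eq in auto)
  qed
  then show thesis using that by blast
qed

lemma avg_eq_difference:
  assumes "open J" "convex J" "0 \<in> J" "t \<in> J"
    and "\<And>s. s \<in> J \<Longrightarrow> (\<Psi> has_real_derivative s ^ j * \<phi> s) (at s)"
  shows "t ^ Suc j * avg j \<phi> t = \<Psi> t - \<Psi> 0"
proof -
  have "((\<lambda>\<tau>. t ^ Suc j * (\<tau> ^ j * \<phi> (\<tau> * t))) has_integral \<Psi> (1 * t) - \<Psi> (0 * t)) {0..1}"
  proof (rule fundamental_theorem_of_calculus)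
    fix \<tau> :: real assume "\<tau> \<in> {0..1}"
    then have J: "\<tau> * t \<in> J" by (rule scaled_in_interval[OF assms(2,3,4)])
    have "((\<lambda>\<tau>. \<tau> * t) has_real_derivative t) (at \<tau> within {0..1})"
      by (auto intro!: derivative_eq_intros)
    from DERIV_chain2[where f=\<Psi> and g="\<lambda>\<tau>. \<tau> * t" and x=\<tau> and s="{0..1}", OF assms(5)[OF J] this]
    have "((\<lambda>\<tau>. \<Psi> (\<tau> * t)) has_real_derivative t ^ Suc j * (\<tau> ^ j * \<phi> (\<tau> * t))) (at \<tau> within {0..1})"
      by (simp add: power_mult_distrib mult_ac)
    then show "((\<lambda>\<tau>. \<Psi> (\<tau> * t)) has_vector_derivative t ^ Suc j * (\<tau> ^ j * \<phi> (\<tau> * t))) (at \<tau> within {0..1})"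
      by (simp add: has_real_derivative_iff_has_vector_derivative)
  qed simp
  from integral_unique[OF this] show ?thesis
    by (simp add: avg_def del: power_Suc)
qed

lemma avg_0_deriv:
  assumes "open J" "convex J" "0 \<in> J" "continuous_on J \<phi>" "t \<in> J"
  shows "((\<lambda>t. t * avg 0 \<phi> t) has_real_derivative \<phi> t) (at t)"
proof -
  obtain \<Psi> where \<Psi>: "\<And>t. t \<in> J \<Longrightarrow> (\<Psi> has_real_derivative \<phi> t) (at t)"
    using antiderivative_on_open_interval[OF assms(1-4)] by blast
  have "((\<lambda>t. \<Psi> t - \<Psi> 0) has_real_derivative \<phi> t) (at t)"
    using \<Psi>[OF assms(5)] by (auto intro!: derivative_eq_intros)
  then show ?thesis
    by (rule has_field_derivative_transform_within_open[OF _ assms(1,5)])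
       (use avg_eq_difference[OF assms(1-3), of _ \<Psi> 0 \<phi>] \<Psi> in auto)
qed

text \<open>With w the average, w' = (\<phi> - 2 w) / t makes sense only for t different from 0. For
  t w and t w^2 the division cancels, and at t = 0 the formulas persist because w = \<phi> / 2
  there. This is the gain of one derivative through the pole.\<close>

lemma avg_1_deriv:
  assumes "open J" "convex J" "0 \<in> J" "continuous_on J \<phi>" "t \<in> J"
  shows "((\<lambda>t. t * avg 1 \<phi> t) has_real_derivative \<phi> t - avg 1 \<phi> t) (at t)"
    and "t \<noteq> 0 \<Longrightarrow> (avg 1 \<phi> has_real_derivative (\<phi> t - 2 * avg 1 \<phi> t) / t) (at t)"
    and "((\<lambda>t. t * (avg 1 \<phi> t)\<^sup>2) has_real_derivative (avg 1 \<phi> t)\<^sup>2 + 2 * avg 1 \<phi> t * (\<phi> t - 2 * avg 1 \<phi> t)) (at t)"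
proof -
  have "continuous_on J (\<lambda>s. s * \<phi> s)" by (intro continuous_intros assms)
  from antiderivative_on_open_interval[OF assms(1-3) this]
  obtain \<Psi> where \<Psi>: "\<And>t. t \<in> J \<Longrightarrow> (\<Psi> has_real_derivative t * \<phi> t) (at t)" by blast
  have eq: "avg 1 \<phi> s = (\<Psi> s - \<Psi> 0) / s\<^sup>2" if "s \<in> J" "s \<noteq> 0" for s
    using avg_eq_difference[OF assms(1-3) that(1), of \<Psi> 1 \<phi>] \<Psi> that by (simp add: field_simps power2_eq_square)
  have cont: "isCont (avg 1 \<phi>) s" if "s \<in> J" for s
    using Cn_on_avg[OF assms(1-3), of 0 \<phi> 1] assms(4) that continuous_on_eq_continuous_at[OF assms(1)] by auto
  show ne: "(avg 1 \<phi> has_real_derivative (\<phi> t - 2 * avg 1 \<phi> t) / t) (at t)" if "t \<noteq> 0"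
  proof -
    have "((\<lambda>s. (\<Psi> s - \<Psi> 0) / s\<^sup>2) has_real_derivative (\<phi> t - 2 * avg 1 \<phi> t) / t) (at t)"
    proof -
      have e: "\<Psi> t = \<Psi> 0 + avg 1 \<phi> t * t\<^sup>2" using eq[OF assms(5) that] that by simp
      show ?thesis
        by (rule derivative_eq_intros \<Psi>[OF assms(5)] refl | (use that in simp; fail))+
           (use that in \<open>simp add: e field_simps power2_eq_square\<close>)
    qed
    then show ?thesis
      by (rule has_field_derivative_transform_within_open[of _ _ _ "J - {0}"]) (use assms that eq in auto)
  qed
  have z: "avg 1 \<phi> 0 = \<phi> 0 / 2"
  proof -
    have "((\<lambda>\<tau>::real. \<tau> ^ 1) has_integral (1 ^ 2 / 2) - (0 ^ 2 / 2)) {0..1}"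
      by (rule fundamental_theorem_of_calculus)
         (auto simp flip: has_real_derivative_iff_has_vector_derivative intro!: derivative_eq_intros)
    from integral_unique[OF has_integral_mult_left[OF this, of "\<phi> 0"]] show ?thesis
      by (simp add: avg_def)
  qed
  show "((\<lambda>t. t * avg 1 \<phi> t) has_real_derivative \<phi> t - avg 1 \<phi> t) (at t)"
  proof (cases "t = 0")
    case True
    have "\<phi> 0 - avg 1 \<phi> 0 = avg 1 \<phi> 0" using z by simp
    then show ?thesis using has_real_derivative_times_id[OF cont[OF assms(3)]] True by (simp only:)
  next
    case False
    show ?thesis by (rule derivative_eq_intros ne False refl)+ (use False in simp)
  qed
  show "((\<lambda>t. t * (avg 1 \<phi> t)\<^sup>2) has_real_derivative (avg 1 \<phi> t)\<^sup>2 + 2 * avg 1 \<phi> t * (\<phi> t - 2 * avg 1 \<phi> t)) (at t)"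
  proof (cases "t = 0")
    case True
    have "isCont (\<lambda>t. (avg 1 \<phi> t)\<^sup>2) 0" using cont[OF assms(3)] by (intro continuous_intros)
    note d = has_real_derivative_times_id[OF this]
    have "(avg 1 \<phi> 0)\<^sup>2 + 2 * avg 1 \<phi> 0 * (\<phi> 0 - 2 * avg 1 \<phi> 0) = (avg 1 \<phi> 0)\<^sup>2" using z by simp
    then show ?thesis using d True by (simp only:)
  next
    case False
    show ?thesis by (rule derivative_eq_intros ne False refl)+ (use False in \<open>simp add: field_simps power2_eq_square\<close>)
  qed
qed

subsection \<open>Energy estimates for the profile\<close>

lemma nondecreasing_open:
  fixes f f' :: "real \<Rightarrow> real"
  assumes "s \<le> t" "continuous_on {s..t} f"
    "\<And>x. s < x \<Longrightarrow> x < t \<Longrightarrow> (f has_real_derivative f' x) (at x)" "\<And>x. s < x \<Longrightarrow> x < t \<Longrightarrow> f' x \<ge> 0"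
  shows "f s \<le> f t"
  by (rule DERIV_nonneg_imp_increasing_open[OF assms(1) _ assms(2)]) (use assms(3,4) in blast)

text \<open>Differentiability is required only for t > 0, continuity up to the pole. The value q 0
  is forced by the constraint, which reads 2 q + P^2 = 1 at t = 0, and w 0 by t w' + 2 w =
  Phi.\<close>

locale pole_flow =
  fixes \<beta> a T :: real and q P w :: "real \<Rightarrow> real"
  assumes \<beta>: "\<beta> > 0" and a: "a > 0" and Tf: "0 < T" "T < 2"
    and cont: "continuous_on {0..T} q" "continuous_on {0..T} P" "continuous_on {0..T} w"
    and init: "q 0 = (1 - a\<^sup>2) / 2" "P 0 = a" "w 0 = Phi \<beta> 0 (q 0) (P 0) 0 0 / 2"
    and q_deriv: "t \<in> {0<..<T} \<Longrightarrow> (q has_real_derivative F_q t (q t) (P t) (w t)) (at t)"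
    and P_deriv: "t \<in> {0<..<T} \<Longrightarrow> (P has_real_derivative F_P t (q t) (P t) (w t)) (at t)"
    and w_deriv: "t \<in> {0<..<T} \<Longrightarrow>
      (w has_real_derivative (Phi \<beta> t (q t) (P t) (t * w t) (t * (w t)\<^sup>2) - 2 * w t) / t) (at t)"
begin

definition "Q t = 1 - t + t * (2 - t) * q t"
definition "g t = P t + t * (2 - t) * w t"
definition "N t = 2 + (1 + 2 * \<beta>) * (g t)\<^sup>2 + (P t)\<^sup>2"
definition "B t = Bfun \<beta> t (q t) (P t) (t * w t) (t * (w t)\<^sup>2)"
definition "E t = t * (2 - t) * (g t)\<^sup>2 + (Q t)\<^sup>2"

lemma N_pos: "N t \<ge> 2" "N t > 0"
proof -
  have "(1 + 2 * \<beta>) * (g t)\<^sup>2 \<ge> 0" using \<beta> by simp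
  then show "N t \<ge> 2" unfolding N_def by (smt (verit) zero_le_power2)
  then show "N t > 0" by simp
qed

lemma gfun_g: "gfun t (P t) (t * w t) = g t"
  by (simp add: gfun_def g_def algebra_simps)

lemma B_eq: "B t * N t = 2 * \<beta> * (t * (2 - t) * w t * ((1 - t) * w t - P t * q t) - P t * q t * (g t + P t))"
proof -
  have "Den \<beta> t (P t) (t * w t) = N t" by (simp add: Den_def N_def gfun_g)
  then have "B t = 2 * \<beta> * ((2 - t) * ((1 - t) * (t * (w t)\<^sup>2) - t * w t * P t * q t) - P t * q t * (g t + P t)) / N t"
    by (simp add: B_def Bfun_def gfun_g)
  then show ?thesis using N_pos(2)[of t] by (simp add: power2_eq_square) (simp add: algebra_simps)
qed

lemma cont_QgE: "continuous_on {0..T} Q" "continuous_on {0..T} g" "continuous_on {0..T} E"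
  unfolding E_def [abs_def] Q_def [abs_def] g_def [abs_def] by (intro continuous_intros cont)+

lemma cont_sub: "continuous_on {0..T} f \<Longrightarrow> 0 \<le> s \<Longrightarrow> t \<le> T \<Longrightarrow> continuous_on {s..t} f" for f :: "real \<Rightarrow> real"
  by (erule continuous_on_subset) auto

lemmas cs = cont_sub[OF cont(1)] cont_sub[OF cont(2)] cont_sub[OF cont(3)]
  cont_sub[OF cont_QgE(1)] cont_sub[OF cont_QgE(2)] cont_sub[OF cont_QgE(3)]

text \<open>This is Q^2 + (1 - z^2) P^2 = 1 divided by 1 - z^2. Its defect satisfies I' = 2 q I and
  I 0 = 0. With C bounding |q|, the function I^2 exp (- 4 C t) is nonincreasing, hence zero.\<close>

lemma invariant:
  assumes "t \<in> {0..T}"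
  shows "2 * (1 - t) * q t + t * (2 - t) * (q t)\<^sup>2 + (P t)\<^sup>2 = 1"
proof -
  define I where "I t = 2 * (1 - t) * q t + t * (2 - t) * (q t)\<^sup>2 + (P t)\<^sup>2 - 1" for t
  obtain C where C: "\<And>t. t \<in> {0..T} \<Longrightarrow> \<bar>q t\<bar> \<le> C"
    using compact_imp_bounded[OF compact_continuous_image[OF cont(1) compact_Icc]]
    by (metis bounded_iff imageI real_norm_def)
  have I': "(I has_real_derivative 2 * q t * I t) (at t)" if "t \<in> {0<..<T}" for t
  proof -
    have "(I has_real_derivative (- 2 * q t + 2 * (1 - t) * F_q t (q t) (P t) (w t))
       + ((2 - 2 * t) * (q t)\<^sup>2 + t * (2 - t) * (2 * q t * F_q t (q t) (P t) (w t))) + 2 * P t * F_P t (q t) (P t) (w t)) (at t)"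
      unfolding I_def [abs_def]
      by (rule derivative_eq_intros q_deriv[OF that] P_deriv[OF that] refl)+ (simp add: algebra_simps)
    then show ?thesis
      by (rule DERIV_cong) (simp add: I_def F_q_def F_P_def algebra_simps power2_eq_square)
  qed
  let ?h = "\<lambda>t. - ((I t)\<^sup>2 * exp (- 4 * C * t))"
  have "?h 0 \<le> ?h t"
  proof (rule nondecreasing_open[of 0 t ?h "\<lambda>t. 4 * (C - q t) * ((I t)\<^sup>2 * exp (- 4 * C * t))"])
    show "continuous_on {0..t} ?h"
      unfolding I_def [abs_def] using assms by (intro continuous_intros cs) auto
    fix x assume x: "0 < x" "x < t"
    then have x': "x \<in> {0<..<T}" using assms by auto
    show "(?h has_real_derivative 4 * (C - q x) * ((I x)\<^sup>2 * exp (- 4 * C * x))) (at x)"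
      by (rule derivative_eq_intros I'[OF x'] refl)+ (simp add: algebra_simps power2_eq_square)
    show "4 * (C - q x) * ((I x)\<^sup>2 * exp (- 4 * C * x)) \<ge> 0"
      using C[of x] x' by auto
  qed (use assms in auto)
  moreover have "I 0 = 0" by (simp add: I_def init field_simps)
  ultimately have "(I t)\<^sup>2 * exp (- 4 * C * t) \<le> 0" by simp
  then have "I t = 0" by (simp add: mult_le_0_iff)
  then show ?thesis by (simp add: I_def)
qed

lemma unit:
  assumes "t \<in> {0..T}"
  shows "(Q t)\<^sup>2 + t * (2 - t) * (P t)\<^sup>2 = 1"
proof -
  have "(Q t)\<^sup>2 + t * (2 - t) * (P t)\<^sup>2 = (1 - t)\<^sup>2 + t * (2 - t) * (2 * (1 - t) * q t + t * (2 - t) * (q t)\<^sup>2 + (P t)\<^sup>2)"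
    by (simp add: Q_def power2_eq_square algebra_simps)
  then show ?thesis unfolding invariant[OF assms] by (simp add: power2_eq_square algebra_simps)
qed

lemma Q_deriv:
  assumes "t \<in> {0<..<T}"
  shows "(Q has_real_derivative - (P t * g t)) (at t)"
proof -
  have "(Q has_real_derivative - 1 + ((2 - 2 * t) * q t + t * (2 - t) * F_q t (q t) (P t) (w t))) (at t)"
    unfolding Q_def [abs_def] by (rule derivative_eq_intros q_deriv[OF assms] refl)+ (simp add: algebra_simps)
  moreover have "- 1 + ((2 - 2 * t) * q t + t * (2 - t) * F_q t (q t) (P t) (w t))
    = (2 * (1 - t) * q t + t * (2 - t) * (q t)\<^sup>2 + (P t)\<^sup>2) - 1 - P t * g t"
    by (simp add: F_q_def g_def power2_eq_square algebra_simps)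
  moreover have "\<dots> = - (P t * g t)" using invariant[of t] assms by simp
  ultimately show ?thesis by (simp only:)
qed

lemma P_flow: "t * (2 - t) * F_P t (q t) (P t) (w t) = Q t * g t - (1 - t) * P t"
  by (simp add: F_P_def Q_def g_def algebra_simps)

lemma g_deriv:
  assumes "t \<in> {0<..<T}"
  shows "(g has_real_derivative P t * q t - (1 - t) * w t + B t * g t) (at t)"
proof -
  let ?\<Phi> = "Phi \<beta> t (q t) (P t) (t * w t) (t * (w t)\<^sup>2)"
  have t: "t > 0" "2 - t > 0" using assms Tf by auto
  have c1: "(2 / (2 - t) - q t) * (2 - t) = 2 - (2 - t) * q t"
  proof -
    have "(c / d - y) * d = c - d * y" if "d \<noteq> 0" for c d y :: real
      using that by (simp add: field_simps)
    then show ?thesis using t by simp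
  qed
  have c2: "(X * v + Y) * d = (X * d) * v + Y * d" for X v Y d :: real by (simp add: algebra_simps)
  have "?\<Phi> * (2 - t) = ((2 / (2 - t) - q t) * (2 - t)) * (t * w t) + (B t * g t / (2 - t)) * (2 - t)"
    unfolding Phi_def gfun_g B_def [symmetric] by (rule c2)
  also have "\<dots> = (2 - (2 - t) * q t) * (t * w t) + B t * g t"
    unfolding c1 using t by simp
  finally have 1: "(2 - t) * (?\<Phi> - 2 * w t) = (2 - (2 - t) * q t) * (t * w t) + B t * g t - 2 * (2 - t) * w t"
    by (simp add: algebra_simps)
  have "(g has_real_derivative F_P t (q t) (P t) (w t) + ((2 - 2 * t) * w t + t * (2 - t) * ((?\<Phi> - 2 * w t) / t))) (at t)"
    unfolding g_def [abs_def] by (rule derivative_eq_intros P_deriv[OF assms] w_deriv[OF assms] refl)+ (simp add: algebra_simps)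
  moreover have "t * (2 - t) * ((?\<Phi> - 2 * w t) / t) = (2 - t) * (?\<Phi> - 2 * w t)" using t by simp
  ultimately have "(g has_real_derivative F_P t (q t) (P t) (w t) + ((2 - 2 * t) * w t + ((2 - (2 - t) * q t) * (t * w t) + B t * g t - 2 * (2 - t) * w t))) (at t)"
    unfolding 1 by simp
  then show ?thesis
    by (rule DERIV_cong) (simp add: F_P_def algebra_simps)
qed

text \<open>Undoes the division by t (2 - t) that was built into \<open>Bfun\<close>.\<close>

lemma kB_eq: "t * (2 - t) * B t * N t = 2 * \<beta> * ((1 - t) * ((g t)\<^sup>2 + (P t)\<^sup>2) - 2 * g t * P t * Q t)"
proof -
  have "t * (2 - t) * B t * N t = t * (2 - t) * (B t * N t)" by simp
  also have "\<dots> = 2 * \<beta> * ((1 - t) * ((g t)\<^sup>2 + (P t)\<^sup>2) - 2 * g t * P t * Q t)"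
    unfolding B_eq by (simp add: g_def Q_def power2_eq_square algebra_simps)
  finally show ?thesis .
qed

text \<open>All terms except the one from B cancel, so E' = 2 t (2 - t) B g^2. In particular E would
  be conserved for \<beta> = 0.\<close>

lemma E_deriv:
  assumes "t \<in> {0<..<T}"
  shows "(E has_real_derivative 4 * \<beta> * (g t)\<^sup>2 * ((1 - t) * ((g t)\<^sup>2 + (P t)\<^sup>2) - 2 * g t * P t * Q t) / N t) (at t)"
proof -
  have "(E has_real_derivative ((2 - 2 * t) * (g t)\<^sup>2 + t * (2 - t) * (2 * g t * (P t * q t - (1 - t) * w t + B t * g t)))
      + 2 * Q t * (- (P t * g t))) (at t)"
    unfolding E_def [abs_def] by (rule derivative_eq_intros g_deriv[OF assms] Q_deriv[OF assms] refl)+ (simp add: algebra_simps)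
  moreover have "((2 - 2 * t) * (g t)\<^sup>2 + t * (2 - t) * (2 * g t * (P t * q t - (1 - t) * w t + B t * g t)))
      + 2 * Q t * (- (P t * g t)) = 2 * (t * (2 - t) * B t) * (g t)\<^sup>2"
    by (simp add: Q_def g_def power2_eq_square algebra_simps)
  moreover have "2 * (t * (2 - t) * B t) * (g t)\<^sup>2 = 4 * \<beta> * (g t)\<^sup>2 * ((1 - t) * ((g t)\<^sup>2 + (P t)\<^sup>2) - 2 * g t * P t * Q t) / N t"
    using kB_eq[of t] N_pos(2)[of t] by (simp add: eq_divide_eq) (simp add: algebra_simps)
  ultimately show ?thesis by simp
qed

end

text \<open>Up to the equator 1 - t \<ge> 0 and 2 - t \<ge> 1. The first sign is used for the gain
  of energy in the first quarter turn, the second for t g^2 \<le> E.\<close>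

locale pole_solution = pole_flow +
  assumes T_le_1: "T \<le> 1"
begin

lemmas T = Tf(1) T_le_1

lemma Q_le_1: "t \<in> {0..T} \<Longrightarrow> \<bar>Q t\<bar> \<le> 1"
proof -
  assume t: "t \<in> {0..T}"
  then have "t * (2 - t) * (P t)\<^sup>2 \<ge> 0" using T by simp
  then have "(Q t)\<^sup>2 \<le> 1" using unit[OF t] by linarith
  then show ?thesis by (simp add: abs_square_le_1)
qed

lemma gPQ_le: "t \<in> {0..T} \<Longrightarrow> \<bar>2 * g t * P t * Q t\<bar> \<le> (g t)\<^sup>2 + (P t)\<^sup>2"
proof -
  assume t: "t \<in> {0..T}"
  have "\<bar>2 * g t * P t * Q t\<bar> \<le> \<bar>2 * g t * P t\<bar>"
    using mult_left_le[OF Q_le_1[OF t], of "\<bar>2 * g t * P t\<bar>"] by (simp add: abs_mult)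
  also have "\<dots> \<le> (g t)\<^sup>2 + (P t)\<^sup>2"
    using sum_squares_bound[of "\<bar>g t\<bar>" "\<bar>P t\<bar>"] by (simp add: abs_mult)
  finally show ?thesis .
qed

lemma N_ge: "(g t)\<^sup>2 + (P t)\<^sup>2 \<le> N t"
proof -
  have "0 \<le> 2 * \<beta> * (g t)\<^sup>2" using \<beta> by simp
  then show ?thesis by (simp add: N_def algebra_simps)
qed

text \<open>By the inequality between g^2 + P^2 and 2 |g P|, the bracket is at least - t (g^2 +
  P^2). The factor t is essential, since E controls t g^2 and not g^2.\<close>

lemma E_lower_growth:
  assumes "t \<in> {0<..<T}"
  shows "- 4 * \<beta> * E t \<le> 4 * \<beta> * (g t)\<^sup>2 * ((1 - t) * ((g t)\<^sup>2 + (P t)\<^sup>2) - 2 * g t * P t * Q t) / N t"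
proof -
  let ?s = "(g t)\<^sup>2 + (P t)\<^sup>2"
  have t: "0 < t" "t < 1" "t \<in> {0..T}" using assms T by auto
  have "- t * ?s \<le> (1 - t) * ?s - 2 * g t * P t * Q t"
    using gPQ_le[OF t(3)] by (simp add: algebra_simps abs_le_iff)
  moreover have "- t * N t \<le> - t * ?s" using N_ge[of t] t by simp
  ultimately have "- t * N t \<le> (1 - t) * ?s - 2 * g t * P t * Q t" by linarith
  then have "4 * \<beta> * (g t)\<^sup>2 * (- t * N t) \<le> 4 * \<beta> * (g t)\<^sup>2 * ((1 - t) * ?s - 2 * g t * P t * Q t)"
    using \<beta> by (intro mult_left_mono) auto
  then have 1: "4 * \<beta> * (g t)\<^sup>2 * (- t) \<le> 4 * \<beta> * (g t)\<^sup>2 * ((1 - t) * ?s - 2 * g t * P t * Q t) / N t"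
    using N_pos(2)[of t] by (simp add: pos_le_divide_eq mult_ac)
  have "t * (g t)\<^sup>2 * 1 \<le> t * (g t)\<^sup>2 * (2 - t)" using t by (intro mult_left_mono) auto
  then have "t * (g t)\<^sup>2 \<le> E t" by (simp add: E_def mult_ac add_increasing2)
  then have "4 * \<beta> * (t * (g t)\<^sup>2) \<le> 4 * \<beta> * E t" using \<beta> by (intro mult_left_mono) auto
  then show ?thesis using 1 by (simp add: mult_ac)
qed

lemma E_lower:
  assumes "0 \<le> s" "s \<le> t" "t \<le> T"
  shows "E s * exp (- 4 * \<beta> * (t - s)) \<le> E t"
proof -
  let ?e = "\<lambda>t. 4 * \<beta> * (g t)\<^sup>2 * ((1 - t) * ((g t)\<^sup>2 + (P t)\<^sup>2) - 2 * g t * P t * Q t) / N t"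
  have "E s * exp (4 * \<beta> * s) \<le> E t * exp (4 * \<beta> * t)"
  proof (rule nondecreasing_open[OF assms(2), of "\<lambda>t. E t * exp (4 * \<beta> * t)" "\<lambda>x. (?e x + 4 * \<beta> * E x) * exp (4 * \<beta> * x)"])
    show "continuous_on {s..t} (\<lambda>t. E t * exp (4 * \<beta> * t))"
      using assms by (intro continuous_intros cs) auto
    fix x assume "s < x" "x < t"
    then have x: "x \<in> {0<..<T}" using assms by auto
    show "((\<lambda>t. E t * exp (4 * \<beta> * t)) has_real_derivative (?e x + 4 * \<beta> * E x) * exp (4 * \<beta> * x)) (at x)"
      by (rule derivative_eq_intros E_deriv[OF x] refl)+ (simp add: algebra_simps)
    show "0 \<le> (?e x + 4 * \<beta> * E x) * exp (4 * \<beta> * x)"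
      using E_lower_growth[OF x] by simp
  qed
  then have "E s * exp (4 * \<beta> * s) * exp (- 4 * \<beta> * t) \<le> E t * exp (4 * \<beta> * t) * exp (- 4 * \<beta> * t)"
    by (intro mult_right_mono) auto
  then show ?thesis by (simp add: mult.assoc flip: exp_add) (simp add: algebra_simps)
qed

lemma E_0: "E 0 = 1" by (simp add: E_def Q_def)

lemma E_pos: "t \<in> {0..T} \<Longrightarrow> E t > 0"
  using E_lower[of 0 t] by (auto simp: E_0 intro: less_le_trans[OF exp_gt_zero])

text \<open>Upward the bracket has no factor t, so g^2 itself must be estimated by E / s. The bound
  degenerates at the pole and can only start from some s > 0.\<close>

lemma E_upper:
  assumes "0 < s" "s \<le> t" "t \<le> T"
  shows "E t \<le> E s * exp (8 * \<beta> / s * (t - s))"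
proof -
  let ?e = "\<lambda>t. 4 * \<beta> * (g t)\<^sup>2 * ((1 - t) * ((g t)\<^sup>2 + (P t)\<^sup>2) - 2 * g t * P t * Q t) / N t"
  define c where "c = 8 * \<beta> / s"
  have "- (E s * exp (- c * s)) \<le> - (E t * exp (- c * t))"
  proof (rule nondecreasing_open[OF assms(2), of "\<lambda>t. - (E t * exp (- c * t))" "\<lambda>x. (c * E x - ?e x) * exp (- c * x)"])
    show "continuous_on {s..t} (\<lambda>t. - (E t * exp (- c * t)))"
      using assms by (intro continuous_intros cs) auto
    fix x assume sx: "s < x" "x < t"
    then have x: "x \<in> {0<..<T}" "x \<in> {0..T}" using assms by auto
    show "((\<lambda>t. - (E t * exp (- c * t))) has_real_derivative (c * E x - ?e x) * exp (- c * x)) (at x)"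
      by (rule derivative_eq_intros E_deriv[OF x(1)] refl)+ (simp add: algebra_simps)
    have x1: "x < 1" using x(1) T by auto
    let ?s = "(g x)\<^sup>2 + (P x)\<^sup>2"
    have h1: "(1 - x) * ?s - 2 * g x * P x * Q x \<le> 2 * ?s - x * ?s"
      using gPQ_le[OF x(2)] by (simp add: algebra_simps abs_le_iff)
    have h2: "0 \<le> x * ?s" using x(2) by simp
    have gen: "A \<le> 2 * S - Y \<Longrightarrow> 0 \<le> Y \<Longrightarrow> S \<le> M \<Longrightarrow> A \<le> 2 * M" for A S Y M :: real by linarith
    have "(1 - x) * ?s - 2 * g x * P x * Q x \<le> 2 * N x" by (rule gen[OF h1 h2 N_ge])
    then have "4 * \<beta> * (g x)\<^sup>2 * ((1 - x) * ?s - 2 * g x * P x * Q x) \<le> 4 * \<beta> * (g x)\<^sup>2 * (2 * N x)"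
      using \<beta> by (intro mult_left_mono) auto
    then have "?e x \<le> 8 * \<beta> * (g x)\<^sup>2"
      using N_pos(2)[of x] by (simp add: pos_divide_le_eq mult_ac)
    moreover have "s * (g x)\<^sup>2 \<le> E x"
    proof -
      have "s * 1 \<le> x * (2 - x)" using sx x1 assms(1) by (intro mult_mono) auto
      from mult_right_mono[OF this, of "(g x)\<^sup>2"] show ?thesis by (simp add: E_def add_increasing2)
    qed
    then have "8 * \<beta> * (g x)\<^sup>2 \<le> c * E x"
      using \<beta> assms(1) by (simp add: c_def pos_le_divide_eq mult_ac)
    ultimately show "0 \<le> (c * E x - ?e x) * exp (- c * x)" by simp
  qed
  then have "E t * exp (- c * t) * exp (c * t) \<le> E s * exp (- c * s) * exp (c * t)"
    by (intro mult_right_mono) auto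
  then have "E t \<le> E s * exp (c * (t - s))"
    by (simp add: mult.assoc flip: exp_add) (simp add: algebra_simps)
  then show ?thesis by (simp only: c_def)
qed

end

subsection \<open>The profile for large initial slope\<close>

context pole_solution begin

text \<open>While the solution is in the first quarter turn and \<open>w > 0\<close>, the quotient
  \<open>(tan (f / 2) / tan (r / 2))\<^sup>2\<close> is nondecreasing from its initial value \<open>a\<^sup>2\<close>.\<close>

lemma tan_ratio_ge:
  assumes \<tau>: "0 < \<tau>" "\<tau> \<le> T" and pos: "\<forall>t\<in>{0..<\<tau>}. w t > 0 \<and> P t > 0 \<and> Q t > 0"
    and t: "t \<in> {0..\<tau>}"
  shows "1 - Q t \<ge> t * a\<^sup>2 / 2" "Q t \<ge> 0" "w t \<ge> 0" "P t \<ge> 0"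
proof -
  have lim: "f t \<ge> 0" if "continuous_on {0..T} f" "\<And>t. t \<in> {0..<\<tau>} \<Longrightarrow> f t > 0" "t \<in> {0..\<tau>}" for f :: "real \<Rightarrow> real" and t
  proof (rule ccontr)
    assume n: "\<not> f t \<ge> 0"
    have "t \<notin> {0..<\<tau>}"
    proof
      assume "t \<in> {0..<\<tau>}"
      from that(2)[OF this] n show False by simp
    qed
    then have "t = \<tau>" using that(3) by auto
    have "continuous_on {0..\<tau>} f" using that(1) \<tau> by (auto intro: continuous_on_subset)
    then have "(f \<longlongrightarrow> f \<tau>) (at \<tau> within {0..\<tau>})" using \<tau> by (simp add: continuous_on_def)
    then have "(f \<longlongrightarrow> f \<tau>) (at_left \<tau>)"
      using \<tau> by (simp add: at_within_Icc_at_left)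
    moreover have "\<forall>\<^sub>F x in at_left \<tau>. 0 \<le> f x"
      using that(2) \<tau> by (auto simp: eventually_at_left_field intro!: exI[of _ 0] less_imp_le)
    ultimately have "0 \<le> f \<tau>" using tendsto_lowerbound trivial_limit_at_left_real by blast
    then show False using n \<open>t = \<tau>\<close> by simp
  qed
  have Q0: "Q s \<ge> 0" if "s \<in> {0..\<tau>}" for s
    using lim[OF cont_QgE(1) _ that] pos by blast
  then show "Q t \<ge> 0" using t .
  show "w t \<ge> 0" "P t \<ge> 0"
    using lim[OF cont(3) _ t] lim[OF cont(2) _ t] pos by blast+
  have den: "1 + s * q s > 0" if "s \<in> {0..\<tau>}" for s
  proof -
    have "(2 - s) * (1 + s * q s) = 1 + Q s" by (simp add: Q_def algebra_simps)
    then have "(2 - s) * (1 + s * q s) > 0" using Q0[OF that] by simp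
    moreover have "2 - s > 0" using that \<tau> T by auto
    ultimately show ?thesis by (simp add: zero_less_mult_iff)
  qed
  \<comment> \<open>(1 - Q) / (1 + Q) times (2 - s) / s, the square of tan (f / 2) / tan (r / 2):
    the factors s and 2 - s cancel, and the quotient is regular at the pole.\<close>
  let ?Y = "\<lambda>s. (1 - (2 - s) * q s) / (1 + s * q s)"
  have "?Y 0 \<le> ?Y t"
  proof (rule nondecreasing_open[of 0 t ?Y "\<lambda>s. 2 * P s * w s / (1 + s * q s)\<^sup>2"])
    show "0 \<le> t" using t by simp
    have ne: "\<forall>s\<in>{0..t}. 1 + s * q s \<noteq> 0" using den t by (metis atLeastAtMost_iff less_irrefl order_trans)
    have "continuous_on {0..t} q" using t \<tau> by (intro cs) auto
    then show "continuous_on {0..t} ?Y" by (intro continuous_intros ne)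
    fix s assume s: "0 < s" "s < t"
    then have s': "s \<in> {0<..<T}" "s \<in> {0..\<tau>}" "s \<in> {0..<\<tau>}" using t \<tau> by auto
    have ne: "1 + s * q s \<noteq> 0" using den[OF s'(2)] by simp
    let ?q' = "F_q s (q s) (P s) (w s)"
    have "(?Y has_real_derivative ((q s - (2 - s) * ?q') * (1 + s * q s) - (1 - (2 - s) * q s) * (q s + s * ?q')) / (1 + s * q s)\<^sup>2) (at s)"
      by (rule derivative_eq_intros q_deriv[OF s'(1)] ne refl)+ (simp add: power2_eq_square algebra_simps)
    moreover have "(q s - (2 - s) * ?q') * (1 + s * q s) - (1 - (2 - s) * q s) * (q s + s * ?q') = 2 * P s * w s"
      by (simp add: F_q_def power2_eq_square algebra_simps)
    ultimately show "(?Y has_real_derivative 2 * P s * w s / (1 + s * q s)\<^sup>2) (at s)" by simp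
    show "0 \<le> 2 * P s * w s / (1 + s * q s)\<^sup>2" using bspec[OF pos s'(3)] by simp
  qed
  moreover have "?Y 0 = a\<^sup>2" by (simp add: init field_simps)
  ultimately have "a\<^sup>2 \<le> ?Y t" by simp
  then have 1: "a\<^sup>2 * (1 + t * q t) \<le> 1 - (2 - t) * q t"
    using den[OF t] by (simp add: pos_le_divide_eq)
  have t2: "0 \<le> t" "t \<le> 1" using t \<tau> T by auto
  have "(2 - t) * (1 + t * q t) = 1 + Q t" by (simp add: Q_def algebra_simps)
  then have "1 \<le> (2 - t) * (1 + t * q t)" using Q0[OF t] by simp
  also have "\<dots> \<le> 2 * (1 + t * q t)" using t2 den[OF t] by (intro mult_right_mono) auto
  finally have "a\<^sup>2 * (1 / 2) \<le> a\<^sup>2 * (1 + t * q t)" by (intro mult_left_mono) auto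
  with 1 have "a\<^sup>2 / 2 \<le> 1 - (2 - t) * q t" by simp
  from mult_left_mono[OF this t2(1)]
  show "1 - Q t \<ge> t * a\<^sup>2 / 2" by (simp add: Q_def algebra_simps)
qed

text \<open>Half of 4 \<beta> / (3 + 2 \<beta>): here 4 \<beta> is the coefficient in E', (3 + 2
  \<beta>) g^2 bounds N while g^2 \<ge> P^2 \<ge> 2, and the half compensates the derivative of the
  square of 1 - Q.\<close>

definition "c0 = 2 * \<beta> / (3 + 2 * \<beta>)"

lemma c0_pos: "c0 > 0" using \<beta> by (simp add: c0_def)

text \<open>E - c0 (1 - Q)^2 is nondecreasing. The assumption a \<ge> 3 gives P^2 \<ge> 9/4, which
  absorbs the constant 2 in N, and 2 t \<le> 1 - Q, so that 1 - t - Q is at least half of 1 - Q. The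
  strict signs of P and w are recovered at the endpoint, which closes a continuation
  argument.\<close>

lemma first_quarter_turn:
  assumes \<tau>: "0 < \<tau>" "\<tau> \<le> T" and pos: "\<forall>t\<in>{0..<\<tau>}. w t > 0 \<and> P t > 0 \<and> Q t > 0"
    and a3: "a \<ge> 3"
  shows "P \<tau> > 0" "w \<tau> > 0" "E \<tau> \<ge> 1 + c0 * (1 - Q \<tau>)\<^sup>2"
proof -
  note tr = tan_ratio_ge[OF \<tau> pos]
  have a9: "a\<^sup>2 \<ge> 9" using power_mono[OF a3, of 2] by simp
  have P2: "(P t)\<^sup>2 \<ge> 9 / 4" if t: "0 < t" "t \<le> \<tau>" for t
  proof -
    have t': "t \<in> {0..\<tau>}" "t \<in> {0..T}" "t \<le> 1" using t \<tau> T by auto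
    have "t * 9 / 2 \<le> t * a\<^sup>2 / 2" using a9 t by simp
    also have "\<dots> \<le> (1 - Q t) * 1" using tr(1)[OF t'(1)] by simp
    also have "\<dots> \<le> (1 - Q t) * (1 + Q t)"
      using tr(2)[OF t'(1)] Q_le_1[OF t'(2)] by (intro mult_left_mono) auto
    also have "\<dots> = t * (2 - t) * (P t)\<^sup>2"
      using unit[OF t'(2)] by (simp add: power2_eq_square algebra_simps)
    also have "\<dots> \<le> t * 2 * (P t)\<^sup>2" using t by (intro mult_right_mono mult_left_mono) auto
    finally show ?thesis using t(1) by simp
  qed
  let ?e = "\<lambda>t. 4 * \<beta> * (g t)\<^sup>2 * ((1 - t) * ((g t)\<^sup>2 + (P t)\<^sup>2) - 2 * g t * P t * Q t) / N t"
  let ?F = "\<lambda>t. E t - c0 * (1 - Q t)\<^sup>2"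
  have "?F 0 \<le> ?F \<tau>"
  proof (rule nondecreasing_open[of 0 \<tau> ?F "\<lambda>t. ?e t - 2 * c0 * (1 - Q t) * (P t * g t)"])
    have "continuous_on {0..\<tau>} E" "continuous_on {0..\<tau>} Q" using \<tau> by (intro cs; simp)+
    then show "continuous_on {0..\<tau>} ?F" by (intro continuous_intros)
    fix t assume t: "0 < t" "t < \<tau>"
    then have t': "t \<in> {0<..<T}" "t \<in> {0..\<tau>}" "t \<in> {0..<\<tau>}" "t \<in> {0..T}" "t < 1" using \<tau> T by auto
    show "(?F has_real_derivative ?e t - 2 * c0 * (1 - Q t) * (P t * g t)) (at t)"
      by (rule derivative_eq_intros E_deriv[OF t'(1)] Q_deriv[OF t'(1)] refl)+ (simp add: algebra_simps)
    have p: "P t > 0" "w t > 0" using bspec[OF pos t'(3)] by auto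
    have "0 \<le> t * (2 - t) * w t" using t t' p by simp
    then have gP: "P t \<le> g t" by (simp add: g_def)
    then have g2: "(P t)\<^sup>2 \<le> (g t)\<^sup>2" using p by (intro power_mono) auto
    have g0: "0 < g t" using gP p by simp
    have N: "N t \<le> (3 + 2 * \<beta>) * (g t)\<^sup>2"
      using g2 P2[of t] t by (simp add: N_def algebra_simps)
    have Qb: "0 \<le> 1 - Q t" using Q_le_1[OF t'(4)] by simp
    have "2 * t \<le> t * a\<^sup>2 / 2" using a9 t mult_left_mono[OF a9, of t] by simp
    then have "2 * t \<le> 1 - Q t" using tr(1)[OF t'(2)] by simp
    then have z: "(1 - Q t) / 2 \<le> 1 - t - Q t" by simp
    have "g t * P t * (1 - Q t) = 2 * (g t * P t) * ((1 - Q t) / 2)" by simp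
    also have "\<dots> \<le> 2 * (g t * P t) * (1 - t - Q t)"
      using z g0 p by (intro mult_left_mono) auto
    also have "\<dots> = (1 - t) * (2 * g t * P t) - 2 * g t * P t * Q t" by (simp add: algebra_simps)
    also have "\<dots> \<le> (1 - t) * ((g t)\<^sup>2 + (P t)\<^sup>2) - 2 * g t * P t * Q t"
      using t' sum_squares_bound[of "g t" "P t"] by (intro diff_right_mono mult_left_mono) auto
    finally have "4 * \<beta> * (g t)\<^sup>2 * (g t * P t * (1 - Q t)) \<le> 4 * \<beta> * (g t)\<^sup>2 * ((1 - t) * ((g t)\<^sup>2 + (P t)\<^sup>2) - 2 * g t * P t * Q t)"
      using \<beta> by (intro mult_left_mono) auto
    then have 1: "4 * \<beta> * (g t)\<^sup>2 * (g t * P t * (1 - Q t)) / N t \<le> ?e t"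
      using N_pos(2)[of t] by (intro divide_right_mono) auto
    have "4 * \<beta> * (g t)\<^sup>2 * (g t * P t * (1 - Q t)) / ((3 + 2 * \<beta>) * (g t)\<^sup>2) \<le> 4 * \<beta> * (g t)\<^sup>2 * (g t * P t * (1 - Q t)) / N t"
    proof (rule divide_left_mono[OF N])
      show "0 \<le> 4 * \<beta> * (g t)\<^sup>2 * (g t * P t * (1 - Q t))"
        using \<beta> g0 p Qb by (intro mult_nonneg_nonneg) auto
      show "0 < (3 + 2 * \<beta>) * (g t)\<^sup>2 * N t"
        using \<beta> g0 N_pos(2)[of t] by (intro mult_pos_pos) auto
    qed
    moreover have "4 * \<beta> * (g t)\<^sup>2 * (g t * P t * (1 - Q t)) / ((3 + 2 * \<beta>) * (g t)\<^sup>2) = 2 * c0 * (1 - Q t) * (P t * g t)"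
      using g0 by (simp add: c0_def)
    ultimately show "0 \<le> ?e t - 2 * c0 * (1 - Q t) * (P t * g t)" using 1 by linarith
  qed (use \<tau> in auto)
  moreover have "?F 0 = 1" by (simp add: E_0) (simp add: Q_def)
  ultimately show E: "E \<tau> \<ge> 1 + c0 * (1 - Q \<tau>)\<^sup>2" by linarith
  have \<tau>': "\<tau> \<in> {0..\<tau>}" "\<tau> \<in> {0..T}" "\<tau> \<le> 1" using \<tau> T by auto
  have "0 < \<tau> * a\<^sup>2 / 2" using \<tau> a by simp
  then have "1 - Q \<tau> > 0" using tr(1)[OF \<tau>'(1)] by linarith
  then have "c0 * (1 - Q \<tau>)\<^sup>2 > 0" using c0_pos by simp
  \<comment> \<open>Subtracting the constraint from E > 1 leaves g^2 > P^2. Since g = P + t (2 - t)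
    w, this excludes w = 0.\<close>
  then have "E \<tau> > 1" using E by linarith
  then have "\<tau> * (2 - \<tau>) * (g \<tau>)\<^sup>2 > \<tau> * (2 - \<tau>) * (P \<tau>)\<^sup>2"
    using unit[OF \<tau>'(2)] by (simp add: E_def)
  moreover have k: "\<tau> * (2 - \<tau>) > 0" using \<tau> \<tau>'(3) by simp
  ultimately have gp: "(g \<tau>)\<^sup>2 > (P \<tau>)\<^sup>2" by (simp only: mult_less_cancel_left_pos)
  show "P \<tau> > 0"
    using P2[of \<tau>] \<tau> tr(4)[OF \<tau>'(1)] by (cases "P \<tau> = 0") auto
  then show "w \<tau> > 0"
    using gp k tr(3)[OF \<tau>'(1)] by (cases "w \<tau> = 0") (auto simp: g_def)
qed

text \<open>At the first point where one of w, P, Q stops being positive, w and P are still positive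
  by the previous lemma; so Q vanishes. Such a point exists and is at most 2 / a^2, because 1 - Q
  \<ge> t a^2 / 2 until then.\<close>

lemma first_zero_of_Q:
  assumes a3: "a \<ge> 3" and T1: "T = 1"
  obtains t1 where "0 < t1" "t1 < 1" "t1 \<le> 2 / a\<^sup>2" "Q t1 = 0" "E t1 \<ge> 1 + c0" "\<And>t. t \<in> {0..t1} \<Longrightarrow> g t > 0"
proof -
  define S where "S = {t\<in>{0..1}. w t \<le> 0} \<union> {t\<in>{0..1}. P t \<le> 0} \<union> {t\<in>{0..1}. Q t \<le> 0}"
  have cl: "closed {t\<in>{0..1}. f t \<le> 0}" if "continuous_on {0..T} f" for f :: "real \<Rightarrow> real"
  proof -
    have "{t\<in>{0..1}. f t \<le> 0} = {0..T} \<inter> f -` {..0}" using T1 by auto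
    then show ?thesis using continuous_closed_preimage[OF that closed_atLeastAtMost] by simp
  qed
  have "closed S" unfolding S_def by (intro closed_Un cl cont cont_QgE)
  moreover have "bounded S" by (rule bounded_subset[of "{0..1::real}"]) (auto simp: S_def)
  ultimately have comp: "compact S" by (simp add: compact_eq_bounded_closed)
  have a9: "a\<^sup>2 \<ge> 9" using power_mono[OF a3, of 2] by simp
  have notS: "w t > 0 \<and> P t > 0 \<and> Q t > 0" if "t \<in> {0..1}" "t \<notin> S" for t
    using that by (simp add: S_def not_le)
  have ne: "S \<noteq> {}"
  proof
    assume "S = {}"
    then have pos: "w t > 0 \<and> P t > 0 \<and> Q t > 0" if "t \<in> {0..1}" for t
      using notS[OF that] by simp
    have "1 - Q 1 \<ge> 1 * a\<^sup>2 / 2" by (rule tan_ratio_ge(1)[of 1]) (use pos T1 in auto)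
    then show False using pos[of 1] a9 by simp
  qed
  obtain t1 where t1: "t1 \<in> S" "\<And>t. t \<in> S \<Longrightarrow> t1 \<le> t"
    using compact_attains_inf[OF comp ne] by blast
  have pos: "\<forall>t\<in>{0..<t1}. w t > 0 \<and> P t > 0 \<and> Q t > 0"
  proof
    fix t assume that: "t \<in> {0..<t1}"
    have "t1 \<le> 1" using t1(1) by (auto simp: S_def)
    then have "t \<in> {0..1}" "t \<notin> S" using that t1(2)[of t] by auto
    then show "w t > 0 \<and> P t > 0 \<and> Q t > 0" by (rule notS)
  qed
  \<comment> \<open>At the pole Phi reduces to its B term, which has the sign of - q 0, and q 0 < 0
    because a > 1.\<close>
  have "w 0 > 0"
  proof -
    have "q 0 < 0" using a9 by (simp add: init)
    have "w 0 = \<beta> * (- q 0) * a^3 * 4 / (Den \<beta> 0 a 0 * 4)"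
      unfolding init(3) Phi_def Bfun_def by (simp add: gfun_def init(2) power3_eq_cube)
    also have "\<dots> > 0" using \<open>q 0 < 0\<close> a \<beta> Den_pos[of \<beta> 0 a 0]
      by (intro divide_pos_pos mult_pos_pos) auto
    finally show ?thesis .
  qed
  moreover have "P 0 > 0" "Q 0 > 0" using a by (auto simp: init Q_def)
  ultimately have "0 \<notin> S" by (auto simp: S_def)
  then have t10: "0 < t1" "t1 \<le> 1" using t1(1) by (auto simp: S_def order.order_iff_strict)
  have t1T: "t1 \<le> T" using t10 T1 by simp
  note fq = first_quarter_turn[OF t10(1) t1T pos a3]
  note tr = tan_ratio_ge[OF t10(1) t1T pos]
  have "Q t1 \<le> 0" using t1(1) fq(1,2) by (auto simp: S_def)
  then have Q0: "Q t1 = 0" using tr(2)[of t1] t10 by simp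
  have "t1 * a\<^sup>2 \<le> 2" using tr(1)[of t1] t10 Q0 by simp
  then have t1a: "t1 \<le> 2 / a\<^sup>2" using a by (simp add: pos_le_divide_eq)
  moreover have "2 / a\<^sup>2 \<le> 2 / 9" using a9 by (intro divide_left_mono) auto
  ultimately have "t1 < 1" by simp
  moreover have "g t > 0" if "t \<in> {0..t1}" for t
  proof (cases "t = t1")
    case True
    then show ?thesis using fq(1,2) t10 by (simp add: g_def add_pos_nonneg)
  next
    case False
    then have "w t > 0 \<and> P t > 0" using pos that by auto
    moreover have "t * (2 - t) \<ge> 0" using that t10 by simp
    ultimately show ?thesis by (simp add: g_def add_pos_nonneg)
  qed
  moreover have "E t1 \<ge> 1 + c0" using fq(3) Q0 by simp
  ultimately show thesis using that[of t1] t10(1) t1a Q0 by blast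
qed

end

section \<open>The angle and its growth for large slope\<close>

context pole_solution begin

text \<open>The profile f itself, recovered from f' so that no branch of an inverse trigonometric
  function has to be chosen.\<close>

definition angle :: "real \<Rightarrow> real" where
  "angle r = integral {0..r} (\<lambda>\<rho>. g (1 - cos \<rho>))"

context
  assumes T1: "T = 1"
begin

lemma one_minus_cos: "r \<in> {0..pi/2} \<Longrightarrow> 1 - cos r \<in> {0..T}"
  using T1 by (auto intro!: cos_ge_zero)

lemma one_minus_cos_open: "r \<in> {0<..<pi/2} \<Longrightarrow> 1 - cos r \<in> {0<..<T}"
  using T1 cos_gt_zero[of r] cos_monotone_0_pi[of 0 r] by auto

lemma sin_square: "(1 - cos r) * (2 - (1 - cos r)) = (sin r)\<^sup>2" for r :: real
  by (simp add: sin_squared_eq power2_eq_square algebra_simps)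

lemma cont_cos: "continuous_on {0..T} h \<Longrightarrow> continuous_on {0..pi/2} (\<lambda>r. h (1 - cos r))" for h :: "real \<Rightarrow> real"
  by (rule continuous_on_compose2[of "{0..T}" h]) (use one_minus_cos in \<open>auto intro!: continuous_intros\<close>)

lemma cont_angle: "continuous_on {0..pi/2} angle"
  unfolding angle_def [abs_def]
  by (intro indefinite_integral_continuous_1 integrable_continuous_real cont_cos cont_QgE)

lemma angle_0: "angle 0 = 0" by (simp add: angle_def)

lemma angle_deriv:
  assumes "r \<in> {0<..<pi/2}"
  shows "(angle has_real_derivative g (1 - cos r)) (at r)"
proof -
  have "(angle has_real_derivative g (1 - cos r)) (at r within {0..pi/2})"
    unfolding angle_def [abs_def]
    by (rule integral_has_real_derivative[OF cont_cos[OF cont_QgE(2)]]) (use assms in auto)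
  then have "(angle has_real_derivative g (1 - cos r)) (at r within {0<..<pi/2})"
    by (rule DERIV_subset) auto
  then show ?thesis using assms by (simp add: at_within_open[of r "{0<..<pi/2}"])
qed

text \<open>The vectors (sin r P, Q) and (sin angle, cos angle) turn with the same speed g, so their
  inner product \<open>?D\<close> keeps its initial value 1. Unit vectors with inner product 1
  coincide.\<close>

lemma angle_sin_cos:
  assumes "r \<in> {0..pi/2}"
  shows "sin (angle r) = sin r * P (1 - cos r)" "cos (angle r) = Q (1 - cos r)"
proof -
  let ?X = "\<lambda>r. sin r * P (1 - cos r)" and ?Y = "\<lambda>r. Q (1 - cos r)"
  let ?D = "\<lambda>r. ?X r * sin (angle r) + ?Y r * cos (angle r)"
  have D: "?D r = ?D 0" if "r \<in> {0..pi/2}" "r > 0" for r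
  proof (rule DERIV_isconst_end[of 0 r ?D])
    show "0 < r" using that by simp
    have "continuous_on {0..pi/2} ?D"
      by (intro continuous_intros cont_cos cont cont_QgE cont_angle)
    then show "continuous_on {0..r} ?D" using that by (auto intro: continuous_on_subset)
    fix s assume "0 < s" "s < r"
    then have s: "s \<in> {0<..<pi/2}" using that by auto
    let ?t = "1 - cos s"
    have c: "((\<lambda>r. 1 - cos r) has_real_derivative sin s) (at s)" by (auto intro!: derivative_eq_intros)
    have Q': "(?Y has_real_derivative - (P ?t * g ?t) * sin s) (at s)"
      by (rule DERIV_chain2[where f=Q and g="\<lambda>r. 1 - cos r", OF Q_deriv[OF one_minus_cos_open[OF s]] c])
    have P': "((\<lambda>r. P (1 - cos r)) has_real_derivative F_P ?t (q ?t) (P ?t) (w ?t) * sin s) (at s)"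
      by (rule DERIV_chain2[where f=P and g="\<lambda>r. 1 - cos r", OF P_deriv[OF one_minus_cos_open[OF s]] c])
    have X': "(?X has_real_derivative Q ?t * g ?t) (at s)"
    proof (rule DERIV_cong[OF DERIV_mult[OF DERIV_sin P']])
      have "F_P ?t (q ?t) (P ?t) (w ?t) * sin s * sin s = (?t * (2 - ?t)) * F_P ?t (q ?t) (P ?t) (w ?t)"
        unfolding sin_square by (simp add: power2_eq_square)
      then show "cos s * P ?t + F_P ?t (q ?t) (P ?t) (w ?t) * sin s * sin s = Q ?t * g ?t"
        unfolding P_flow by simp
    qed
    have "(?D has_real_derivative (Q ?t * g ?t * sin (angle s) + cos (angle s) * g ?t * ?X s)
      + (- (P ?t * g ?t) * sin s * cos (angle s) + - sin (angle s) * g ?t * ?Y s)) (at s)"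
      by (rule derivative_eq_intros X' Q' angle_deriv[OF s] refl)+
    then show "(?D has_real_derivative 0) (at s)" by (rule DERIV_cong) (simp add: algebra_simps)
  qed
  have "?D 0 = 1" by (simp add: angle_0 Q_def)
  then have D1: "?D r = 1" using D[of r] assms by (cases "r = 0") auto
  have "(?X r)\<^sup>2 + (?Y r)\<^sup>2 = 1"
    using unit[OF one_minus_cos[OF assms]] unfolding sin_square by (simp add: power_mult_distrib)
  then have "(?X r - sin (angle r))\<^sup>2 + (?Y r - cos (angle r))\<^sup>2 = 0"
    using D1 sin_cos_squared_add[of "angle r"] by (simp add: power2_diff algebra_simps)
  then show "sin (angle r) = ?X r" "cos (angle r) = ?Y r"
    by (simp_all add: sum_power2_eq_zero_iff)
qed

text \<open>From t1 to \<eta>, E \<ge> 1 + c0 / 2 and Q^2 \<le> 1 give (sin r g)^2 \<ge> c0 / 2, so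
  f has at least the speed sqrt (c0 / 2) in the variable log tan (r / 2). That variable is replaced
  by half of ln (1 - cos r), whose derivative is smaller. As t1 \<le> 2 / a^2, the available length
  grows like log a.\<close>

lemma angle_growth:
  assumes a3: "a \<ge> 3" and \<eta>: "0 < \<eta>" "\<eta> < 1" "2 / a\<^sup>2 \<le> \<eta>" "(1 + c0) * exp (- 4 * \<beta> * \<eta>) \<ge> 1 + c0 / 2"
  shows "angle (arccos (1 - \<eta>)) \<ge> sqrt (c0 / 2) / 2 * ln (\<eta> * a\<^sup>2 / 2)"
proof -
  obtain t1 where t1: "0 < t1" "t1 < 1" "t1 \<le> 2 / a\<^sup>2" "Q t1 = 0" "E t1 \<ge> 1 + c0" "\<And>t. t \<in> {0..t1} \<Longrightarrow> g t > 0"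
    using first_zero_of_Q[OF a3 T1] by blast
  have t1\<eta>: "t1 \<le> \<eta>" using t1(3) \<eta>(3) by simp
  have k: "t * (2 - t) * (g t)\<^sup>2 \<ge> c0 / 2 \<and> g t \<noteq> 0" if t: "t1 \<le> t" "t \<le> \<eta>" for t
  proof -
    have tT: "t \<in> {0..T}" using t t1 \<eta> T1 by auto
    have "exp (- 4 * \<beta> * \<eta>) \<le> exp (- 4 * \<beta> * (t - t1))"
    proof -
      have "\<beta> * (t - t1) \<le> \<beta> * \<eta>" using \<beta> t t1 by (intro mult_left_mono) auto
      then show ?thesis by simp
    qed
    then have "(1 + c0) * exp (- 4 * \<beta> * \<eta>) \<le> E t1 * exp (- 4 * \<beta> * (t - t1))"
      using t1(5) c0_pos by (intro mult_mono) auto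
    also have "\<dots> \<le> E t" using E_lower[of t1 t] t1 t tT by auto
    finally have "E t \<ge> 1 + c0 / 2" using \<eta>(4) by linarith
    moreover have "(Q t)\<^sup>2 \<le> 1" using Q_le_1[OF tT] by (simp add: abs_square_le_1)
    ultimately have 1: "t * (2 - t) * (g t)\<^sup>2 \<ge> c0 / 2" by (simp add: E_def)
    then show ?thesis using c0_pos by auto
  qed
  \<comment> \<open>g has no zero between t1 and \<eta> and is positive at t1.\<close>
  have gpos: "g t > 0" if t: "t1 \<le> t" "t \<le> \<eta>" for t
  proof (rule ccontr)
    assume "\<not> g t > 0"
    then have "g t \<le> 0" "0 \<le> g t1" using t1(6)[of t1] t1(1) by auto
    moreover have "continuous_on {t1..t} g" using t t1 \<eta> T1 by (intro cs) auto
    ultimately obtain x where "t1 \<le> x" "x \<le> t" "g x = 0" using IVT2'[of g t 0 t1] t by auto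
    then show False using k[of x] t by auto
  qed
  let ?k = "sqrt (c0 / 2) / 2"
  let ?r1 = "arccos (1 - t1)" and ?r2 = "arccos (1 - \<eta>)"
  have r: "0 < ?r1" "?r1 \<le> ?r2" "?r2 < pi / 2"
  proof -
    show "0 < ?r1" using arccos_less_arccos[of "1 - t1" 1] t1 by simp
    show "?r1 \<le> ?r2" using arccos_le_arccos[of "1 - \<eta>" "1 - t1"] t1\<eta> \<eta> t1 by simp
    show "?r2 < pi / 2" using arccos_less_arccos[of 0 "1 - \<eta>"] \<eta> by simp
  qed
  have cosr: "cos ?r1 = 1 - t1" "cos ?r2 = 1 - \<eta>" using t1 \<eta> by (auto intro!: cos_arccos)
  have a1: "angle ?r1 \<ge> 0"
  proof -
    have "angle 0 \<le> angle ?r1"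
    proof (rule nondecreasing_open[of 0 ?r1 angle "\<lambda>r. g (1 - cos r)"])
      show "continuous_on {0..?r1} angle" using r by (intro continuous_on_subset[OF cont_angle]) auto
      fix s assume s: "0 < s" "s < ?r1"
      then show "(angle has_real_derivative g (1 - cos s)) (at s)" using r by (intro angle_deriv) auto
      have "cos ?r1 < cos s" using s r by (intro cos_monotone_0_pi) auto
      then have "1 - cos s \<in> {0..t1}" using cosr by simp
      then show "0 \<le> g (1 - cos s)" using t1(6) less_imp_le by blast
    qed (use r in auto)
    then show ?thesis by (simp add: angle_0)
  qed
  let ?F = "\<lambda>r. angle r - ?k * ln (1 - cos r)"
  have "?F ?r1 \<le> ?F ?r2"
  proof (rule nondecreasing_open[of ?r1 ?r2 ?F "\<lambda>r. g (1 - cos r) - ?k * (sin r / (1 - cos r))"])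
    show "?r1 \<le> ?r2" by (rule r)
    have pos: "1 - cos s > 0" if "s \<in> {?r1..?r2}" for s
      using that r cos_monotone_0_pi[of 0 s] by simp
    show "continuous_on {?r1..?r2} ?F"
      using r pos by (intro continuous_intros continuous_on_subset[OF cont_angle]) force+
    fix s assume s: "?r1 < s" "s < ?r2"
    then have s': "s \<in> {0<..<pi/2}" "1 - cos s > 0" using r pos[of s] by auto
    show "(?F has_real_derivative g (1 - cos s) - ?k * (sin s / (1 - cos s))) (at s)"
    proof -
      have "((\<lambda>r. ln (1 - cos r)) has_real_derivative sin s / (1 - cos s)) (at s)"
        using s'(2) by (auto intro!: derivative_eq_intros)
      from DERIV_diff[OF angle_deriv[OF s'(1)] DERIV_cmult[OF this, of ?k]] show ?thesis .
    qed
    have "cos s < cos ?r1" "cos ?r2 < cos s" using s r by (auto intro!: cos_monotone_0_pi)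
    then have t: "t1 \<le> 1 - cos s" "1 - cos s \<le> \<eta>" using cosr by auto
    let ?t = "1 - cos s"
    have sp: "sin s > 0" using s' by (auto intro!: sin_gt_zero)
    have "(sqrt (c0 / 2))\<^sup>2 \<le> (sin s * g ?t)\<^sup>2"
      using k[OF t] c0_pos unfolding sin_square by (simp add: power_mult_distrib)
    then have 1: "sqrt (c0 / 2) \<le> sin s * g ?t"
      by (rule power2_le_imp_le) (use sp gpos[OF t] in simp)
    have "?t * (2 - ?t) \<le> ?t * 2" using s'(2) by (intro mult_left_mono) auto
    then have "(sin s)\<^sup>2 \<le> 2 * ?t" unfolding sin_square by simp
    then have "sin s / ?t * sin s \<le> 2" using s'(2) by (simp add: pos_divide_le_eq power2_eq_square)
    then have "sqrt (c0 / 2) / 2 * (sin s / ?t * sin s) \<le> sqrt (c0 / 2) / 2 * 2"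
      using c0_pos by (intro mult_left_mono) auto
    then have "?k * (sin s / ?t) * sin s \<le> sqrt (c0 / 2)" by (simp add: mult.assoc)
    also have "\<dots> \<le> g ?t * sin s" using 1 by (simp add: mult.commute)
    finally have "?k * (sin s / ?t) \<le> g ?t" using sp by (simp only: mult_le_cancel_right_pos)
    then show "0 \<le> g ?t - ?k * (sin s / ?t)" by simp
  qed
  then have "?k * (ln \<eta> - ln t1) \<le> angle ?r2"
    using a1 cosr by (simp add: algebra_simps)
  moreover have "ln (\<eta> * a\<^sup>2 / 2) \<le> ln \<eta> - ln t1"
  proof -
    have "\<eta> * a\<^sup>2 / 2 \<le> \<eta> / t1"
      using t1(1,3) \<eta>(1) a by (simp add: field_simps)
    then have "ln (\<eta> * a\<^sup>2 / 2) \<le> ln (\<eta> / t1)" using \<eta>(1) a t1(1) by simp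
    then show ?thesis using \<eta>(1) t1(1) by (simp add: ln_div)
  qed
  then have "?k * ln (\<eta> * a\<^sup>2 / 2) \<le> ?k * (ln \<eta> - ln t1)" using c0_pos by (intro mult_left_mono) auto
  ultimately show ?thesis by linarith
qed

end

end

lemma large_slope_threshold:
  assumes "\<beta> > 0"
  obtains A where "A \<ge> 3" "\<And>q P w. pole_solution \<beta> A 1 q P w \<Longrightarrow> \<exists>r\<in>{0..pi/2}. pole_solution.angle P w r \<ge> 3 * pi / 2"
proof -
  define c where "c = 2 * \<beta> / (3 + 2 * \<beta>)"
  have c: "c > 0" using assms by (simp add: c_def)
  \<comment> \<open>Makes exp (4 \<beta> \<eta>) \<le> (1 + c) / (1 + c / 2): the loss of energy up
    to t = \<eta> costs at most half of the gain c.\<close>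
  define \<eta> where "\<eta> = min (1/2) (ln ((1 + c) / (1 + c / 2)) / (4 * \<beta>))"
  have r: "(1 + c) / (1 + c / 2) > 1" using c by simp
  have \<eta>: "0 < \<eta>" "\<eta> < 1" using r assms by (auto simp: \<eta>_def)
  have "4 * \<beta> * \<eta> \<le> ln ((1 + c) / (1 + c / 2))"
    using assms by (simp add: \<eta>_def min_def field_simps)
  then have "exp (4 * \<beta> * \<eta>) \<le> (1 + c) / (1 + c / 2)" using r by (simp add: ln_ge_iff)
  then have "(1 + c / 2) * exp (4 * \<beta> * \<eta>) \<le> 1 + c" using c by (simp add: field_simps)
  then have \<eta>4: "(1 + c) * exp (- 4 * \<beta> * \<eta>) \<ge> 1 + c / 2"
    by (simp add: exp_minus field_simps)
  define k where "k = sqrt (c / 2) / 2"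
  have k: "k > 0" using c by (simp add: k_def)
  \<comment> \<open>Large enough for k ln (\<eta> A^2 / 2) \<ge> 3 pi / 2.\<close>
  define A where "A = max 3 (sqrt (2 / \<eta> * exp (3 * pi / 2 / k)))"
  have A3: "A \<ge> 3" by (simp add: A_def)
  have "2 / \<eta> * exp (3 * pi / 2 / k) = (sqrt (2 / \<eta> * exp (3 * pi / 2 / k)))\<^sup>2"
    using \<eta> by (subst real_sqrt_pow2) auto
  also have "\<dots> \<le> A\<^sup>2" using \<eta> by (intro power_mono) (auto simp: A_def)
  finally have A2: "exp (3 * pi / 2 / k) \<le> \<eta> * A\<^sup>2 / 2" using \<eta> by (simp add: field_simps)
  have "1 \<le> exp (3 * pi / 2 / k)" using k by simp
  with A2 have "1 \<le> \<eta> * A\<^sup>2 / 2" by linarith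
  then have \<eta>3: "2 / A\<^sup>2 \<le> \<eta>" using A3 by (simp add: field_simps)
  have ln: "3 * pi / 2 / k \<le> ln (\<eta> * A\<^sup>2 / 2)"
    using A2 \<eta> A3 by (subst ln_ge_iff) auto
  show thesis
  proof (rule that[OF A3])
    fix q P w assume "pole_solution \<beta> A 1 q P w"
    then interpret pole_solution \<beta> A 1 q P w .
    have "c0 = c" by (simp add: c0_def c_def)
    then have "k * ln (\<eta> * A\<^sup>2 / 2) \<le> angle (arccos (1 - \<eta>))"
      using angle_growth[OF refl A3 \<eta> \<eta>3] \<eta>4 by (simp add: k_def)
    moreover have "3 * pi / 2 \<le> k * ln (\<eta> * A\<^sup>2 / 2)"
      using ln k by (simp add: pos_divide_le_eq mult.commute)
    moreover have "arccos (1 - \<eta>) \<in> {0..pi/2}"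
      using \<eta> arccos_le_arccos[of 0 "1 - \<eta>"] by (auto intro: arccos_lbound)
    ultimately show "\<exists>r\<in>{0..pi/2}. angle r \<ge> 3 * pi / 2" by (intro bexI[of _ "arccos (1 - \<eta>)"]) auto
  qed
qed

subsection \<open>A priori bounds\<close>

lemma avg_1_at_0: "avg 1 \<phi> 0 = \<phi> 0 / 2"
proof -
  have "((\<lambda>\<tau>::real. \<tau> ^ 1) has_integral (1 ^ 2 / 2) - (0 ^ 2 / 2)) {0..1}"
    by (rule fundamental_theorem_of_calculus)
       (auto simp flip: has_real_derivative_iff_has_vector_derivative intro!: derivative_eq_intros)
  from integral_unique[OF has_integral_mult_left[OF this, of "\<phi> 0"]] show ?thesis
    by (simp add: avg_def)
qed

lemma avg_cong:
  assumes "convex S" "0 \<in> S" "t \<in> S" "\<And>s. s \<in> S \<Longrightarrow> \<phi> s = \<psi> s"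
  shows "avg j \<phi> t = avg j \<psi> t"
  unfolding avg_def
  by (rule Henstock_Kurzweil_Integration.integral_cong) (use scaled_in_interval[OF assms(1-3)] assms(4) in auto)

text \<open>The averages at t involve the solution only between 0 and t. A cutoff may therefore be
  exchanged on any interval around 0 on which both act alike on the solution.\<close>

lemma pole_system_cutoff:
  assumes "pole_system c \<beta> a S q P w" "T \<subseteq> S" "convex T" "0 \<in> T"
    and "\<And>t. t \<in> T \<Longrightarrow> c (q t) = c' (q t) \<and> c (P t) = c' (P t) \<and> c (w t) = c' (w t)"
  shows "pole_system c' \<beta> a T q P w"
  unfolding pole_system_def
proof
  fix t assume t: "t \<in> T"
  note cg = avg_cong[OF assms(3,4) t]
  have "avg 0 (\<lambda>\<sigma>. F_q \<sigma> (c (q \<sigma>)) (c (P \<sigma>)) (c (w \<sigma>))) t = avg 0 (\<lambda>\<sigma>. F_q \<sigma> (c' (q \<sigma>)) (c' (P \<sigma>)) (c' (w \<sigma>))) t"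
    by (rule cg) (use assms(5) in simp)
  moreover have "avg 0 (\<lambda>\<sigma>. F_P \<sigma> (c (q \<sigma>)) (c (P \<sigma>)) (c (w \<sigma>))) t = avg 0 (\<lambda>\<sigma>. F_P \<sigma> (c' (q \<sigma>)) (c' (P \<sigma>)) (c' (w \<sigma>))) t"
    by (rule cg) (use assms(5) in simp)
  moreover have "avg 1 (\<lambda>\<sigma>. Phi \<beta> \<sigma> (c (q \<sigma>)) (c (P \<sigma>)) (\<sigma> * c (w \<sigma>)) (\<sigma> * (c (w \<sigma>))\<^sup>2)) t
    = avg 1 (\<lambda>\<sigma>. Phi \<beta> \<sigma> (c' (q \<sigma>)) (c' (P \<sigma>)) (\<sigma> * c' (w \<sigma>)) (\<sigma> * (c' (w \<sigma>))\<^sup>2)) t"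
    by (rule cg) (use assms(5) in simp)
  ultimately show "q t = (1 - a\<^sup>2) / 2 + t * avg 0 (\<lambda>\<sigma>. F_q \<sigma> (c' (q \<sigma>)) (c' (P \<sigma>)) (c' (w \<sigma>))) t \<and>
     P t = a + t * avg 0 (\<lambda>\<sigma>. F_P \<sigma> (c' (q \<sigma>)) (c' (P \<sigma>)) (c' (w \<sigma>))) t \<and>
     w t = avg 1 (\<lambda>\<sigma>. Phi \<beta> \<sigma> (c' (q \<sigma>)) (c' (P \<sigma>)) (\<sigma> * c' (w \<sigma>)) (\<sigma> * (c' (w \<sigma>))\<^sup>2)) t"
    using assms(1,2) t unfolding pole_system_def by auto
qed

lemma pole_system_derivs:
  assumes "\<beta> \<ge> 0" and J: "open J" "convex J" "0 \<in> J" "J \<subseteq> {..<2}"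
    and c: "continuous_on UNIV c" and qPw: "continuous_on J q" "continuous_on J P" "continuous_on J w"
    and s: "pole_system c \<beta> a J q P w" and t: "t \<in> J"
  shows "(q has_real_derivative F_q t (c (q t)) (c (P t)) (c (w t))) (at t)"
    and "(P has_real_derivative F_P t (c (q t)) (c (P t)) (c (w t))) (at t)"
    and "t \<noteq> 0 \<Longrightarrow> (w has_real_derivative (Phi \<beta> t (c (q t)) (c (P t)) (t * c (w t)) (t * (c (w t))\<^sup>2) - 2 * w t) / t) (at t)"
    and "((\<lambda>t. t * w t) has_real_derivative Phi \<beta> t (c (q t)) (c (P t)) (t * c (w t)) (t * (c (w t))\<^sup>2) - w t) (at t)"
    and "((\<lambda>t. t * (w t)\<^sup>2) has_real_derivative (w t)\<^sup>2 + 2 * w t * (Phi \<beta> t (c (q t)) (c (P t)) (t * c (w t)) (t * (c (w t))\<^sup>2) - 2 * w t)) (at t)"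
proof -
  have cc: "continuous_on J (\<lambda>t. c (f t))" if "continuous_on J f" for f
    by (rule continuous_on_compose2[OF c that]) auto
  let ?q = "\<lambda>\<sigma>. F_q \<sigma> (c (q \<sigma>)) (c (P \<sigma>)) (c (w \<sigma>))" and ?P = "\<lambda>\<sigma>. F_P \<sigma> (c (q \<sigma>)) (c (P \<sigma>)) (c (w \<sigma>))"
  let ?w = "\<lambda>\<sigma>. Phi \<beta> \<sigma> (c (q \<sigma>)) (c (P \<sigma>)) (\<sigma> * c (w \<sigma>)) (\<sigma> * (c (w \<sigma>))\<^sup>2)"
  have cq: "continuous_on J ?q" "continuous_on J ?P"
    unfolding F_q_def F_P_def by (intro continuous_intros cc qPw)+
  have cw: "continuous_on J ?w"
    by (intro continuous_on_Phi continuous_intros cc qPw) (use assms(1) J(4) in auto)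
  have eq: "q t = (1 - a\<^sup>2) / 2 + t * avg 0 ?q t" "P t = a + t * avg 0 ?P t" "w t = avg 1 ?w t" if "t \<in> J" for t
    using s that unfolding pole_system_def by auto
  have "((\<lambda>t. (1 - a\<^sup>2) / 2 + t * avg 0 ?q t) has_real_derivative ?q t) (at t)"
    using DERIV_add[OF DERIV_const avg_0_deriv[OF J(1-3) cq(1) t]] by simp
  then show "(q has_real_derivative ?q t) (at t)"
    by (rule has_field_derivative_transform_within_open[OF _ J(1) t]) (use eq in simp)
  have "((\<lambda>t. a + t * avg 0 ?P t) has_real_derivative ?P t) (at t)"
    using DERIV_add[OF DERIV_const avg_0_deriv[OF J(1-3) cq(2) t]] by simp
  then show "(P has_real_derivative ?P t) (at t)"
    by (rule has_field_derivative_transform_within_open[OF _ J(1) t]) (use eq in simp)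
  note d = avg_1_deriv[OF J(1-3) cw t]
  show "(w has_real_derivative (?w t - 2 * w t) / t) (at t)" if "t \<noteq> 0"
    using has_field_derivative_transform_within_open[OF d(2)[OF that] J(1) t, of w] eq(3) t by simp
  show "((\<lambda>t. t * w t) has_real_derivative ?w t - w t) (at t)"
    using has_field_derivative_transform_within_open[OF d(1) J(1) t, of "\<lambda>t. t * w t"] eq(3) t by simp
  show "((\<lambda>t. t * (w t)\<^sup>2) has_real_derivative (w t)\<^sup>2 + 2 * w t * (?w t - 2 * w t)) (at t)"
    using has_field_derivative_transform_within_open[OF d(3) J(1) t, of "\<lambda>t. t * (w t)\<^sup>2"] eq(3) t by simp
qed

text \<open>The bound is demanded on [0, T) only, so the conclusion is available at the very first
  time at which the cutoff level is reached.\<close>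

lemma pole_flow_of_truncated:
  assumes "\<beta> > 0" "a > 0" "R \<ge> 0" "0 < T" "T < 3/2"
    and qPw: "continuous_on {-1..3/2} q" "continuous_on {-1..3/2} P" "continuous_on {-1..3/2} w"
    and s: "pole_system (clamp_to R) \<beta> a {-1..3/2} q P w"
    and box: "\<And>t. t \<in> {0..<T} \<Longrightarrow> \<bar>q t\<bar> \<le> R \<and> \<bar>P t\<bar> \<le> R \<and> \<bar>w t\<bar> \<le> R"
  shows "pole_flow \<beta> a T q P w"
proof
  let ?J = "{-1<..<3/2::real}"
  have J: "open ?J" "convex ?J" "0 \<in> ?J" "?J \<subseteq> {..<2}" by auto
  have sJ: "pole_system (clamp_to R) \<beta> a ?J q P w"
    by (rule pole_system_cutoff[OF s]) auto
  have cJ: "continuous_on ?J q" "continuous_on ?J P" "continuous_on ?J w"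
    by (rule continuous_on_subset[OF qPw(1)] continuous_on_subset[OF qPw(2)] continuous_on_subset[OF qPw(3)]; force)+
  have cc: "continuous_on UNIV (clamp_to R)"
    by (rule continuous_clamp_to[OF continuous_on_id, unfolded id_def])
  note d = pole_system_derivs[OF less_imp_le[OF assms(1)] J cc cJ sJ]
  have cl: "clamp_to R (q t) = q t" "clamp_to R (P t) = P t" "clamp_to R (w t) = w t" if "t \<in> {0..<T}" for t
    using box[OF that] by (auto intro: clamp_to_id)
  show "continuous_on {0..T} q" "continuous_on {0..T} P" "continuous_on {0..T} w"
    by (rule continuous_on_subset[OF qPw(1)] continuous_on_subset[OF qPw(2)] continuous_on_subset[OF qPw(3)]; use assms in force)+
  have z: "(0::real) \<in> {-1..3/2}" "0 \<in> {0..<T}" using assms by auto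
  show "q 0 = (1 - a\<^sup>2) / 2" "P 0 = a"
    using s z(1) unfolding pole_system_def by auto
  have "w 0 = avg 1 (\<lambda>\<sigma>. Phi \<beta> \<sigma> (clamp_to R (q \<sigma>)) (clamp_to R (P \<sigma>)) (\<sigma> * clamp_to R (w \<sigma>)) (\<sigma> * (clamp_to R (w \<sigma>))\<^sup>2)) 0"
    using s z(1) unfolding pole_system_def by auto
  then show "w 0 = Phi \<beta> 0 (q 0) (P 0) 0 0 / 2"
    unfolding avg_1_at_0 using cl[OF z(2)] by simp
  fix t assume t: "t \<in> {0<..<T}"
  then have t': "t \<in> ?J" "t \<in> {0..<T}" "t \<noteq> 0" using assms by auto
  show "(q has_real_derivative F_q t (q t) (P t) (w t)) (at t)" using d(1)[OF t'(1)] cl[OF t'(2)] by simp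
  show "(P has_real_derivative F_P t (q t) (P t) (w t)) (at t)" using d(2)[OF t'(1)] cl[OF t'(2)] by simp
  show "(w has_real_derivative (Phi \<beta> t (q t) (P t) (t * w t) (t * (w t)\<^sup>2) - 2 * w t) / t) (at t)"
    using d(3)[OF t'(1,3)] cl[OF t'(2)] by simp
qed (use assms in auto)

locale truncated_family =
  fixes \<beta> R A :: real and q P w :: "real \<times> real \<Rightarrow> real"
  assumes \<beta>: "\<beta> > 0" and R: "R \<ge> 0" and A: "A \<ge> 1"
    and cont: "continuous_on ({-1..3/2} \<times> UNIV) q" "continuous_on ({-1..3/2} \<times> UNIV) P" "continuous_on ({-1..3/2} \<times> UNIV) w"
    and sys: "a \<in> {1..A} \<Longrightarrow> pole_system (clamp_to R) \<beta> a {-1..3/2} (\<lambda>t. q (t, a)) (\<lambda>t. P (t, a)) (\<lambda>t. w (t, a))"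
begin

definition "m x = max (max \<bar>q x\<bar> \<bar>P x\<bar>) \<bar>w x\<bar>"

lemma m_less: "m x < b \<longleftrightarrow> \<bar>q x\<bar> < b \<and> \<bar>P x\<bar> < b \<and> \<bar>w x\<bar> < b"
  by (auto simp: m_def)

lemma cont_m: "continuous_on ({-1..3/2} \<times> UNIV) m"
  unfolding m_def by (intro continuous_intros cont)

lemma cont_slice: "continuous_on ({-1..3/2} \<times> UNIV) f \<Longrightarrow> continuous_on {-1..3/2} (\<lambda>t. f (t, a))" for f :: "real \<times> real \<Rightarrow> real"
  by (rule continuous_on_compose2) (auto intro!: continuous_intros)

lemmas cont_slices = cont_slice[OF cont(1)] cont_slice[OF cont(2)] cont_slice[OF cont(3)]

lemma flow:
  assumes "a \<in> {1..A}" "0 < T" "T < 3/2" "\<And>t. t \<in> {0..<T} \<Longrightarrow> m (t, a) < R"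
  shows "pole_flow \<beta> a T (\<lambda>t. q (t, a)) (\<lambda>t. P (t, a)) (\<lambda>t. w (t, a))"
  by (rule pole_flow_of_truncated[OF \<beta> _ R assms(2,3) cont_slices sys[OF assms(1)]])
     (use assms(1,4) in \<open>auto simp: m_less less_imp_le\<close>)

end

lemma truncated_family_exists:
  assumes "\<beta> > 0" "R \<ge> 0" "A \<ge> 1"
  obtains q P w where "truncated_family \<beta> R A q P w"
proof -
  obtain q P w :: "real \<times> real \<Rightarrow> real" where
    "continuous_on ({-1..3/2} \<times> UNIV) q" "continuous_on ({-1..3/2} \<times> UNIV) P" "continuous_on ({-1..3/2} \<times> UNIV) w"
    "\<And>a. a \<in> {0..A} \<Longrightarrow> pole_system (clamp_to R) \<beta> a {-1..3/2} (\<lambda>t. q (t, a)) (\<lambda>t. P (t, a)) (\<lambda>t. w (t, a))"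
    using truncated_solution[of \<beta> R A] assms by auto
  then have "truncated_family \<beta> R A q P w" using assms by unfold_locales auto
  then show thesis by (rule that)
qed

text \<open>q and P start at explicit values and w starts at half of Phi of these. The bound can
  thus be fixed before R; for R \<ge> B the cutoff does not alter the initial values of q and
  P.\<close>

lemma initial_bound:
  assumes "\<beta> > 0" "A \<ge> 1"
  obtains B where "B > 0" "\<And>R q P w a. R \<ge> B \<Longrightarrow> truncated_family \<beta> R A q P w \<Longrightarrow> a \<in> {1..A} \<Longrightarrow> truncated_family.m q P w (0, a) < B"
proof -
  have "continuous_on {1..A} (\<lambda>a. (1 - a\<^sup>2) / 2)" by (intro continuous_intros) simp
  note cP = continuous_on_Phi[OF less_imp_le[OF assms(1)] continuous_on_const[of _ 0] this continuous_on_id continuous_on_const[of _ 0] continuous_on_const[of _ 0]]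
  have "continuous_on {1..A} (\<lambda>a. Phi \<beta> 0 ((1 - a\<^sup>2) / 2) a 0 0 * (1 / 2))"
    by (rule continuous_on_mult_right[OF cP[unfolded id_def]]) simp
  then have "continuous_on {1..A} (\<lambda>a. Phi \<beta> 0 ((1 - a\<^sup>2) / 2) a 0 0 / 2)" by simp
  from compact_imp_bounded[OF compact_continuous_image[OF this compact_Icc]]
  obtain C where "\<forall>y\<in>(\<lambda>a. Phi \<beta> 0 ((1 - a\<^sup>2) / 2) a 0 0 / 2) ` {1..A}. norm y \<le> C"
    unfolding bounded_iff by (elim exE)
  then have C: "\<bar>Phi \<beta> 0 ((1 - a\<^sup>2) / 2) a 0 0 / 2\<bar> \<le> C" if "a \<in> {1..A}" for a
    using that by (simp only: ball_simps real_norm_def)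
  have "\<bar>Phi \<beta> 0 ((1 - 1\<^sup>2) / 2) 1 0 0 / 2\<bar> \<le> C" by (rule C) (use assms in simp)
  then have C0: "C \<ge> 0" by (rule order_trans[OF abs_ge_zero])
  define B where "B = A\<^sup>2 + A + C + 1"
  have B: "B > 0" using assms C0 by (simp add: B_def add_nonneg_pos)
  show thesis
  proof (rule that[OF B])
    fix R q P w a assume RB: "R \<ge> B" and tf: "truncated_family \<beta> R A q P w" and a: "a \<in> {1..A}"
    interpret truncated_family \<beta> R A q P w by (rule tf)
    have z: "(0::real) \<in> {-1..3/2}" by simp
    have q0: "q (0, a) = (1 - a\<^sup>2) / 2" "P (0, a) = a" using sys[OF a] z unfolding pole_system_def by auto
    have "1 \<le> a" "a \<le> A" using a by auto
    then have a2: "1 \<le> a\<^sup>2" "a\<^sup>2 \<le> A\<^sup>2" using power_mono[of 1 a 2] power_mono[of a A 2] by auto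
    have "- A\<^sup>2 \<le> (1 - a\<^sup>2) / 2" using a2 by simp
    moreover have "(1 - a\<^sup>2) / 2 \<le> A\<^sup>2" using a2 by simp
    ultimately have qb: "\<bar>q (0, a)\<bar> < B" using assms C0 unfolding q0 B_def abs_less_iff by linarith
    have "a < A\<^sup>2 + A + C + 1" using \<open>a \<le> A\<close> a2 C0 by linarith
    then have Pb: "\<bar>P (0, a)\<bar> < B" using \<open>1 \<le> a\<close> unfolding q0 B_def by simp
    have "w (0, a) = avg 1 (\<lambda>\<sigma>. Phi \<beta> \<sigma> (clamp_to R (q (\<sigma>, a))) (clamp_to R (P (\<sigma>, a))) (\<sigma> * clamp_to R (w (\<sigma>, a))) (\<sigma> * (clamp_to R (w (\<sigma>, a)))\<^sup>2)) 0"
      using sys[OF a] z unfolding pole_system_def by auto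
    then have "w (0, a) = Phi \<beta> 0 ((1 - a\<^sup>2) / 2) a 0 0 / 2"
    proof -
      have "clamp_to R (q (0, a)) = q (0, a)" "clamp_to R (P (0, a)) = P (0, a)"
        using qb Pb RB by (auto intro: clamp_to_id)
      then show "w (0, a) = avg 1 (\<lambda>\<sigma>. Phi \<beta> \<sigma> (clamp_to R (q (\<sigma>, a))) (clamp_to R (P (\<sigma>, a))) (\<sigma> * clamp_to R (w (\<sigma>, a))) (\<sigma> * (clamp_to R (w (\<sigma>, a)))\<^sup>2)) 0
        \<Longrightarrow> ?thesis"
        unfolding avg_1_at_0 by (simp only: q0 mult_zero_left)
    qed
    then have "\<bar>w (0, a)\<bar> \<le> C" using C[OF a] by simp
    also have "C < B" using assms by (simp add: B_def add_nonneg_pos)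
    finally have "\<bar>w (0, a)\<bar> < B" .
    then show "m (0, a) < B" using qb Pb by (simp add: m_less)
  qed
qed

text \<open>Beyond t0 the factor t (2 - t) is at least t0. The constraint then bounds P and q, and
  \<open>E_upper\<close> bounds g, hence w. The bounds depend on t0, \<beta> and the data at t0, but
  not on a cutoff level.\<close>

lemma (in pole_solution) a_priori:
  assumes t0: "0 < t0" "t0 \<le> T" "t0 \<le> 1" and R1: "\<bar>P t0\<bar> \<le> R1" "\<bar>w t0\<bar> \<le> R1"
  defines "M \<equiv> ((2 * R1)\<^sup>2 + 1) * exp (8 * \<beta> / t0)"
  assumes t: "t \<in> {t0..T}"
  shows "\<bar>q t\<bar> \<le> 2 / t0" "\<bar>P t\<bar> \<le> sqrt (1 / t0)" "\<bar>w t\<bar> \<le> (sqrt (M / t0) + sqrt (1 / t0)) / t0"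
proof -
  have tT: "t \<in> {0..T}" "t0 \<in> {0..T}" using t t0 by auto
  have k: "t0 \<le> t * (2 - t)"
  proof -
    have "t0 * 1 \<le> t * (2 - t)" using t t0 T by (intro mult_mono) auto
    then show ?thesis by simp
  qed
  have kp: "t * (2 - t) > 0" using k t0 by linarith
  have k0: "0 \<le> t0 * (2 - t0)" "t0 * (2 - t0) \<le> 1"
    using t0 zero_le_power2[of "t0 - 1"] by (auto simp: power2_eq_square algebra_simps)
  have "\<bar>g t0\<bar> \<le> \<bar>P t0\<bar> + t0 * (2 - t0) * \<bar>w t0\<bar>"
    unfolding g_def
    by (rule order_trans[OF abs_triangle_ineq])
       (simp only: abs_mult[of "t0 * (2 - t0)" "w t0"] abs_of_nonneg[OF k0(1)] order_refl)
  also have "\<dots> \<le> R1 + 1 * R1" using R1 k0 by (intro add_mono mult_mono) auto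
  finally have "\<bar>g t0\<bar> \<le> 2 * R1" by simp
  then have "(g t0)\<^sup>2 \<le> (2 * R1)\<^sup>2" by (metis abs_ge_zero power2_abs power_mono)
  then have "t0 * (2 - t0) * (g t0)\<^sup>2 \<le> 1 * (2 * R1)\<^sup>2" using k0 by (intro mult_mono) auto
  moreover have Q1: "(Q t)\<^sup>2 \<le> 1" if "t \<in> {0..T}" for t using Q_le_1[OF that] by (simp add: abs_square_le_1)
  ultimately have E0: "E t0 \<le> (2 * R1)\<^sup>2 + 1" using Q1[OF tT(2)] by (simp add: E_def)
  have "8 * \<beta> / t0 * (t - t0) \<le> 8 * \<beta> / t0 * 1" using t t0 T \<beta> by (intro mult_left_mono) auto
  then have "E t0 * exp (8 * \<beta> / t0 * (t - t0)) \<le> M"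
    unfolding M_def using E0 E_pos[OF tT(2)] by (intro mult_mono) auto
  then have EM: "E t \<le> M" using E_upper[of t0 t] t t0 by simp
  have "t0 * (g t)\<^sup>2 \<le> t * (2 - t) * (g t)\<^sup>2" using k by (intro mult_right_mono) auto
  also have "\<dots> \<le> E t" by (simp add: E_def)
  finally have "t0 * (g t)\<^sup>2 \<le> M" using EM by simp
  then have "(g t)\<^sup>2 \<le> M / t0" using t0 by (simp add: pos_le_divide_eq mult.commute)
  then have gb: "\<bar>g t\<bar> \<le> sqrt (M / t0)" by (metis real_sqrt_abs real_sqrt_le_iff)
  have "t0 * (P t)\<^sup>2 \<le> t * (2 - t) * (P t)\<^sup>2" using k by (intro mult_right_mono) auto
  also have "\<dots> \<le> 1" using unit[OF tT(1)] zero_le_power2[of "Q t"] by linarith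
  finally have "(P t)\<^sup>2 \<le> 1 / t0" using t0 by (simp add: pos_le_divide_eq mult.commute)
  then show Pb: "\<bar>P t\<bar> \<le> sqrt (1 / t0)" by (metis real_sqrt_abs real_sqrt_le_iff)
  have "t0 * \<bar>w t\<bar> \<le> t * (2 - t) * \<bar>w t\<bar>" using k by (intro mult_right_mono) auto
  also have "\<dots> = \<bar>g t - P t\<bar>"
    by (simp only: g_def add_diff_cancel_left' abs_mult[of "t * (2 - t)" "w t"] abs_of_pos[OF kp])
  also have "\<dots> \<le> sqrt (M / t0) + sqrt (1 / t0)" using gb Pb by linarith
  finally show "\<bar>w t\<bar> \<le> (sqrt (M / t0) + sqrt (1 / t0)) / t0" using t0 by (simp add: pos_le_divide_eq mult.commute)
  have "t0 * \<bar>q t\<bar> \<le> t * (2 - t) * \<bar>q t\<bar>" using k by (intro mult_right_mono) auto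
  also have "\<dots> = \<bar>Q t - (1 - t)\<bar>"
    by (simp only: Q_def add_diff_cancel_left' abs_mult[of "t * (2 - t)" "q t"] abs_of_pos[OF kp])
  also have "\<dots> \<le> 2" using Q_le_1[OF tT(1)] t t0 T by auto
  finally show "\<bar>q t\<bar> \<le> 2 / t0" using t0 by (simp add: pos_le_divide_eq mult.commute)
qed

text \<open>The solution is controlled near the pole by its initial data, and from there on by \<open>E\<close>; so
  a large enough truncation is never active.\<close>

lemma truncation_inactive:
  assumes "\<beta> > 0" "A \<ge> 1"
  obtains R q P w where "R \<ge> 1" "truncated_family \<beta> R A q P w"
    "\<And>t a. t \<in> {0..1} \<Longrightarrow> a \<in> {1..A} \<Longrightarrow> truncated_family.m q P w (t, a) < R"
proof -
  obtain R1 where R1: "R1 > 0" "\<And>R q P w a. R \<ge> R1 \<Longrightarrow> truncated_family \<beta> R A q P w \<Longrightarrow> a \<in> {1..A} \<Longrightarrow> truncated_family.m q P w (0, a) < R1"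
    using initial_bound[OF assms] by blast
  obtain q1 P1 w1 where tf1: "truncated_family \<beta> R1 A q1 P1 w1"
    using truncated_family_exists[OF assms(1) less_imp_le[OF R1(1)] assms(2)] by blast
  interpret F1: truncated_family \<beta> R1 A q1 P1 w1 by (rule tf1)
  \<comment> \<open>t0 is read off from the system with cutoff R1, by compactness in the slope. It
    is thus available before R is chosen.\<close>
  obtain t0 where t0: "0 < t0" "t0 \<le> 1" "\<And>t a. t \<in> {0..t0} \<Longrightarrow> a \<in> {1..A} \<Longrightarrow> F1.m (t, a) < R1"
  proof -
    have "uniformly_continuous_on ({0..1} \<times> {1..A}) F1.m"
      by (intro compact_uniformly_continuous continuous_on_subset[OF F1.cont_m] compact_Times compact_Icc) auto
    moreover obtain e where e: "e > 0" "\<And>a. a \<in> {1..A} \<Longrightarrow> F1.m (0, a) \<le> R1 - e"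
    proof -
      have "continuous_on {1..A} (\<lambda>a. F1.m (0, a))"
        by (rule continuous_on_compose2[OF F1.cont_m]) (auto intro!: continuous_intros)
      from continuous_attains_sup[OF compact_Icc _ this] assms(2)
      obtain b where b: "b \<in> {1..A}" "\<And>a. a \<in> {1..A} \<Longrightarrow> F1.m (0, a) \<le> F1.m (0, b)" by auto
      show thesis by (rule that[of "R1 - F1.m (0, b)"]) (use b R1(2)[OF order_refl tf1 b(1)] in auto)
    qed
    ultimately obtain d where d: "d > 0" "\<And>x y. x \<in> {0..1} \<times> {1..A} \<Longrightarrow> y \<in> {0..1} \<times> {1..A} \<Longrightarrow> dist y x < d \<Longrightarrow> dist (F1.m y) (F1.m x) < e"
      unfolding uniformly_continuous_on_def by metis
    show thesis
    proof (rule that[of "min 1 (d / 2)"])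
      fix t a assume t: "t \<in> {0..min 1 (d / 2)}" and a: "a \<in> {1..A}"
      have "dist (t, a) (0, a) < d" using t d(1) by (simp add: dist_Pair_Pair)
      then have "dist (F1.m (t, a)) (F1.m (0, a)) < e" using t a by (intro d(2)) auto
      then show "F1.m (t, a) < R1" using e(2)[OF a] by (simp add: dist_real_def)
    qed (use d in auto)
  qed
  define M where "M = ((2 * R1)\<^sup>2 + 1) * exp (8 * \<beta> / t0)"
  define R where "R = max (max 1 R1) (1 + max (max (2 / t0) (sqrt (1 / t0))) ((sqrt (M / t0) + sqrt (1 / t0)) / t0))"
  have R: "R \<ge> 1" "R \<ge> R1" "R \<ge> 0" "2 / t0 < R" "sqrt (1 / t0) < R" "(sqrt (M / t0) + sqrt (1 / t0)) / t0 < R"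
    by (auto simp: R_def less_max_iff_disj)
  obtain q P w where tf: "truncated_family \<beta> R A q P w"
    using truncated_family_exists[OF assms(1) R(3) assms(2)] by blast
  interpret F: truncated_family \<beta> R A q P w by (rule tf)
  \<comment> \<open>Up to t0 the solution with cutoff R1 stays below R1, so it also solves the
    system with the larger cutoff R; uniqueness identifies the two.\<close>
  have near: "q (t, a) = q1 (t, a) \<and> P (t, a) = P1 (t, a) \<and> w (t, a) = w1 (t, a)" if t: "t \<in> {0..t0}" and a: "a \<in> {1..A}" for t a
  proof (rule truncated_unique[OF less_imp_le[OF assms(1)] R(3) _ _ _ _ _ _ _ _ _ _ t])
    show "0 \<le> t0" "t0 \<le> 3/2" using t0 by auto
    show "continuous_on {0..t0} (\<lambda>t. q (t, a))" "continuous_on {0..t0} (\<lambda>t. P (t, a))" "continuous_on {0..t0} (\<lambda>t. w (t, a))"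
      "continuous_on {0..t0} (\<lambda>t. q1 (t, a))" "continuous_on {0..t0} (\<lambda>t. P1 (t, a))" "continuous_on {0..t0} (\<lambda>t. w1 (t, a))"
      by (rule continuous_on_subset[OF F.cont_slices(1)] continuous_on_subset[OF F.cont_slices(2)] continuous_on_subset[OF F.cont_slices(3)]
        continuous_on_subset[OF F1.cont_slices(1)] continuous_on_subset[OF F1.cont_slices(2)] continuous_on_subset[OF F1.cont_slices(3)]; use t0 in force)+
    show "pole_system (clamp_to R) \<beta> a {0..t0} (\<lambda>t. q (t, a)) (\<lambda>t. P (t, a)) (\<lambda>t. w (t, a))"
      by (rule pole_system_cutoff[OF F.sys[OF a]]) (use t0 in auto)
    have cl: "clamp_to R1 x = clamp_to R x" if "\<bar>x\<bar> < R1" for x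
      using that R(2) by (simp add: clamp_to_id)
    show "pole_system (clamp_to R) \<beta> a {0..t0} (\<lambda>t. q1 (t, a)) (\<lambda>t. P1 (t, a)) (\<lambda>t. w1 (t, a))"
      by (rule pole_system_cutoff[OF F1.sys[OF a]]) (use t0 t0(3)[OF _ a] in \<open>auto simp: F1.m_less intro!: cl\<close>)
  qed
  have near_m: "F.m (t, a) < R1" if "t \<in> {0..t0}" "a \<in> {1..A}" for t a
    using near[OF that] t0(3)[OF that] by (simp add: F.m_less F1.m_less)
  have "F.m (t, a) < R" if t: "t \<in> {0..1}" and a: "a \<in> {1..A}" for t a
  proof (rule ccontr)
    assume n: "\<not> F.m (t, a) < R"
    define S where "S = {s\<in>{0..1}. F.m (s, a) \<ge> R}"
    have "continuous_on {0..1} (\<lambda>s. F.m (s, a))"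
      by (rule continuous_on_compose2[OF F.cont_m]) (auto intro!: continuous_intros)
    note cp = continuous_closed_preimage[OF this closed_atLeastAtMost, of "{R..}"]
    have "S = {0..1} \<inter> (\<lambda>s. F.m (s, a)) -` {R..}" by (auto simp: S_def)
    then have "closed S" using cp by simp
    moreover have "bounded S" by (rule bounded_subset[of "{0..1::real}"]) (auto simp: S_def)
    ultimately have "compact S" by (simp add: compact_eq_bounded_closed)
    moreover have "S \<noteq> {}" using n t by (auto simp: S_def not_less)
    \<comment> \<open>The first time at which the level R is reached. It lies beyond t0, and up to
      it the solution obeys the untruncated equations, so the a priori bounds at s contradict the
      choice of R.\<close>
    ultimately obtain s where s: "s \<in> S" "\<And>s'. s' \<in> S \<Longrightarrow> s \<le> s'"
      using compact_attains_inf by metis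
    then have s01: "0 \<le> s" "s \<le> 1" "F.m (s, a) \<ge> R" by (auto simp: S_def)
    have "s > t0"
    proof (rule ccontr)
      assume "\<not> s > t0"
      then have "F.m (s, a) < R1" using near_m[of s a] a s01 by auto
      then show False using s01 R(2) by simp
    qed
    have lt: "F.m (s', a) < R" if "s' \<in> {0..<s}" for s'
    proof (rule ccontr)
      assume "\<not> F.m (s', a) < R"
      then have "s' \<in> S" using that s01 by (auto simp: S_def)
      then show False using s(2)[of s'] that by simp
    qed
    interpret S: pole_flow \<beta> a s "\<lambda>t. q (t, a)" "\<lambda>t. P (t, a)" "\<lambda>t. w (t, a)"
      by (rule F.flow[OF a _ _ lt]) (use \<open>s > t0\<close> t0 s01 in auto)
    interpret S: pole_solution \<beta> a s "\<lambda>t. q (t, a)" "\<lambda>t. P (t, a)" "\<lambda>t. w (t, a)"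
      by unfold_locales (rule s01)
    have "\<bar>P (t0, a)\<bar> \<le> R1" "\<bar>w (t0, a)\<bar> \<le> R1" using near_m[of t0 a] a t0 by (auto simp: F.m_less)
    from S.a_priori[OF t0(1) _ t0(2) this, of s] \<open>s > t0\<close>
    have "F.m (s, a) < R" unfolding M_def[symmetric] F.m_less using R(4-6) by auto
    then show False using s01 by simp
  qed
  with R(1) tf show thesis by (rule that)
qed

subsection \<open>Shooting\<close>

text \<open>Moves the variable endpoint into the integrand, so that continuity of the angle in r and
  the slope together is continuity of an integral over a fixed interval.\<close>

lemma integral_rescale:
  fixes h :: "real \<Rightarrow> real"
  assumes "0 \<le> r" "continuous_on {0..r} h"
  shows "integral {0..r} h = r * integral {0..1} (\<lambda>\<tau>. h (\<tau> * r))"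
proof -
  let ?\<Psi> = "\<lambda>s. integral {0..s} h"
  have sc: "(\<lambda>\<tau>. \<tau> * r) ` {0..1} \<subseteq> {0..r}"
    using scaled_in_interval[of "{0..r}" r] assms(1) by auto
  have "((\<lambda>\<tau>. r * h (\<tau> * r)) has_integral ?\<Psi> (1 * r) - ?\<Psi> (0 * r)) {0..1}"
  proof (rule fundamental_theorem_of_calculus)
    fix \<tau> :: real assume \<tau>: "\<tau> \<in> {0..1}"
    have "((\<lambda>\<tau>. \<tau> * r) has_real_derivative r) (at \<tau> within {0..1})"
      by (auto intro!: derivative_eq_intros)
    moreover have "(?\<Psi> has_real_derivative h (\<tau> * r)) (at (\<tau> * r) within (\<lambda>\<tau>. \<tau> * r) ` {0..1})"
      by (rule DERIV_subset[OF integral_has_real_derivative[OF assms(2) subsetD[OF sc imageI[OF \<tau>]]] sc])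
    ultimately have "(?\<Psi> \<circ> (\<lambda>\<tau>. \<tau> * r) has_real_derivative h (\<tau> * r) * r) (at \<tau> within {0..1})"
      by (intro DERIV_image_chain)
    then show "((\<lambda>\<tau>. ?\<Psi> (\<tau> * r)) has_vector_derivative r * h (\<tau> * r)) (at \<tau> within {0..1})"
      by (simp add: o_def mult.commute flip: has_real_derivative_iff_has_vector_derivative)
  qed simp
  from integral_unique[OF this] show ?thesis by simp
qed

text \<open>The identity map of the sphere: f(r) = r has P = g = 1 and Q = z.\<close>

lemma pole_system_trivial:
  assumes "convex S" "0 \<in> S" "R \<ge> 1"
  shows "pole_system (clamp_to R) \<beta> 1 S (\<lambda>t. 0) (\<lambda>t. 1) (\<lambda>t. 0)"
proof -
  have cl: "clamp_to R 0 = 0" "clamp_to R 1 = 1" using assms(3) by (auto simp: clamp_to_id)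
  show ?thesis
    unfolding pole_system_def cl by (simp add: F_q_def F_P_def Phi_def Bfun_def avg_def)
qed

lemma profile_existence:
  assumes "\<beta> > 0"
  obtains a \<delta> q P w where "a \<ge> 1" "0 < \<delta>" "\<delta> < 1 / 2" "pole_system (\<lambda>x. x) \<beta> a {-\<delta><..<1 + \<delta>} q P w"
    "continuous_on {-\<delta><..<1 + \<delta>} q" "continuous_on {-\<delta><..<1 + \<delta>} P" "continuous_on {-\<delta><..<1 + \<delta>} w"
    "pole_solution \<beta> a 1 q P w" "pole_solution.angle P w (pi / 2) = 3 * pi / 2"
proof -
  obtain A where A3: "A \<ge> 3" and A: "\<And>q P w. pole_solution \<beta> A 1 q P w \<Longrightarrow> \<exists>r\<in>{0..pi/2}. pole_solution.angle P w r \<ge> 3 * pi / 2"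
    using large_slope_threshold[OF assms] by blast
  have A1: "A \<ge> 1" using A3 by simp
  obtain R q P w where R: "R \<ge> 1" and tf: "truncated_family \<beta> R A q P w"
    and mR: "\<And>t a. t \<in> {0..1} \<Longrightarrow> a \<in> {1..A} \<Longrightarrow> truncated_family.m q P w (t, a) < R"
    using truncation_inactive[OF assms A1] by blast
  interpret F: truncated_family \<beta> R A q P w by (rule tf)
  have sol: "pole_solution \<beta> a 1 (\<lambda>t. q (t, a)) (\<lambda>t. P (t, a)) (\<lambda>t. w (t, a))" if "a \<in> {1..A}" for a
  proof -
    have "pole_flow \<beta> a 1 (\<lambda>t. q (t, a)) (\<lambda>t. P (t, a)) (\<lambda>t. w (t, a))"
      by (rule F.flow[OF that]) (use mR[OF _ that] in auto)
    then show ?thesis by (simp add: pole_solution_def pole_solution_axioms_def)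
  qed
  define G where "G t a = P (t, a) + t * (2 - t) * w (t, a)" for t a
  have cG: "continuous_on ({-1..3/2} \<times> UNIV) (\<lambda>(t, a). G t a)"
    unfolding G_def split_beta by (intro continuous_intros F.cont[unfolded split_beta]; simp add: F.cont)
  define ang where "ang r a = pole_solution.angle (\<lambda>t. P (t, a)) (\<lambda>t. w (t, a)) r" for r a
  have ang_int: "ang r a = integral {0..r} (\<lambda>\<rho>. G (1 - cos \<rho>) a)" if "a \<in> {1..A}" for r a
    unfolding ang_def pole_solution.angle_def[OF sol[OF that]] G_def
      pole_flow.g_def[OF pole_solution.axioms(1)[OF sol[OF that]]] ..
  have c1: "1 - cos \<rho> \<in> {-1..3/2}" if "\<rho> \<in> {0..pi/2}" for \<rho> :: real
  proof -
    have "0 \<le> cos \<rho>" using that by (intro cos_ge_zero) auto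
    moreover have "cos \<rho> \<le> 1" by simp
    ultimately show ?thesis by (simp only: atLeastAtMost_iff) linarith
  qed
  have ang_eq: "ang r a = r * integral {0..1} (\<lambda>\<tau>. G (1 - cos (\<tau> * r)) a)" if r: "r \<in> {0..pi/2}" and a: "a \<in> {1..A}" for r a
    unfolding ang_int[OF a]
  proof (rule integral_rescale)
    show "continuous_on {0..r} (\<lambda>\<rho>. G (1 - cos \<rho>) a)"
      by (rule continuous_on_compose2[OF cG, of _ "\<lambda>\<rho>. (1 - cos \<rho>, a)", simplified split_conv])
         (use c1 r in \<open>auto intro!: continuous_intros\<close>)
  qed (use r in auto)
  let ?D = "{0..pi/2} \<times> {1..A}"
  have cang: "continuous_on ?D (\<lambda>(r, a). ang r a)"
  proof -
    have "continuous_on (?D \<times> cbox 0 1) (\<lambda>(x, \<tau>). G (1 - cos (\<tau> * fst x)) (snd x))"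
      unfolding split_beta
    proof (rule continuous_on_compose2[OF cG, of _ "\<lambda>y. (1 - cos (snd y * fst (fst y)), snd (fst y))", simplified split_conv])
      show "continuous_on (?D \<times> cbox 0 1) (\<lambda>y. (1 - cos (snd y * fst (fst y)), snd (fst y)))"
        by (intro continuous_intros)
      show "(\<lambda>y. (1 - cos (snd y * fst (fst y)), snd (fst y))) ` (?D \<times> cbox 0 1) \<subseteq> {- 1..3 / 2} \<times> UNIV"
      proof (rule image_subsetI)
        fix y assume y: "y \<in> ?D \<times> cbox 0 (1::real)"
        then have "fst (fst y) \<in> {0..pi/2}" "snd y \<in> {0..1}" by auto
        then have "snd y * fst (fst y) \<in> {0..pi/2}" by (intro scaled_in_interval) auto
        from c1[OF this] show "(1 - cos (snd y * fst (fst y)), snd (fst y)) \<in> {- 1..3 / 2} \<times> UNIV" by simp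
      qed
    qed
    then have "continuous_on ?D (\<lambda>x. integral (cbox 0 1) (\<lambda>\<tau>. G (1 - cos (\<tau> * fst x)) (snd x)))"
      by (rule integral_continuous_on_param)
    then have "continuous_on ?D (\<lambda>x. fst x * integral (cbox 0 1) (\<lambda>\<tau>. G (1 - cos (\<tau> * fst x)) (snd x)))"
      by (intro continuous_intros)
    then show ?thesis by (rule continuous_on_eq) (auto simp: ang_eq)
  qed
  define S where "S = {x \<in> ?D. ang (fst x) (snd x) \<ge> 3 * pi / 2}"
  have "compact S"
  proof -
    have "S = ?D \<inter> (\<lambda>(r, a). ang r a) -` {3 * pi / 2..}" by (auto simp: S_def)
    moreover have "closed ?D" by (intro closed_Times closed_atLeastAtMost)
    ultimately have "closed S" using continuous_closed_preimage[OF cang] by simp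
    moreover have "bounded S"
      by (rule bounded_subset[OF compact_imp_bounded[OF compact_Times[OF compact_Icc compact_Icc]]]) (auto simp: S_def)
    ultimately show ?thesis by (simp add: compact_eq_bounded_closed)
  qed
  then have cS: "compact (snd ` S)" by (intro compact_continuous_image continuous_intros)
  have "A \<in> {1..A}" using A1 by simp
  from A[OF sol[OF this]] have "S \<noteq> {}" using A1 by (force simp: S_def ang_def)
  then obtain a where a: "a \<in> snd ` S" "\<And>b. b \<in> snd ` S \<Longrightarrow> a \<le> b"
    using compact_attains_inf[OF cS] by auto
  then obtain r where r: "r \<in> {0..pi/2}" "ang r a \<ge> 3 * pi / 2" and aA: "a \<in> {1..A}" by (auto simp: S_def)
  have a1: "a \<noteq> 1"
  proof
    assume "a = 1"
    have one: "1 \<in> {1..A}" using A1 by simp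
    have "q (t, 1) = 0 \<and> P (t, 1) = 1 \<and> w (t, 1) = 0" if t: "t \<in> {0..1}" for t
    proof (rule truncated_unique[OF less_imp_le[OF assms] F.R _ _ _ _ _ _ _ _ _ _ t])
      show "continuous_on {0..1} (\<lambda>t. q (t, 1))" "continuous_on {0..1} (\<lambda>t. P (t, 1))" "continuous_on {0..1} (\<lambda>t. w (t, 1))"
        by (rule continuous_on_subset[OF F.cont_slices(1)] continuous_on_subset[OF F.cont_slices(2)] continuous_on_subset[OF F.cont_slices(3)]; force)+
      show "pole_system (clamp_to R) \<beta> 1 {0..1} (\<lambda>t. q (t, 1)) (\<lambda>t. P (t, 1)) (\<lambda>t. w (t, 1))"
        by (rule pole_system_cutoff[OF F.sys[OF one]]) auto
      show "pole_system (clamp_to R) \<beta> 1 {0..1} (\<lambda>t. 0) (\<lambda>t. 1) (\<lambda>t. 0)"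
        by (rule pole_system_trivial) (use R in auto)
    qed auto
    then have "G t 1 = 1" if "t \<in> {0..1}" for t using that by (simp add: G_def)
    moreover have "1 - cos \<rho> \<in> {0..1}" if "\<rho> \<in> {0..r}" for \<rho>
      using that r(1) cos_ge_zero[of \<rho>] by auto
    ultimately have "ang r 1 = integral {0..r} (\<lambda>\<rho>. 1)"
      unfolding ang_int[OF one] by (intro Henstock_Kurzweil_Integration.integral_cong) auto
    then have "ang r 1 = r" using r(1) by simp
    then show False using r \<open>a = 1\<close> pi_gt_zero by auto
  qed
  \<comment> \<open>A larger value at s would be preceded, by the intermediate value theorem in the
    slope between 1 and a, by the value 3 pi / 2 at a smaller slope, against the minimality of
    a.\<close>
  have le: "ang s a \<le> 3 * pi / 2" if s: "s \<in> {0..pi/2}" for s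
  proof (rule ccontr)
    assume n: "\<not> ang s a \<le> 3 * pi / 2"
    have c: "continuous_on {1..a} (\<lambda>b. ang s b)"
      by (rule continuous_on_compose2[OF cang, of _ "\<lambda>b. (s, b)", simplified split_conv])
         (use s aA in \<open>auto intro!: continuous_intros\<close>)
    have "ang s 1 < 3 * pi / 2"
    proof (rule ccontr)
      assume "\<not> ang s 1 < 3 * pi / 2"
      then have "(s, 1) \<in> S" using s A1 by (simp add: S_def)
      then have "a \<le> 1" using a(2)[of 1] by force
      then show False using a1 aA by simp
    qed
    then obtain b where b: "1 \<le> b" "b \<le> a" "ang s b = 3 * pi / 2"
      using IVT'[OF _ _ _ c, of "3 * pi / 2"] n aA by auto
    then have "b \<noteq> a" using n by auto
    moreover have "(s, b) \<in> S" using b s aA by (simp add: S_def)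
    then have "a \<le> b" using a(2)[of b] by force
    ultimately show False using b by simp
  qed
  then have eq: "ang r a = 3 * pi / 2" using r by fastforce
  interpret S: pole_solution \<beta> a 1 "\<lambda>t. q (t, a)" "\<lambda>t. P (t, a)" "\<lambda>t. w (t, a)" by (rule sol[OF aA])
  have angS: "S.angle s = ang s a" for s by (simp add: ang_def)
  have "r = pi / 2"
  proof (rule ccontr)
    assume "r \<noteq> pi / 2"
    moreover have "r \<noteq> 0" using eq S.angle_0[OF refl] by (auto simp: angS)
    ultimately have r': "r \<in> {0<..<pi/2}" using r(1) by auto
    let ?t = "1 - cos r"
    have "S.g ?t = 0"
    proof (rule DERIV_local_max[OF S.angle_deriv[OF refl r']])
      show "0 < min r (pi/2 - r)" using r' by auto
      show "\<forall>y. \<bar>r - y\<bar> < min r (pi/2 - r) \<longrightarrow> S.angle y \<le> S.angle r"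
      proof (intro allI impI)
        fix y assume "\<bar>r - y\<bar> < min r (pi/2 - r)"
        then have "y \<in> {0..pi/2}" by (auto simp: abs_less_iff)
        then show "S.angle y \<le> S.angle r" using le[of y] eq by (simp add: angS)
      qed
    qed
    moreover have "cos (3 * pi / 2) = (0::real)"
      using cos_periodic_pi[of "pi / 2"] by (simp add: field_simps)
    then have "S.Q ?t = 0" using S.angle_sin_cos(2)[OF refl r(1)] eq by (simp add: angS)
    ultimately have "S.E ?t = 0" by (simp add: S.E_def)
    then show False using S.E_pos[OF S.one_minus_cos[OF refl r(1)]] by simp
  qed
  \<comment> \<open>Room beyond both ends: t < 0 makes the pole an interior point for the smoothness
    argument, t > 1 gives two-sided derivatives at the equator for the reflection.\<close>
  obtain \<delta> where \<delta>: "0 < \<delta>" "\<delta> < 1 / 2" "\<And>t. t \<in> {-\<delta><..<1 + \<delta>} \<Longrightarrow> F.m (t, a) < R"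
  proof -
    have "continuous_on {-1<..<3/2} (\<lambda>t. F.m (t, a))"
      by (rule continuous_on_compose2[OF F.cont_m]) (auto intro!: continuous_intros)
    from continuous_open_preimage[OF this _ open_lessThan[of R]]
    have op: "open ({-1<..<3/2} \<inter> (\<lambda>t. F.m (t, a)) -` {..<R})" (is "open ?U") by simp
    have "0 \<in> ?U" "1 \<in> ?U" using mR[OF _ aA] by auto
    then obtain d e where "0 < d" "ball 0 d \<subseteq> ?U" "0 < e" "ball 1 e \<subseteq> ?U"
      using op open_contains_ball by meson
    show thesis
    proof (rule that[of "min (1/4) (min d e)"])
      fix t assume t: "t \<in> {- min (1/4) (min d e)<..<1 + min (1/4) (min d e)}"
      consider "t \<in> {0..1}" | "t \<in> ball 0 d" | "t \<in> ball 1 e"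
        using t by (auto simp: dist_real_def) linarith
      then show "F.m (t, a) < R"
        using mR[OF _ aA] \<open>ball 0 d \<subseteq> ?U\<close> \<open>ball 1 e \<subseteq> ?U\<close> by cases auto
    qed (use \<open>0 < d\<close> \<open>0 < e\<close> in auto)
  qed
  have sub: "{-\<delta><..<1 + \<delta>} \<subseteq> {-1..3/2}" using \<delta> by auto
  show thesis
  proof (rule that[of a \<delta> "\<lambda>t. q (t, a)" "\<lambda>t. P (t, a)" "\<lambda>t. w (t, a)"])
    show "pole_system (\<lambda>x. x) \<beta> a {-\<delta><..<1 + \<delta>} (\<lambda>t. q (t, a)) (\<lambda>t. P (t, a)) (\<lambda>t. w (t, a))"
      by (rule pole_system_cutoff[OF F.sys[OF aA] sub])
         (use \<delta> in \<open>auto simp: F.m_less less_imp_le clamp_to_id\<close>)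
    show "pole_solution.angle (\<lambda>t. P (t, a)) (\<lambda>t. w (t, a)) (pi / 2) = 3 * pi / 2"
      using eq \<open>r = pi / 2\<close> by (simp add: ang_def)
  qed (use \<delta> aA sol[OF aA] continuous_on_subset[OF F.cont_slices(1) sub] continuous_on_subset[OF F.cont_slices(2) sub]
        continuous_on_subset[OF F.cont_slices(3) sub] in auto)
qed

subsection \<open>Smoothness and reflection of the profile\<close>

lemma Cn_on_Phi:
  assumes "\<beta> \<ge> 0" "open J" "J \<subseteq> {..<2}" "Cn_on k q J" "Cn_on k P J" "Cn_on k v J" "Cn_on k x J"
  shows "Cn_on k (\<lambda>t. Phi \<beta> t (q t) (P t) (v t) (x t)) J"
proof -
  note i = Cn_on_const Cn_on_ident Cn_on_add Cn_on_mult Cn_on_diff Cn_on_power assms(2,4-7)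
  have t2: "Cn_on k (\<lambda>t. 2 - t) J" "Cn_on k (\<lambda>t. 1 - t) J" by (intro i)+
  have ne: "2 - t \<noteq> 0" if "t \<in> J" for t using assms(3) that by force
  have g: "Cn_on k (\<lambda>t. gfun t (P t) (v t)) J"
    unfolding gfun_def by (intro Cn_on_add Cn_on_mult t2 assms)
  have D: "Cn_on k (\<lambda>t. Den \<beta> t (P t) (v t)) J"
    unfolding Den_def by (intro Cn_on_add Cn_on_mult Cn_on_power Cn_on_const g assms)
  have D0: "Den \<beta> t (P t) (v t) \<noteq> 0" for t using Den_pos[OF assms(1), of t "P t" "v t"] by simp
  have B: "Cn_on k (\<lambda>t. Bfun \<beta> t (q t) (P t) (v t) (x t)) J"
    unfolding Bfun_def by (intro Cn_on_divide Cn_on_mult Cn_on_diff Cn_on_add Cn_on_const t2 g D D0 assms)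
  have c: "Cn_on k (\<lambda>t. 2 / (2 - t)) J" by (intro Cn_on_divide Cn_on_const t2 ne assms)
  show ?thesis
    unfolding Phi_def by (intro Cn_on_add Cn_on_mult Cn_on_divide Cn_on_diff c B g t2 ne assms)
qed

text \<open>Bootstrapping through \<open>t = 0\<close>: \<open>\<Phi>\<close> depends on \<open>w\<close> only through \<open>t w\<close> and \<open>t w\<^sup>2\<close>, which gain a
  derivative by the equation, and \<open>w\<close> is an average of \<open>\<Phi>\<close>.\<close>

lemma pole_system_smooth:
  assumes "\<beta> \<ge> 0" and J: "open J" "convex J" "0 \<in> J" "J \<subseteq> {..<2}"
    and qPw: "continuous_on J q" "continuous_on J P" "continuous_on J w"
    and s: "pole_system (\<lambda>x. x) \<beta> a J q P w"
  shows "Cn_on k q J \<and> Cn_on k P J \<and> Cn_on k w J"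
proof (induction k)
  case 0
  then show ?case using qPw by simp
next
  case (Suc k)
  then have IH: "Cn_on k q J" "Cn_on k P J" "Cn_on k w J" by auto
  note d = pole_system_derivs[OF assms(1) J continuous_on_id[unfolded id_def] qPw s]
  let ?\<Phi> = "\<lambda>t. Phi \<beta> t (q t) (P t) (t * w t) (t * (w t)\<^sup>2)"
  have id: "Cn_on k (\<lambda>t. t) J" by (rule Cn_on_ident[OF J(1)])
  have v: "Cn_on k (\<lambda>t. t * w t) J" "Cn_on k (\<lambda>t. t * (w t)\<^sup>2) J"
    by (intro Cn_on_mult Cn_on_power id IH J(1))+
  have \<Phi>: "Cn_on k ?\<Phi> J" by (rule Cn_on_Phi[OF assms(1) J(1,4) IH(1,2) v])
  have c1: "Cn_on k (\<lambda>t. 1 - t) J" "Cn_on k (\<lambda>t. 2 - t) J"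
    by (intro Cn_on_diff Cn_on_const id J(1))+
  have q: "Cn_on (Suc k) q J"
  proof (rule Cn_on_SucI[OF J(1) d(1)])
    show "Cn_on k (\<lambda>t. F_q t (q t) (P t) (w t)) J"
      unfolding F_q_def by (intro Cn_on_diff Cn_on_mult Cn_on_power IH J(1))
  qed
  have P: "Cn_on (Suc k) P J"
  proof (rule Cn_on_SucI[OF J(1) d(2)])
    show "Cn_on k (\<lambda>t. F_P t (q t) (P t) (w t)) J"
      unfolding F_P_def by (intro Cn_on_add Cn_on_mult c1 id IH J(1))
  qed
  have v': "Cn_on (Suc k) (\<lambda>t. t * w t) J"
  proof (rule Cn_on_SucI[OF J(1) d(4)])
    show "Cn_on k (\<lambda>t. ?\<Phi> t - w t) J" by (intro Cn_on_diff \<Phi> IH J(1))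
  qed
  have x': "Cn_on (Suc k) (\<lambda>t. t * (w t)\<^sup>2) J"
  proof (rule Cn_on_SucI[OF J(1) d(5)])
    show "Cn_on k (\<lambda>t. (w t)\<^sup>2 + 2 * w t * (?\<Phi> t - 2 * w t)) J"
      by (intro Cn_on_add Cn_on_mult Cn_on_diff Cn_on_power Cn_on_const \<Phi> IH J(1))
  qed
  have "Cn_on (Suc k) ?\<Phi> J" by (rule Cn_on_Phi[OF assms(1) J(1,4) q P v' x'])
  from Cn_on_avg[OF J(1-3) this]
  have "Cn_on (Suc k) (avg 1 ?\<Phi>) J" .
  moreover have "avg 1 ?\<Phi> t = w t" if "t \<in> J" for t using s that unfolding pole_system_def by auto
  ultimately have "Cn_on (Suc k) w J" by (rule Cn_on_cong[OF J(1), rotated])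
  with q P show ?case by blast
qed

section \<open>The profile equations between the poles, and reflection at the equator\<close>

definition field_P :: "real \<Rightarrow> real \<Rightarrow> real \<Rightarrow> real \<Rightarrow> real" where
  "field_P z P Q g = (z * P - Q * g) / (1 - z\<^sup>2)"

definition field_g :: "real \<Rightarrow> real \<Rightarrow> real \<Rightarrow> real \<Rightarrow> real \<Rightarrow> real" where
  "field_g \<beta> z P Q g = (z * g - P * Q - 2 * \<beta> * (z * (g\<^sup>2 + P\<^sup>2) - 2 * g * P * Q) / (2 + (1 + 2 * \<beta>) * g\<^sup>2 + P\<^sup>2) * g) / (1 - z\<^sup>2)"

definition profile_solves :: "real \<Rightarrow> real set \<Rightarrow> (real \<Rightarrow> real) \<Rightarrow> (real \<Rightarrow> real) \<Rightarrow> (real \<Rightarrow> real) \<Rightarrow> bool" where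
  "profile_solves \<beta> S P Q g \<longleftrightarrow> (\<forall>z\<in>S.
     (P has_real_derivative field_P z (P z) (Q z) (g z)) (at z) \<and>
     (Q has_real_derivative P z * g z) (at z) \<and>
     (g has_real_derivative field_g \<beta> z (P z) (Q z) (g z)) (at z))"

text \<open>The symmetry f(r) to 3 pi - f(pi - r): sine and derivative are preserved, the cosine
  changes sign.\<close>

lemma profile_solves_reflect:
  assumes "profile_solves \<beta> S P Q g"
  shows "profile_solves \<beta> (uminus ` S) (\<lambda>z. P (- z)) (\<lambda>z. - Q (- z)) (\<lambda>z. g (- z))"
  unfolding profile_solves_def
proof
  fix z assume "z \<in> uminus ` S"
  then have z: "- z \<in> S" by auto
  have m: "((\<lambda>z. - z) has_real_derivative -1) (at z)" by (auto intro!: derivative_eq_intros)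
  have d: "((\<lambda>z. f (- z)) has_real_derivative f' * -1) (at z)" if "(f has_real_derivative f') (at (- z))" for f f'
    by (rule DERIV_chain2[where f=f and g=uminus, OF that m])
  note h = bspec[OF assms[unfolded profile_solves_def] z]
  have "((\<lambda>z. P (- z)) has_real_derivative field_P z (P (- z)) (- Q (- z)) (g (- z))) (at z)"
    by (rule DERIV_cong[OF d[OF conjunct1[OF h]]]) (simp add: field_P_def field_simps)
  moreover have "((\<lambda>z. - Q (- z)) has_real_derivative P (- z) * g (- z)) (at z)"
    using DERIV_minus[OF d[OF conjunct1[OF conjunct2[OF h]]]] by simp
  moreover have "((\<lambda>z. g (- z)) has_real_derivative field_g \<beta> z (P (- z)) (- Q (- z)) (g (- z))) (at z)"
    by (rule DERIV_cong[OF d[OF conjunct2[OF conjunct2[OF h]]]])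
       (simp add: field_g_def minus_divide_left del: minus_divide_left[symmetric], simp add: algebra_simps)
  ultimately show "((\<lambda>z. P (- z)) has_real_derivative field_P z (P (- z)) (- Q (- z)) (g (- z))) (at z) \<and>
    ((\<lambda>z. - Q (- z)) has_real_derivative P (- z) * g (- z)) (at z) \<and>
    ((\<lambda>z. g (- z)) has_real_derivative field_g \<beta> z (P (- z)) (- Q (- z)) (g (- z))) (at z)" by blast
qed

definition glue :: "(real \<Rightarrow> real) \<Rightarrow> (real \<Rightarrow> real) \<Rightarrow> real \<Rightarrow> real" where
  "glue f h z = (if z \<ge> 0 then f z else h z)"

lemma glue_deriv_0:
  assumes "(f has_real_derivative d) (at 0)" "(h has_real_derivative d) (at 0)" "f 0 = h 0"
  shows "(glue f h has_real_derivative d) (at 0)"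
proof -
  have "(f has_real_derivative d) (at 0 within {0..})" "(h has_real_derivative d) (at 0 within {..0})"
    using assms(1,2) has_field_derivative_at_within by blast+
  then have "(glue f h has_real_derivative d) (at 0 within {0..})" "(glue f h has_real_derivative d) (at 0 within {..0})"
    using has_field_derivative_transform_within[of f d 0 "{0..}" 1 "glue f h"]
      has_field_derivative_transform_within[of h d 0 "{..0}" 1 "glue f h"] assms(3)
    by (auto simp: glue_def)
  then have "(glue f h has_real_derivative d) (at 0 within {0..} \<union> {..0})"
    unfolding has_field_derivative_iff by (simp add: Lim_within_Un)
  moreover have "{0..} \<union> {..0} = (UNIV :: real set)" by auto
  ultimately show ?thesis by simp
qed

lemma glue_deriv:
  assumes "z \<noteq> 0"
  shows "z > 0 \<Longrightarrow> (f has_real_derivative d) (at z) \<Longrightarrow> (glue f h has_real_derivative d) (at z)"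
    and "z < 0 \<Longrightarrow> (h has_real_derivative d) (at z) \<Longrightarrow> (glue f h has_real_derivative d) (at z)"
  by (erule has_field_derivative_transform_within_open[of _ _ _ "{0<..}"]; simp add: glue_def)
     (erule has_field_derivative_transform_within_open[of _ _ _ "{..<0}"]; simp add: glue_def)

text \<open>P and g are reflected evenly and match by themselves; Q is reflected oddly and matches
  because Q 0 = 0. The one-sided derivatives at 0 then agree, since both pieces solve the same
  equations with the same values there.\<close>

lemma profile_solves_glue:
  assumes "profile_solves \<beta> {-e<..<1} P Q g" "e > 0" "Q 0 = 0"
  defines "P2 \<equiv> glue P (\<lambda>z. P (- z))" and "Q2 \<equiv> glue Q (\<lambda>z. - Q (- z))" and "g2 \<equiv> glue g (\<lambda>z. g (- z))"
  shows "profile_solves \<beta> {-1<..<1} P2 Q2 g2"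
  unfolding profile_solves_def
proof
  fix z :: real assume z: "z \<in> {-1<..<1}"
  have r: "profile_solves \<beta> {-1<..<e} (\<lambda>z. P (- z)) (\<lambda>z. - Q (- z)) (\<lambda>z. g (- z))"
    using profile_solves_reflect[OF assms(1)] by simp
  consider "z > 0" | "z < 0" | "z = 0" by linarith
  then show "(P2 has_real_derivative field_P z (P2 z) (Q2 z) (g2 z)) (at z) \<and>
     (Q2 has_real_derivative P2 z * g2 z) (at z) \<and>
     (g2 has_real_derivative field_g \<beta> z (P2 z) (Q2 z) (g2 z)) (at z)"
  proof cases
    case 1
    then have v: "P2 z = P z" "Q2 z = Q z" "g2 z = g z" by (auto simp: P2_def Q2_def g2_def glue_def)
    have "z \<in> {-e<..<1}" using 1 z assms(2) by auto
    from bspec[OF assms(1)[unfolded profile_solves_def] this] 1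
    show ?thesis unfolding v unfolding P2_def Q2_def g2_def by (auto intro!: glue_deriv(1))
  next
    case 2
    then have v: "P2 z = P (- z)" "Q2 z = - Q (- z)" "g2 z = g (- z)" by (auto simp: P2_def Q2_def g2_def glue_def)
    have "z \<in> {-1<..<e}" using 2 z assms(2) by auto
    from bspec[OF r[unfolded profile_solves_def] this] 2
    show ?thesis unfolding v unfolding P2_def Q2_def g2_def by (auto intro!: glue_deriv(2))
  next
    case 3
    have v: "P2 0 = P 0" "Q2 0 = 0" "g2 0 = g 0" using assms(3) by (auto simp: P2_def Q2_def g2_def glue_def)
    have z0: "0 \<in> {-e<..<1}" "0 \<in> {-1<..<e}" using assms(2) by auto
    note h = bspec[OF assms(1)[unfolded profile_solves_def] z0(1), unfolded assms(3)]
    note h' = bspec[OF r[unfolded profile_solves_def] z0(2), simplified, unfolded assms(3), simplified]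
    show ?thesis
      unfolding 3 v unfolding P2_def Q2_def g2_def
      by (intro conjI glue_deriv_0) (use h h' assms(3) in auto)
  qed
qed

text \<open>After gluing only differentiability at the equator is known. The right-hand sides are
  rational with nonvanishing denominators, so the equations yield one derivative after
  another.\<close>

lemma profile_smooth:
  assumes "\<beta> \<ge> 0" "profile_solves \<beta> {-1<..<1} P Q g"
  shows "Cn_on k P {-1<..<1} \<and> Cn_on k Q {-1<..<1} \<and> Cn_on k g {-1<..<1}"
proof -
  let ?S = "{-1<..<1::real}"
  have d: "(P has_real_derivative field_P z (P z) (Q z) (g z)) (at z)" "(Q has_real_derivative P z * g z) (at z)"
     "(g has_real_derivative field_g \<beta> z (P z) (Q z) (g z)) (at z)" if "z \<in> ?S" for z
    using assms(2) that unfolding profile_solves_def by auto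
  have op: "open ?S" by simp
  have z1: "1 - z\<^sup>2 \<noteq> 0" if "z \<in> ?S" for z :: real
  proof -
    have "z\<^sup>2 < 1" using that by (simp add: abs_square_less_1 abs_less_iff)
    then show ?thesis by simp
  qed
  have N: "2 + (1 + 2 * \<beta>) * x\<^sup>2 + y\<^sup>2 \<noteq> 0" for x y :: real
  proof -
    have "0 \<le> (1 + 2 * \<beta>) * x\<^sup>2" using assms(1) by simp
    then show ?thesis using zero_le_power2[of y] by linarith
  qed
  show ?thesis
  proof (induction k)
    case 0
    have "isCont P z" "isCont Q z" "isCont g z" if "z \<in> ?S" for z
      using d[OF that] DERIV_isCont by blast+
    then show ?case by (auto intro!: continuous_at_imp_continuous_on)
  next
    case (Suc k)
    then have IH: "Cn_on k P ?S" "Cn_on k Q ?S" "Cn_on k g ?S" by auto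
    have id: "Cn_on k (\<lambda>z. z) ?S" by (rule Cn_on_ident[OF op])
    have k: "Cn_on k (\<lambda>z. 1 - z\<^sup>2) ?S" by (intro Cn_on_diff Cn_on_const Cn_on_power id op)
    have fP: "Cn_on k (\<lambda>z. field_P z (P z) (Q z) (g z)) ?S"
      unfolding field_P_def by (intro Cn_on_divide Cn_on_diff Cn_on_mult id IH k z1 op)
    have n: "Cn_on k (\<lambda>z. 2 + (1 + 2 * \<beta>) * (g z)\<^sup>2 + (P z)\<^sup>2) ?S"
      by (intro Cn_on_add Cn_on_mult Cn_on_power Cn_on_const IH op)
    have fg: "Cn_on k (\<lambda>z. field_g \<beta> z (P z) (Q z) (g z)) ?S"
      unfolding field_g_def
      by (intro Cn_on_divide Cn_on_diff Cn_on_mult Cn_on_add Cn_on_power Cn_on_const id IH k n z1 N op)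
    have fQ: "Cn_on k (\<lambda>z. P z * g z) ?S" by (intro Cn_on_mult IH op)
    show ?case using Cn_on_SucI[OF op d(1) fP] Cn_on_SucI[OF op d(2) fQ] Cn_on_SucI[OF op d(3) fg] by blast
  qed
qed

lemma eq_on_closed_interval:
  fixes F G :: "real \<Rightarrow> real"
  assumes "continuous_on {-1..1} F" "continuous_on {-1..1} G" "\<And>z. z \<in> {-1<..<1} \<Longrightarrow> F z = G z" "z \<in> {-1..1}"
  shows "F z = G z"
proof -
  have cl: "closure {-1<..<1::real} = {-1..1}" by simp
  have "F z - G z = 0"
  proof (rule continuous_constant_on_closure[of "{-1<..<1}" "\<lambda>z. F z - G z"])
    show "continuous_on (closure {-1<..<1}) (\<lambda>z. F z - G z)"
      unfolding cl by (intro continuous_intros assms(1,2))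
  qed (use assms(3,4) in auto)
  then show ?thesis by simp
qed

subsection \<open>The symmetric solution\<close>

text \<open>Three open sets cover the interval: the one between the poles, where the equations give
  smoothness, and two around the poles, where the glued function is f itself or its reflection, each
  smooth beyond the pole. The sign s is 1 for P and g, -1 for Q.\<close>

lemma glue_reflect_smooth:
  assumes "\<delta> > 0" "Cn_on k f {-\<delta><..<1 + \<delta>}" "Cn_on k (glue f (\<lambda>z. s * f (- z))) {-1<..<1}"
  shows "Cn_on k (glue f (\<lambda>z. s * f (- z))) {-1 - \<delta><..<1 + \<delta>}"
proof -
  let ?F = "glue f (\<lambda>z. s * f (- z))"
  have "Cn_on k f {0<..<1 + \<delta>}" by (rule Cn_on_subset[OF assms(2)]) (use assms(1) in auto)
  then have 1: "Cn_on k ?F {0<..<1 + \<delta>}" by (rule Cn_on_cong[rotated 2]) (auto simp: glue_def)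
  have "Cn_on k (\<lambda>x. f (0 - x)) ((\<lambda>x. 0 - x) -` {-\<delta><..<1 + \<delta>})"
    by (rule Cn_on_reflect[OF _ assms(2)]) simp
  then have "Cn_on k (\<lambda>x. f (0 - x)) {-1 - \<delta><..<0}"
    by (rule Cn_on_subset) (use assms(1) in auto)
  then have "Cn_on k (\<lambda>x. s * f (- x)) {-1 - \<delta><..<0}"
    by (intro Cn_on_mult Cn_on_const) auto
  then have 2: "Cn_on k ?F {-1 - \<delta><..<0}" by (rule Cn_on_cong[rotated 2]) (auto simp: glue_def)
  have "{-1<..<1} \<union> ({0<..<1 + \<delta>} \<union> {-1 - \<delta><..<0}) = {-1 - \<delta><..<1 + \<delta>}"
    using assms(1) by (auto simp: not_less)
  then show ?thesis
    using Cn_on_Un[OF _ _ assms(3) Cn_on_Un[OF _ _ 1 2]] by (simp add: open_Un)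
qed

text \<open>Returns from t to z = 1 - t and from q, w to Q, g. For T > 1 the equator z = 0 is an
  interior point.\<close>

lemma (in pole_flow) profile_solves_height:
  assumes "T > 1"
  shows "profile_solves \<beta> {1 - T<..<1} (\<lambda>z. P (1 - z)) (\<lambda>z. Q (1 - z)) (\<lambda>z. g (1 - z))"
  unfolding profile_solves_def
proof
  fix z assume z: "z \<in> {1 - T<..<1}"
  let ?t = "1 - z"
  have t: "?t \<in> {0<..<T}" using z by auto
  then have k0: "?t * (2 - ?t) > 0" using Tf by simp
  have kz: "?t * (2 - ?t) = 1 - z\<^sup>2" by (simp add: power2_eq_square algebra_simps)
  have m: "((\<lambda>z. 1 - z) has_real_derivative -1) (at z)" by (auto intro!: derivative_eq_intros)
  have d: "((\<lambda>z. f (1 - z)) has_real_derivative - f') (at z)" if "(f has_real_derivative f') (at ?t)" for f f'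
    using DERIV_chain2[where f=f and g="\<lambda>z. 1 - z", OF that m] by simp
  have 1: "- F_P ?t (q ?t) (P ?t) (w ?t) = field_P z (P ?t) (Q ?t) (g ?t)"
  proof -
    have "- F_P ?t (q ?t) (P ?t) (w ?t) * (1 - z\<^sup>2) = z * P ?t - Q ?t * g ?t"
      using P_flow[of ?t] unfolding kz by (simp add: algebra_simps)
    then show ?thesis using k0 unfolding field_P_def kz by (simp add: eq_divide_eq)
  qed
  have B: "2 * \<beta> * (z * ((g ?t)\<^sup>2 + (P ?t)\<^sup>2) - 2 * g ?t * P ?t * Q ?t) / (2 + (1 + 2 * \<beta>) * (g ?t)\<^sup>2 + (P ?t)\<^sup>2)
    = ?t * (2 - ?t) * B ?t"
    using kB_eq[of ?t] N_pos(2)[of ?t] unfolding N_def by (simp add: divide_eq_eq)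
  have "?t * (2 - ?t) * (P ?t * q ?t - z * w ?t + B ?t * g ?t)
     = P ?t * (?t * (2 - ?t) * q ?t) - z * (?t * (2 - ?t) * w ?t) + ?t * (2 - ?t) * B ?t * g ?t"
    by (simp add: algebra_simps)
  also have "\<dots> = P ?t * (Q ?t - z) - z * (g ?t - P ?t) + ?t * (2 - ?t) * B ?t * g ?t"
    by (simp add: Q_def g_def)
  finally have e: "(1 - z\<^sup>2) * (P ?t * q ?t - z * w ?t + B ?t * g ?t)
     = P ?t * (Q ?t - z) - z * (g ?t - P ?t) + (1 - z\<^sup>2) * B ?t * g ?t"
    unfolding kz .
  have 2: "- (P ?t * q ?t - (1 - ?t) * w ?t + B ?t * g ?t) = field_g \<beta> z (P ?t) (Q ?t) (g ?t)"
  proof -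
    have "- (P ?t * q ?t - z * w ?t + B ?t * g ?t) * (1 - z\<^sup>2)
      = - ((1 - z\<^sup>2) * (P ?t * q ?t - z * w ?t + B ?t * g ?t))" by (simp only: mult_minus_left mult.commute)
    also have "\<dots> = z * g ?t - P ?t * Q ?t - (1 - z\<^sup>2) * B ?t * g ?t"
      unfolding e by (simp add: algebra_simps)
    finally show ?thesis using k0 unfolding field_g_def B unfolding kz by (simp add: eq_divide_eq)
  qed
  show "((\<lambda>z. P (1 - z)) has_real_derivative field_P z (P ?t) (Q ?t) (g ?t)) (at z) \<and>
    ((\<lambda>z. Q (1 - z)) has_real_derivative P ?t * g ?t) (at z) \<and>
    ((\<lambda>z. g (1 - z)) has_real_derivative field_g \<beta> z (P ?t) (Q ?t) (g ?t)) (at z)"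
    using d[OF P_deriv[OF t]] d[OF Q_deriv[OF t]] d[OF g_deriv[OF t]] unfolding 1 2 by simp
qed

text \<open>Between the poles the equations are cleared of the denominator 1 - z^2. Both sides are
  continuous on [-1, 1], so the identities extend to the poles.\<close>

lemma symmetric_profile_of_smooth:
  assumes I: "{-1..1} \<subseteq> I" and sm: "\<And>k. Cn_on k P I" "\<And>k. Cn_on k Q I" "\<And>k. Cn_on k g I"
    and \<beta>: "\<beta> \<ge> 0" and ps: "profile_solves \<beta> {-1<..<1} P Q g"
    and un: "\<And>z. z \<in> {-1..1} \<Longrightarrow> (Q z)\<^sup>2 + (1 - z\<^sup>2) * (P z)\<^sup>2 = 1"
  shows "symmetric_profile (\<beta> + 1) P Q g (deriv P) (deriv (deriv P)) (deriv g)"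
proof -
  have d: "deriv P z = field_P z (P z) (Q z) (g z)" "deriv Q z = P z * g z" "deriv g z = field_g \<beta> z (P z) (Q z) (g z)"
    if "z \<in> {-1<..<1}" for z
    using ps that unfolding profile_solves_def by (auto intro: DERIV_imp_deriv)
  have dd: "(f has_real_derivative deriv f z) (at z)" if "\<And>k. Cn_on k f I" "z \<in> {-1..1}" for f z
    using Cn_on_DERIV[OF that(1)[of "Suc 0"]] that(2) I by blast
  have c: "continuous_on {-1..1} f" "continuous_on {-1..1} (deriv f)" if "\<And>k. Cn_on k f I" for f
    using Cn_on_continuous[OF that[of 0]] Cn_on_continuous[of 0 "deriv f" I] that[of "Suc 0"] I
    by (auto intro: continuous_on_subset)
  note cP = c[OF sm(1)] and cQ = c[OF sm(2)] and cg = c[OF sm(3)]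
  have k0: "1 - z\<^sup>2 \<noteq> 0" if "z \<in> {-1<..<1}" for z :: real
  proof -
    have "z\<^sup>2 < 1" using that by (simp add: abs_square_less_1 abs_less_iff)
    then show ?thesis by simp
  qed
  have dQ: "deriv Q z = P z * g z" if "z \<in> {-1..1}" for z
    by (rule eq_on_closed_interval[OF cQ(2) _ d(2) that]) (auto intro!: continuous_intros cP cg)
  have eP: "(1 - z\<^sup>2) * deriv P z = z * P z - Q z * g z" if "z \<in> {-1..1}" for z
  proof (rule eq_on_closed_interval[OF _ _ _ that])
    show "continuous_on {-1..1} (\<lambda>z. (1 - z\<^sup>2) * deriv P z)" "continuous_on {-1..1} (\<lambda>z. z * P z - Q z * g z)"
      by (intro continuous_intros cP cQ cg)+
    show "(1 - z\<^sup>2) * deriv P z = z * P z - Q z * g z" if "z \<in> {-1<..<1}" for z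
      using k0[OF that] by (simp add: d(1)[OF that] field_P_def)
  qed
  have eg: "(1 - z\<^sup>2) * (deriv g z * (2 + (g z)\<^sup>2 + (P z)\<^sup>2) + 2 * \<beta> * g z * (g z * deriv g z + P z * deriv P z))
        = (2 + (g z)\<^sup>2 + (P z)\<^sup>2) * (z * g z - P z * Q z)" if "z \<in> {-1..1}" for z
  proof (rule eq_on_closed_interval[OF _ _ _ that])
    show "continuous_on {-1..1} (\<lambda>z. (1 - z\<^sup>2) * (deriv g z * (2 + (g z)\<^sup>2 + (P z)\<^sup>2) + 2 * \<beta> * g z * (g z * deriv g z + P z * deriv P z)))"
      "continuous_on {-1..1} (\<lambda>z. (2 + (g z)\<^sup>2 + (P z)\<^sup>2) * (z * g z - P z * Q z))"
      by (intro continuous_intros cP cQ cg)+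
    fix z :: real assume z: "z \<in> {-1<..<1}"
    define N where "N = 2 + (1 + 2 * \<beta>) * (g z)\<^sup>2 + (P z)\<^sup>2"
    define X where "X = 2 * \<beta> * (z * ((g z)\<^sup>2 + (P z)\<^sup>2) - 2 * g z * P z * Q z) / N"
    have "0 \<le> (1 + 2 * \<beta>) * (g z)\<^sup>2" using \<beta> by simp
    then have "N \<noteq> 0" using zero_le_power2[of "P z"] unfolding N_def by linarith
    then have XN: "X * N = 2 * \<beta> * (z * ((g z)\<^sup>2 + (P z)\<^sup>2) - 2 * g z * P z * Q z)" by (simp add: X_def)
    have g': "(1 - z\<^sup>2) * deriv g z = z * g z - P z * Q z - X * g z"
      using k0[OF z] unfolding d(3)[OF z] field_g_def X_def N_def by simp
    have P': "(1 - z\<^sup>2) * deriv P z = z * P z - Q z * g z" using eP z by simp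
    have "(1 - z\<^sup>2) * (deriv g z * (2 + (g z)\<^sup>2 + (P z)\<^sup>2) + 2 * \<beta> * g z * (g z * deriv g z + P z * deriv P z))
      = ((1 - z\<^sup>2) * deriv g z) * N + 2 * \<beta> * g z * P z * ((1 - z\<^sup>2) * deriv P z)"
      by (simp add: N_def power2_eq_square algebra_simps)
    also have "\<dots> = (z * g z - P z * Q z) * N - g z * (X * N) + 2 * \<beta> * g z * P z * (z * P z - Q z * g z)"
      unfolding g' P' by (simp add: algebra_simps)
    also have "\<dots> = (2 + (g z)\<^sup>2 + (P z)\<^sup>2) * (z * g z - P z * Q z)"
      unfolding XN by (simp add: N_def power2_eq_square algebra_simps)
    finally show "(1 - z\<^sup>2) * (deriv g z * (2 + (g z)\<^sup>2 + (P z)\<^sup>2) + 2 * \<beta> * g z * (g z * deriv g z + P z * deriv P z))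
        = (2 + (g z)\<^sup>2 + (P z)\<^sup>2) * (z * g z - P z * Q z)" .
  qed
  have smP': "Cn_on k (deriv P) I" for k using sm(1)[of "Suc k"] by simp
  show ?thesis
  proof
    fix z :: real assume z: "z \<in> {-1..1}"
    show "(P has_real_derivative deriv P z) (at z)" by (rule dd[OF sm(1) z])
    show "(Q has_real_derivative P z * g z) (at z)" using dd[OF sm(2) z] dQ[OF z] by simp
    show "(deriv P has_real_derivative deriv (deriv P) z) (at z)" by (rule dd[OF smP' z])
    show "(g has_real_derivative deriv g z) (at z)" by (rule dd[OF sm(3) z])
    show "(1 - z\<^sup>2) * deriv P z = z * P z - Q z * g z" by (rule eP[OF z])
    show "(Q z)\<^sup>2 + (1 - z\<^sup>2) * (P z)\<^sup>2 = 1" by (rule un[OF z])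
    show "(1 - z\<^sup>2) * (deriv g z * (2 + (g z)\<^sup>2 + (P z)\<^sup>2) + 2 * (\<beta> + 1 - 1) * g z * (g z * deriv g z + P z * deriv P z))
        = (2 + (g z)\<^sup>2 + (P z)\<^sup>2) * (z * g z - P z * Q z)" using eg[OF z] by simp
  qed
qed

lemma symmetric_solution:
  fixes \<alpha> :: real
  assumes "\<alpha> > 1"
  obtains P Q g P' P'' g' I \<theta> where "symmetric_profile \<alpha> P Q g P' P'' g'" "open I" "{-1..1} \<subseteq> I"
    "\<forall>k. Cn_on k P I" "\<forall>k. Cn_on k Q I" "\<forall>z. P (- z) = P z" "\<forall>z. Q (- z) = - Q z"
    "continuous_on {0..pi/2} \<theta>" "\<theta> 0 = (0::real)" "\<theta> (pi / 2) = 3 * pi / 2"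
    "\<forall>r\<in>{0..pi/2}. sin (\<theta> r) = sin r * P (cos r) \<and> cos (\<theta> r) = Q (cos r)"
proof -
  define \<beta> where "\<beta> = \<alpha> - 1"
  have \<beta>: "\<beta> > 0" using assms by (simp add: \<beta>_def)
  obtain a \<delta> q p w where a: "a \<ge> 1" and \<delta>: "0 < \<delta>" "\<delta> < 1 / 2"
    and s: "pole_system (\<lambda>x. x) \<beta> a {-\<delta><..<1 + \<delta>} q p w"
    and c: "continuous_on {-\<delta><..<1 + \<delta>} q" "continuous_on {-\<delta><..<1 + \<delta>} p" "continuous_on {-\<delta><..<1 + \<delta>} w"
    and sol: "pole_solution \<beta> a 1 q p w" and ang: "pole_solution.angle p w (pi / 2) = 3 * pi / 2"
    using profile_existence[OF \<beta>] by blast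
  interpret S: pole_solution \<beta> a 1 q p w by (rule sol)
  let ?J = "{-\<delta><..<1 + \<delta>}"
  have J: "open ?J" "convex ?J" "0 \<in> ?J" "?J \<subseteq> {..<2}" using \<delta> by auto
  note d = pole_system_derivs[OF less_imp_le[OF \<beta>] J continuous_on_id[unfolded id_def] c s]
  have flow: "pole_flow \<beta> a (1 + \<delta> / 2) q p w"
  proof
    show "continuous_on {0..1 + \<delta> / 2} q" "continuous_on {0..1 + \<delta> / 2} p" "continuous_on {0..1 + \<delta> / 2} w"
      by (rule continuous_on_subset[OF c(1)] continuous_on_subset[OF c(2)] continuous_on_subset[OF c(3)]; use \<delta> in force)+
    show "q 0 = (1 - a\<^sup>2) / 2" "p 0 = a" "w 0 = Phi \<beta> 0 (q 0) (p 0) 0 0 / 2" by (rule S.init)+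
    fix t assume "t \<in> {0<..<1 + \<delta> / 2}"
    then have t: "t \<in> ?J" "t \<noteq> 0" using \<delta> by auto
    show "(q has_real_derivative F_q t (q t) (p t) (w t)) (at t)" by (rule d(1)[OF t(1)])
    show "(p has_real_derivative F_P t (q t) (p t) (w t)) (at t)" by (rule d(2)[OF t(1)])
    show "(w has_real_derivative (Phi \<beta> t (q t) (p t) (t * w t) (t * (w t)\<^sup>2) - 2 * w t) / t) (at t)"
      by (rule d(3)[OF t])
  qed (use \<beta> a \<delta> in auto)
  define P1 Q1 g1 where "P1 z = p (1 - z)" and "Q1 z = S.Q (1 - z)" and "g1 z = S.g (1 - z)" for z
  have "profile_solves \<beta> {1 - (1 + \<delta> / 2)<..<1} (\<lambda>z. p (1 - z)) (\<lambda>z. S.Q (1 - z)) (\<lambda>z. S.g (1 - z))"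
    by (rule pole_flow.profile_solves_height[OF flow]) (use \<delta> in simp)
  then have ps1: "profile_solves \<beta> {-(\<delta> / 2)<..<1} P1 Q1 g1"
    by (simp add: P1_def [abs_def] Q1_def [abs_def] g1_def [abs_def])
  have r2: "pi / 2 \<in> {0..pi/2}" by simp
  have "cos (3 * pi / 2) = (0::real)"
    using cos_periodic_pi[of "pi / 2"] by (simp add: field_simps)
  then have Q10: "Q1 0 = 0" using S.angle_sin_cos(2)[OF refl r2] ang by (simp add: Q1_def)
  define P Q g where "P = glue P1 (\<lambda>z. P1 (- z))" and "Q = glue Q1 (\<lambda>z. - Q1 (- z))" and "g = glue g1 (\<lambda>z. g1 (- z))"
  have ps: "profile_solves \<beta> {-1<..<1} P Q g"
    unfolding P_def Q_def g_def by (rule profile_solves_glue[OF ps1 _ Q10]) (use \<delta> in simp)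
  note sm1 = profile_smooth[OF less_imp_le[OF \<beta>] ps]
  let ?I = "{-1 - \<delta><..<1 + \<delta>}"
  have sm: "Cn_on k q ?J" "Cn_on k p ?J" "Cn_on k w ?J" for k
    using pole_system_smooth[OF less_imp_le[OF \<beta>] J c s] by auto
  have smc: "Cn_on k (\<lambda>t. t) ?J" "Cn_on k (\<lambda>t. 1 - t) ?J" "Cn_on k (\<lambda>t. 2 - t) ?J" for k
    by (intro Cn_on_diff Cn_on_const Cn_on_ident J(1))+
  have smQ: "Cn_on k S.Q ?J" "Cn_on k S.g ?J" for k
    unfolding S.Q_def [abs_def] S.g_def [abs_def] by (intro Cn_on_add Cn_on_mult smc sm J(1))+
  have refl1: "Cn_on k (\<lambda>z. f (1 - z)) ?J" if "Cn_on k f ?J" for f k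
  proof -
    have "(\<lambda>x. 1 - x) -` ?J = ?J" by auto
    then show ?thesis using Cn_on_reflect[OF J(1) that, of 1] by simp
  qed
  have smP1: "Cn_on k P1 ?J" "Cn_on k Q1 ?J" "Cn_on k g1 ?J" for k
    using refl1[OF sm(2)] refl1[OF smQ(1)] refl1[OF smQ(2)]
    by (simp_all add: P1_def [abs_def] Q1_def [abs_def] g1_def [abs_def])
  have smP: "Cn_on k P ?I" "Cn_on k Q ?I" "Cn_on k g ?I" for k
    using glue_reflect_smooth[where s=1 and k=k, OF \<delta>(1) smP1(1)] glue_reflect_smooth[where s="-1" and k=k, OF \<delta>(1) smP1(2)]
      glue_reflect_smooth[where s=1 and k=k, OF \<delta>(1) smP1(3)] sm1[of k]
    by (simp_all add: P_def Q_def g_def)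
  have even: "P (- z) = P z" "Q (- z) = - Q z" for z
    using Q10 by (auto simp: P_def Q_def glue_def)
  have un0: "(Q z)\<^sup>2 + (1 - z\<^sup>2) * (P z)\<^sup>2 = 1" if "z \<in> {0..1}" for z
  proof -
    have "1 - z \<in> {0..1}" using that by auto
    from S.unit[OF this] have "(Q1 z)\<^sup>2 + (1 - z) * (2 - (1 - z)) * (P1 z)\<^sup>2 = 1"
      by (simp add: P1_def Q1_def)
    moreover have "(1 - z) * (2 - (1 - z)) = 1 - z\<^sup>2" by (simp add: power2_eq_square algebra_simps)
    ultimately show ?thesis using that by (simp add: P_def Q_def glue_def)
  qed
  have un: "(Q z)\<^sup>2 + (1 - z\<^sup>2) * (P z)\<^sup>2 = 1" if "z \<in> {-1..1}" for z
    using un0[of z] un0[of "- z"] that even[of z] by (cases "z \<ge> 0") auto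
  have "symmetric_profile (\<beta> + 1) P Q g (deriv P) (deriv (deriv P)) (deriv g)"
    by (rule symmetric_profile_of_smooth[OF _ smP less_imp_le[OF \<beta>] ps un]) (use \<delta> in auto)
  then have sp: "symmetric_profile \<alpha> P Q g (deriv P) (deriv (deriv P)) (deriv g)" by (simp add: \<beta>_def)
  show thesis
  proof (rule that[OF sp _ _ _ _ _ _ S.cont_angle[OF refl] S.angle_0[OF refl] ang])
    show "\<forall>r\<in>{0..pi/2}. sin (S.angle r) = sin r * P (cos r) \<and> cos (S.angle r) = Q (cos r)"
    proof
      fix r assume r: "r \<in> {0..pi/2}"
      then have "cos r \<ge> 0" by (intro cos_ge_zero) auto
      then show "sin (S.angle r) = sin r * P (cos r) \<and> cos (S.angle r) = Q (cos r)"
        using S.angle_sin_cos[OF refl r] by (simp add: P_def Q_def glue_def P1_def Q1_def)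
    qed
    show "\<forall>k. Cn_on k P ?I" "\<forall>k. Cn_on k Q ?I" "\<forall>z. P (- z) = P z" "\<forall>z. Q (- z) = - Q z"
      using smP even by blast+
  qed (use \<delta> in auto)
qed

text \<open>Replacing f by f + pi changes the signs of P and Q and leaves g alone. The degree, a
  difference of values of Q, changes sign.\<close>

lemma symmetric_profile_antipodal:
  assumes "symmetric_profile \<alpha> P Q g P' P'' g'"
  shows "symmetric_profile \<alpha> (\<lambda>z. - P z) (\<lambda>z. - Q z) g (\<lambda>z. - P' z) (\<lambda>z. - P'' z) g'"
proof -
  interpret symmetric_profile \<alpha> P Q g P' P'' g' by (rule assms)
  show ?thesis
  proof
    fix z :: real assume z: "z \<in> {-1..1}"
    show "((\<lambda>z. - P z) has_real_derivative - P' z) (at z)" by (rule DERIV_minus[OF P_deriv[OF z]])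
    show "((\<lambda>z. - Q z) has_real_derivative - P z * g z) (at z)" using DERIV_minus[OF Q_deriv[OF z]] by simp
    show "((\<lambda>z. - P' z) has_real_derivative - P'' z) (at z)" by (rule DERIV_minus[OF P'_deriv[OF z]])
    show "(g has_real_derivative g' z) (at z)" by (rule g_deriv[OF z])
    show "(1 - z\<^sup>2) * - P' z = z * - P z - - Q z * g z" using P_eq[OF z] by simp
    show "(- Q z)\<^sup>2 + (1 - z\<^sup>2) * (- P z)\<^sup>2 = 1" using unit[OF z] by simp
    show "(1 - z\<^sup>2) * (g' z * (2 + (g z)\<^sup>2 + (- P z)\<^sup>2) + 2 * (\<alpha> - 1) * g z * (g z * g' z + - P z * - P' z))
        = (2 + (g z)\<^sup>2 + (- P z)\<^sup>2) * (z * g z - - P z * - Q z)" using g_eq[OF z] by simp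
  qed
qed

lemma geodesic_disc_eq_band:
  assumes "0 \<le> \<rho>" "\<rho> \<le> pi"
  shows "geodesic_disc (axis 3 1) \<rho> = band (cos \<rho>) 1"
proof -
  have "arccos (x $ 3) \<le> \<rho> \<longleftrightarrow> cos \<rho> \<le> x $ 3" if "x \<in> S2" for x :: "real^3"
  proof -
    have b: "-1 \<le> x $ 3" "x $ 3 \<le> 1" using sphere_component_bounds[OF that, of 3] by auto
    show ?thesis
      using cos_mono_le_eq[of \<rho> "arccos (x $ 3)"] assms b by (simp add: arccos_lbound arccos_ubound cos_arccos)
  qed
  moreover have "x $ 3 \<le> 1" if "x \<in> S2" for x :: "real^3" using sphere_component_bounds[OF that, of 3] by simp
  ultimately show ?thesis
    by (auto simp: geodesic_disc_def band_def inner_axis')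
qed

lemma sph_annulus_eq_band:
  assumes "0 < r1" "r1 \<le> r2" "r2 < pi"
  shows "sph_annulus r1 r2 = band (cos r2) (cos r1)"
proof (intro equalityI subsetI)
  fix x assume "x \<in> sph_annulus r1 r2"
  then obtain r \<theta> where r: "r1 \<le> r" "r \<le> r2" "x = sph r \<theta>" by (auto simp: sph_annulus_def sph_circle_def)
  then have "cos r2 \<le> cos r" "cos r \<le> cos r1" using assms by (auto intro!: cos_monotone_0_pi_le)
  then show "x \<in> band (cos r2) (cos r1)" using r sph_in_S2[of r \<theta>] by (simp add: band_def del: mem_sphere_0)
next
  fix x assume x: "x \<in> band (cos r2) (cos r1)"
  then have xs: "x \<in> S2" and x3: "cos r2 \<le> x $ 3" "x $ 3 \<le> cos r1" by (auto simp: band_def)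
  have b: "-1 \<le> x $ 3" "x $ 3 \<le> 1" using sphere_component_bounds[OF xs, of 3] by auto
  define r where "r = arccos (x $ 3)"
  have r0: "0 \<le> r" "r \<le> pi" "cos r = x $ 3" using b by (auto simp: r_def arccos_lbound arccos_ubound)
  have r: "r1 \<le> r" "r \<le> r2"
    using cos_mono_le_eq[of r r1] cos_mono_le_eq[of r2 r] assms r0 x3 by auto
  then have sp: "sin r > 0" using assms by (intro sin_gt_zero) auto
  have "(x $ 1)\<^sup>2 + (x $ 2)\<^sup>2 = (sin r)\<^sup>2"
    using sphere_sum_squares[OF xs] r0(3) by (simp add: sin_squared_eq)
  then have "(x $ 1 / sin r)\<^sup>2 + (x $ 2 / sin r)\<^sup>2 = 1"
    using sp by (simp add: power_divide flip: add_divide_distrib)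
  then obtain t where t: "0 \<le> t" "t < 2 * pi" "x $ 1 / sin r = cos t" "x $ 2 / sin r = sin t"
    using sincos_total_2pi by metis
  have "x $ 1 = cos t * sin r" using t(3) sp by (simp add: divide_eq_eq)
  moreover have "x $ 2 = sin t * sin r" using t(4) sp by (simp add: divide_eq_eq)
  ultimately have "x = sph r t"
    using r0(3) by (simp add: vec_eq_iff forall_3)
  then have "x \<in> sph_circle r"
    unfolding sph_circle_def by (rule image_eqI) (use t(1,2) in simp)
  then show "x \<in> sph_annulus r1 r2"
    using r by (auto simp: sph_annulus_def)
qed

theorem mainTheorem2:
  fixes \<alpha> :: real
  assumes "\<alpha> > 1"
  shows "(\<exists>f u. continuous_on {0..pi} f \<and> f 0 = 0 \<and> f pi = 3 * pi \<and> is_rot_sym_map f u \<and>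
            alpha_harmonic_on \<alpha> S2 u \<and> deg S2 u = 1 \<and> \<not> is_rotation u \<and>
            alpha_energy \<alpha> u \<ge> 2 powr (3 * \<alpha> + 1) * pi)
       \<and> (\<exists>p \<rho> u. p \<in> S2 \<and> 0 < \<rho> \<and> \<rho> < pi \<and>
            alpha_harmonic_on \<alpha> (geodesic_disc p \<rho>) u \<and> deg (geodesic_disc p \<rho>) u = 1 \<and>
            (\<exists>q. \<forall>x\<in>geodesic_circle p \<rho>. u x = q))
       \<and> (\<exists>r1 r2 u. 0 < r1 \<and> r1 < r2 \<and> r2 < pi \<and>
            alpha_harmonic_on \<alpha> (sph_annulus r1 r2) u \<and> deg (sph_annulus r1 r2) u = 1 \<and>
            (\<exists>q\<in>S2. (\<forall>x\<in>sph_circle r1. u x = q) \<and> (\<forall>x\<in>sph_circle r2. u x = - q)))"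
proof -
  obtain P Q g P' P'' g' I \<theta> where sp: "symmetric_profile \<alpha> P Q g P' P'' g'" and I: "open I" "{-1..1} \<subseteq> I"
    and sm': "\<forall>k. Cn_on k P I" "\<forall>k. Cn_on k Q I" and even': "\<forall>z. P (- z) = P z" "\<forall>z. Q (- z) = - Q z"
    and c: "continuous_on {0..pi/2} \<theta>" and \<theta>0: "\<theta> 0 = 0" and \<theta>1: "\<theta> (pi / 2) = 3 * pi / 2"
    and \<theta>': "\<forall>r\<in>{0..pi/2}. sin (\<theta> r) = sin r * P (cos r) \<and> cos (\<theta> r) = Q (cos r)"
    using symmetric_solution[OF assms] by blast
  note sm = sm'[rule_format] and even = even'[rule_format] and \<theta> = \<theta>'[rule_format]
  interpret S: symmetric_profile \<alpha> P Q g P' P'' g' by (rule sp)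
  interpret N: symmetric_profile \<alpha> "\<lambda>z. - P z" "\<lambda>z. - Q z" g "\<lambda>z. - P' z" "\<lambda>z. - P'' z" g'
    by (rule symmetric_profile_antipodal[OF sp])
  let ?u = "sym_map P Q" and ?v = "sym_map (\<lambda>z. - P z) (\<lambda>z. - Q z)"
  have smu: "smooth_map_on (band c1 c2) ?u" "smooth_map_on (band c1 c2) ?v" for c1 c2
    by (rule smooth_sym_map[OF I]; use sm Cn_on_minus[OF I(1)] in \<open>auto simp: band_def\<close>)+
  have Q1: "Q 1 = 1" "Q (-1) = -1" using \<theta>[of 0] \<theta>0 even(2)[of 1] by auto
  \<comment> \<open>Where the angle passes pi: there sin f = 0 and cos f = -1, so the whole circle
    goes to the south pole.\<close>
  obtain r1 where r1: "0 \<le> r1" "r1 \<le> pi / 2" "\<theta> r1 = pi"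
    using IVT'[of \<theta> 0 pi "pi / 2"] c \<theta>0 \<theta>1 by auto
  have r1': "0 < r1" "r1 < pi / 2"
  proof -
    have "r1 \<noteq> 0" using r1(3) \<theta>0 by auto
    then show "0 < r1" using r1(1) by simp
    have "r1 \<noteq> pi / 2"
    proof
      assume "r1 = pi / 2"
      then have "\<theta> r1 = 3 * pi / 2" using \<theta>1 by (simp only:)
      then show False using r1(3) pi_gt_zero by linarith
    qed
    then show "r1 < pi / 2" using r1(2) by simp
  qed
  define z0 where "z0 = cos r1"
  have z0: "0 < z0" "z0 < 1"
    using r1' cos_gt_zero[of r1] cos_monotone_0_pi[of 0 r1] by (auto simp: z0_def)
  have Qz: "Q z0 = -1" "Q (- z0) = 1" "P z0 = 0" "P (- z0) = 0"
  proof -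
    have "sin r1 > 0" using r1' by (intro sin_gt_zero) auto
    then show "Q z0 = -1" "P z0 = 0" using \<theta>[of r1] r1 by (auto simp: z0_def)
    then show "Q (- z0) = 1" "P (- z0) = 0" using even by auto
  qed
  have x3: "x $ 3 \<in> {-1..1}" if "x \<in> S2" for x :: "real^3"
    using sphere_component_bounds[OF that, of 3] by auto

  have part1: "\<exists>f u. continuous_on {0..pi} f \<and> f 0 = 0 \<and> f pi = 3 * pi \<and> is_rot_sym_map f u \<and>
            alpha_harmonic_on \<alpha> S2 u \<and> deg S2 u = 1 \<and> \<not> is_rotation u \<and>
            alpha_energy \<alpha> u \<ge> 2 powr (3 * \<alpha> + 1) * pi"
  proof (intro exI conjI)
    \<comment> \<open>The reflected half uses 3 pi - \<theta> (pi - r); the halves match at the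
      equator because \<theta> is 3 pi / 2 there.\<close>
    define f where "f r = (if r \<le> pi / 2 then \<theta> r else 3 * pi - \<theta> (pi - r))" for r
    show "continuous_on {0..pi} f"
    proof -
      have "continuous_on ({0..pi/2} \<union> {pi/2..pi}) f"
        unfolding f_def
      proof (rule continuous_on_If)
        show "continuous_on {pi / 2..pi} (\<lambda>r. 3 * pi - \<theta> (pi - r))"
          by (intro continuous_intros continuous_on_compose2[OF c]) auto
        show "\<theta> r = 3 * pi - \<theta> (pi - r)" if "r \<in> {0..pi / 2}" "\<not> r \<le> pi / 2" for r
          using that by simp
        show "\<theta> r = 3 * pi - \<theta> (pi - r)" if "r \<in> {pi / 2..pi}" "r \<le> pi / 2" for r
        proof -
          have r: "r = pi / 2" using that by simp
          have "pi - pi / 2 = pi / 2" by simp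
          then show ?thesis unfolding r using \<theta>1 by simp
        qed
      qed (use c in auto)
      moreover have "{0..pi/2} \<union> {pi/2..pi} = {0..pi}" by auto
      ultimately show ?thesis by simp
    qed
    show "f 0 = 0" "f pi = 3 * pi" using \<theta>0 by (auto simp: f_def)
    have f: "sin (f r) = sin r * P (cos r) \<and> cos (f r) = Q (cos r)" if r: "r \<in> {0..pi}" for r
    proof (cases "r \<le> pi / 2")
      case True
      then show ?thesis using \<theta>[of r] r by (simp add: f_def)
    next
      case False
      have s3: "sin (3 * pi - y) = sin y" "cos (3 * pi - y) = - cos y" for y :: real
      proof -
        have e: "3 * pi - y = (pi - y) + 2 * pi" by simp
        show "sin (3 * pi - y) = sin y" "cos (3 * pi - y) = - cos y"
          unfolding e sin_periodic cos_periodic by simp_all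
      qed
      have "pi - r \<in> {0..pi/2}" using False r by auto
      from \<theta>[OF this] show ?thesis using False even by (simp add: f_def s3)
    qed
    show "is_rot_sym_map f ?u"
      unfolding is_rot_sym_map_def using f by (simp add: vec_eq_iff forall_3)
    show "alpha_harmonic_on \<alpha> S2 ?u"
      unfolding S2_eq_band by (rule S.alpha_harmonic_sym[OF _ _ _ smu(1)]) auto
    show "deg S2 ?u = 1"
      unfolding S2_eq_band by (subst S.deg_sym) (use Q1 in auto)
    show "alpha_energy \<alpha> ?u \<ge> 2 powr (3 * \<alpha> + 1) * pi"
      by (rule S.energy_lower_bound[OF assms z0 Qz(1,2) Q1])
    show "\<not> is_rotation ?u"
    proof
      assume "is_rotation ?u"
      then obtain R where R: "rotation_matrix R" "\<And>x. x \<in> S2 \<Longrightarrow> ?u x = R *v x" by (auto simp: is_rotation_def)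
      then have "orthogonal_transformation ((*v) R)"
        by (simp add: rotation_matrix_def orthogonal_transformation_matrix)
      then have inj: "inj ((*v) R)" by (rule orthogonal_transformation_inj)
      \<comment> \<open>P z0 = 0, so the circle r = r1 collapses to a point, whereas a rotation is
        injective.\<close>
      have "?u (sph r1 0) = ?u (sph r1 pi)"
        using Qz by (simp add: vec_eq_iff forall_3 z0_def)
      then have "R *v sph r1 0 = R *v sph r1 pi" using R(2) sph_in_S2 by metis
      then have "sph r1 0 = sph r1 pi" using inj by (auto dest: injD)
      then have "sph r1 0 $ 1 = sph r1 pi $ 1" by simp
      then have "sin r1 = 0" by simp
      moreover have "sin r1 > 0" using r1' by (intro sin_gt_zero) auto
      ultimately show False by simp
    qed
  qed

  have part2: "\<exists>p \<rho> u. p \<in> S2 \<and> 0 < \<rho> \<and> \<rho> < pi \<and>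
            alpha_harmonic_on \<alpha> (geodesic_disc p \<rho>) u \<and> deg (geodesic_disc p \<rho>) u = 1 \<and>
            (\<exists>q. \<forall>x\<in>geodesic_circle p \<rho>. u x = q)"
  proof (intro exI conjI ballI)
    show "(axis 3 1 :: real^3) \<in> S2" by (simp add: norm_axis_1)
    show "0 < r1" "r1 < pi" using r1' by auto
    have D: "geodesic_disc (axis 3 1) r1 = band z0 1"
      unfolding z0_def by (rule geodesic_disc_eq_band) (use r1' in auto)
    show "alpha_harmonic_on \<alpha> (geodesic_disc (axis 3 1) r1) ?u"
      unfolding D by (rule S.alpha_harmonic_sym[OF _ _ _ smu(1)]) (use z0 in auto)
    show "deg (geodesic_disc (axis 3 1) r1) ?u = 1"
      unfolding D by (subst S.deg_sym) (use z0 Q1 Qz in auto)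
    fix x assume "x \<in> geodesic_circle (axis 3 1) r1"
    then have "x \<in> S2" "arccos (x $ 3) = r1" by (auto simp: geodesic_circle_def inner_axis')
    then have "x $ 3 = z0" using x3[of x] by (auto simp: z0_def cos_arccos)
    then show "?u x = - axis 3 1" using Qz by (simp add: vec_eq_iff forall_3)
  qed

  have part3: "\<exists>r1 r2 u. 0 < r1 \<and> r1 < r2 \<and> r2 < pi \<and>
            alpha_harmonic_on \<alpha> (sph_annulus r1 r2) u \<and> deg (sph_annulus r1 r2) u = 1 \<and>
            (\<exists>q\<in>S2. (\<forall>x\<in>sph_circle r1. u x = q) \<and> (\<forall>x\<in>sph_circle r2. u x = - q))"
  proof (intro exI conjI bexI ballI)
    show "0 < r1" "r1 < pi - r1" "pi - r1 < pi" using r1' by auto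
    have A: "sph_annulus r1 (pi - r1) = band (- z0) z0"
      using sph_annulus_eq_band[of r1 "pi - r1"] r1' by (simp add: z0_def)
    show "alpha_harmonic_on \<alpha> (sph_annulus r1 (pi - r1)) ?v"
      unfolding A by (rule N.alpha_harmonic_sym[OF _ _ _ smu(2)]) (use z0 in auto)
    \<comment> \<open>Between the heights -z0 and z0, Q passes from 1 to -1, so the original map has
      degree -1 on this annulus; composing with the antipodal map makes it 1.\<close>
    show "deg (sph_annulus r1 (pi - r1)) ?v = 1"
      unfolding A by (subst N.deg_sym) (use z0 Qz in auto)
    show "(axis 3 1 :: real^3) \<in> S2" by (simp add: norm_axis_1)
    show "?v x = axis 3 1" if "x \<in> sph_circle r1" for x
      using that Qz by (auto simp: sph_circle_def z0_def vec_eq_iff forall_3)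
    show "?v x = - axis 3 1" if "x \<in> sph_circle (pi - r1)" for x
      using that Qz by (auto simp: sph_circle_def z0_def vec_eq_iff forall_3)
  qed

  show ?thesis using part1 part2 part3 by blast
qed

end
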